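(* Let $p>2$ be a prime, $\mathbf{F}$ a field of characteristic $p$, and $M\in\mathbf{F}^{2\times4}$ with $\gamma_{1234}(M)\neq0$ and $\gamma_{1235}(M)=\gamma_{1357}(M)=\gamma_{1245}(M)=0$. Then, by an admissible change of coordinates (see context), $M$ may be taken to be of the form $$M=\begin{pmatrix}1&c_{12}&c_{13}&0\\0&c_{22}&c_{23}&c_{24}\end{pmatrix},\qquad c_{24}\neq0,$$ (still satisfying the same conditions), and for $M$ of this form, with $\widehat{h_2}$, $N_M(y)$, $N_M(z)$ as defined in the context, the set $\mathcal B:=\{x,N_M(y),\widehat{h_2},N_M(z)\}$ is a SAGBI basis for $\mathbf{F}[V_M]^E$. Furthermore, $\mathbf{F}[V_M]^E$ is a hypersurface with the relation coming from the subduction of the tête-à-tête $(\widehat{h_2}^{p^2},N_M(y)^{p^2+1})$.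
   Context: For $M=(c_{ij})\in\mathbf{F}^{2\times4}$, $E=\langle e_1,e_2,e_3,e_4\rangle\cong(\mathbf{Z}/p)^4$ acts on $\mathbf{F}[V_M]=\mathbf{F}[x,y,z]$ (on the right, by algebra automorphisms) by $x\cdot e_j=x$, $y\cdot e_j=y+c_{1j}x$, $z\cdot e_j=z+2c_{1j}y+(c_{1j}^2+c_{2j})x$; $\mathbf{F}[V_M]^E$ is the ring of invariants. For $f\in\mathbf{F}[V_M]$, $N_M(f)$ is the product of the distinct elements of the $E$-orbit of $f$. Admissible change of coordinates: a change of generators of $E$ (replacing $M$ by $Mg$ with $g\in\mathrm{GL}_4(\mathbf{F}_p)$), and/or a change of basis $(x,y,z)\mapsto(cx,\,y,\,c^{-1}(z+ay))$ of $V_M^*$ with $c\in\mathbf{F}^\times$, $a\in\mathbf{F}$, which replaces each column $(c_{1j},c_{2j})^T$ of $M$ by $(c^{-1}c_{1j},\,c^{-2}(c_{2j}+ac_{1j}))^T$. Minors: $\Gamma(M)$ is the $10\times4$ matrix whose row $2k+1$ is $(c_{11}^{p^k},\dots,c_{14}^{p^k})$ and whose row $2k+2$ is $(c_{21}^{p^k},\dots,c_{24}^{p^k})$, $k=0,\dots,4$; $\gamma_{ijk\ell}(M)$ is its $4\times4$ minor with rows $i,j,k,\ell$, written $\bar\gamma_{ijk\ell}$. Put $\delta:=y^2-xz$ and $$\bar f_1:=\bar\gamma_{1234}y^{p^2}+\bar\gamma_{1235}\delta^px^{p^2-2p}+\bar\gamma_{1245}x^{p^2-p}y^p+\bar\gamma_{1345}\delta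 x^{p^2-2}+\bar\gamma_{2345}x^{p^2-1}y,$$ $$\bar f_{12346}:=-\bar\gamma_{1234}\delta^{p^2}+\bar\gamma_{1236}\delta^px^{2p^2-2p}+\bar\gamma_{1246}x^{2p^2-p}y^p+\bar\gamma_{1346}\delta x^{2p^2-2}+\bar\gamma_{2346}x^{2p^2-1}y,$$ $$\bar f_2:=\frac{\bar f_1^{\,2}+\bar\gamma_{1234}\bar f_{12346}}{2x^{p^2-2p}}.$$ For $M$ satisfying the hypotheses and of the displayed form, $N_M(y)=\bar f_1/\bar\gamma_{1234}=y^{p^2}-yx^{p^2-1}$, and $\widehat{h_2}:=-\bar f_2/(\bar\gamma_{1234}^2x^{2p-1})\in\mathbf{F}[V_M]^E$ has lead term $y^{p^2+1}$. Conventions: graded reverse lexicographic order with $x<y<z$; $\mathrm{LM}$, $\mathrm{LT}$ denote lead monomial and lead term (with coefficient). A finite subset $\mathcal B=\{b_1,\dots,b_m\}$ of a subalgebra $A$ of a polynomial ring is a SAGBI basis for $A$ if the monomials $\mathrm{LM}(b_i)$ generate the algebra spanned by the lead monomials of the elements of $A$. A tête-à-tête is a pair $(b^I,b^J)$ of products of elements of $\mathcal B$ with $\mathrm{LM}(b^I)=\mathrm{LM}(b^J)$. Its subduction: choose a scalar $c$ with $\mathrm{LT}(b^I)=\mathrm{LT}(cb^J)$ and repeatedly cancel the lead term of $b^I-cb^J$ by scalar multiples of products of elements of $\mathcal B$; if this ends at zero, it expresses $b^I-cb^J$ as a polynomial in $\mathcal B$, giving a relation. "Hypersurface with the relation coming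 from the subduction of" a tête-à-tête means that the kernel of the surjection from the polynomial ring on $m$ variables sending the variables to $b_1,\dots,b_m$ is the principal ideal generated by the relation so obtained. *)

theory Defs
  imports
    "HOL-Analysis.Determinants"
    "HOL-Library.Poly_Mapping"
    "HOL-Computational_Algebra.Primes"
begin

section \<open>Multivariate polynomials\<close>

text \<open>A monomial is its exponent vector \<^typ>\<open>'v \<Rightarrow>\<^sub>0 nat\<close>; the product of
  \<^typ>\<open>'b \<Rightarrow>\<^sub>0 'a\<close> is convolution, so the following is the polynomial ring over
  \<open>'a\<close> in variables indexed by \<open>'v\<close>.\<close>

type_synonym ('v, 'a) mpoly = "('v \<Rightarrow>\<^sub>0 nat) \<Rightarrow>\<^sub>0 'a"

definition pconst :: "'a::field \<Rightarrow> ('v::finite, 'a) mpoly" where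
  "pconst c = Poly_Mapping.single 0 c"

definition pmonom :: "('v::finite \<Rightarrow>\<^sub>0 nat) \<Rightarrow> ('v, 'a::field) mpoly" where
  "pmonom m = Poly_Mapping.single m 1"

definition pvar :: "'v::finite \<Rightarrow> ('v, 'a::field) mpoly" where
  "pvar v = pmonom (Poly_Mapping.single v 1)"

definition pscale :: "'a::field \<Rightarrow> ('v::finite, 'a) mpoly \<Rightarrow> ('v, 'a) mpoly" where
  "pscale c f = pconst c * f"

text \<open>The algebra homomorphism sending each variable \<open>v\<close> to \<open>\<phi> v\<close>.\<close>

definition psubst :: "('v::finite \<Rightarrow> ('w::finite, 'a::field) mpoly)
    \<Rightarrow> ('v, 'a) mpoly \<Rightarrow> ('w, 'a) mpoly" where
  "psubst \<phi> f = (\<Sum>m\<in>Poly_Mapping.keys f.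
     pscale (Poly_Mapping.lookup f m) (\<Prod>v\<in>UNIV. \<phi> v ^ Poly_Mapping.lookup m v))"

definition subalgebra :: "('v::finite, 'a::field) mpoly set \<Rightarrow> bool" where
  "subalgebra A \<longleftrightarrow> range pconst \<subseteq> A \<and> (\<forall>f\<in>A. \<forall>g\<in>A. f + g \<in> A \<and> f * g \<in> A)"

text \<open>Exact division: meaningful only if \<open>g \<noteq> 0\<close> divides \<open>f\<close>; the quotient is then unique
  because the polynomial ring is a domain.\<close>

definition exact_quot :: "('v::finite, 'a::field) mpoly \<Rightarrow> ('v, 'a) mpoly \<Rightarrow> ('v, 'a) mpoly" where
  "exact_quot f g = (THE q. q * g = f)"


section \<open>Lead terms and SAGBI bases\<close>

definition mdeg :: "('v::finite \<Rightarrow>\<^sub>0 nat) \<Rightarrow> nat" where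
  "mdeg m = (\<Sum>v\<in>UNIV. Poly_Mapping.lookup m v)"

text \<open>Graded reverse lexicographic order; the variables are ordered as their indices. In equal
  degree, the smaller monomial has the larger exponent at the smallest variable where the two
  differ.\<close>

definition grevlex_less :: "('v::{finite,linorder} \<Rightarrow>\<^sub>0 nat) \<Rightarrow> ('v \<Rightarrow>\<^sub>0 nat) \<Rightarrow> bool" where
  "grevlex_less m n \<longleftrightarrow> mdeg m < mdeg n \<or>
     mdeg m = mdeg n \<and> (\<exists>v. Poly_Mapping.lookup m v > Poly_Mapping.lookup n v \<and>
       (\<forall>u<v. Poly_Mapping.lookup m u = Poly_Mapping.lookup n u))"

text \<open>\<open>lead_exp\<close> and \<open>LM\<close> are meaningful for nonzero polynomials only; \<open>LT 0 = 0\<close>.\<close>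

definition lead_exp :: "('v::{finite,linorder}, 'a::field) mpoly \<Rightarrow> ('v \<Rightarrow>\<^sub>0 nat)" where
  "lead_exp f = (THE m. m \<in> Poly_Mapping.keys f \<and>
     (\<forall>n\<in>Poly_Mapping.keys f. n \<noteq> m \<longrightarrow> grevlex_less n m))"

definition LM :: "('v::{finite,linorder}, 'a::field) mpoly \<Rightarrow> ('v, 'a) mpoly" where
  "LM f = pmonom (lead_exp f)"

definition LT :: "('v::{finite,linorder}, 'a::field) mpoly \<Rightarrow> ('v, 'a) mpoly" where
  "LT f = pscale (Poly_Mapping.lookup f (lead_exp f)) (LM f)"

definition sagbi_basis ::
    "('v::{finite,linorder}, 'a::field) mpoly set \<Rightarrow> ('v, 'a) mpoly set \<Rightarrow> bool" where
  "sagbi_basis B A \<longleftrightarrow> subalgebra A \<and> finite B \<and> B \<subseteq> A \<and> 0 \<notin> B \<and>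
     subalgebra hull (LM ` B) = module.span pscale (LM ` (A - {0}))"


section \<open>Subduction and hypersurfaces\<close>

text \<open>A family \<open>b\<close> indexed by \<open>'w\<close> stands for \<open>\<B>\<close>. The product \<open>b\<^sup>I\<close> is
  \<open>bprod b I\<close>, the image of the monomial \<open>pmonom I\<close> of the polynomial ring in variables indexed
  by \<open>'w\<close>.\<close>

definition bprod :: "('w::finite \<Rightarrow> ('v::finite, 'a::field) mpoly) \<Rightarrow> ('w \<Rightarrow>\<^sub>0 nat)
    \<Rightarrow> ('v, 'a) mpoly" where
  "bprod b I = (\<Prod>w\<in>UNIV. b w ^ Poly_Mapping.lookup I w)"

definition tete_a_tete :: "('w::finite \<Rightarrow> ('v::{finite,linorder}, 'a::field) mpoly)
    \<Rightarrow> ('w \<Rightarrow>\<^sub>0 nat) \<Rightarrow> ('w \<Rightarrow>\<^sub>0 nat) \<Rightarrow> bool" where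
  "tete_a_tete b I J \<longleftrightarrow> LM (bprod b I) = LM (bprod b J)"

text \<open>\<open>subducts_to_zero b f P\<close>: some sequence of cancellations of lead terms takes \<open>f\<close> to
  zero, and \<open>P\<close> is the sum of the terms used, so that \<open>f = psubst b P\<close>.\<close>

inductive subducts_to_zero :: "('w::finite \<Rightarrow> ('v::{finite,linorder}, 'a::field) mpoly)
    \<Rightarrow> ('v, 'a) mpoly \<Rightarrow> ('w, 'a) mpoly \<Rightarrow> bool" for b where
  zero: "subducts_to_zero b 0 0"
| step: "\<lbrakk> f \<noteq> 0; LT f = LT (pscale c (bprod b K));
          subducts_to_zero b (f - pscale c (bprod b K)) P \<rbrakk>
        \<Longrightarrow> subducts_to_zero b f (pscale c (pmonom K) + P)"

definition subduction_relation :: "('w::finite \<Rightarrow> ('v::{finite,linorder}, 'a::field) mpoly)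
    \<Rightarrow> ('w \<Rightarrow>\<^sub>0 nat) \<Rightarrow> ('w \<Rightarrow>\<^sub>0 nat) \<Rightarrow> ('w, 'a) mpoly \<Rightarrow> bool" where
  "subduction_relation b I J R \<longleftrightarrow> (\<exists>c P.
     LT (bprod b I) = LT (pscale c (bprod b J)) \<and>
     subducts_to_zero b (bprod b I - pscale c (bprod b J)) P \<and>
     R = pmonom I - pscale c (pmonom J) - P)"

text \<open>A subduction involves choices of products with a given lead monomial. We demand that some
  subduction ends at zero and that every one that does yields a generator of the kernel.\<close>

definition hypersurface_by :: "('v::{finite,linorder}, 'a::field) mpoly set
    \<Rightarrow> ('w::finite \<Rightarrow> ('v, 'a) mpoly) \<Rightarrow> ('w \<Rightarrow>\<^sub>0 nat) \<Rightarrow> ('w \<Rightarrow>\<^sub>0 nat) \<Rightarrow> bool" where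
  "hypersurface_by A b I J \<longleftrightarrow>
     range (psubst b) = A \<and>
     tete_a_tete b I J \<and>
     (\<exists>R. subduction_relation b I J R) \<and>
     (\<forall>R. subduction_relation b I J R \<longrightarrow> {P. psubst b P = 0} = range (\<lambda>Q. Q * R))"


section \<open>The representation and its invariants\<close>

text \<open>Matrix indices are \<open>1, 2\<close> and \<open>1, \<dots>, 4\<close> (with \<open>4 = 0\<close> in the type \<^typ>\<open>4\<close>). The
  variables \<open>x < y < z\<close> have the indices \<open>0 < 1 < 2\<close> of the type \<^typ>\<open>3\<close>.\<close>

abbreviation px :: "(3, 'a::field) mpoly" where "px \<equiv> pvar 0"
abbreviation py :: "(3, 'a::field) mpoly" where "py \<equiv> pvar 1"
abbreviation pz :: "(3, 'a::field) mpoly" where "pz \<equiv> pvar 2"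

definition act_gen :: "'a::field^4^2 \<Rightarrow> 4 \<Rightarrow> (3, 'a) mpoly \<Rightarrow> (3, 'a) mpoly" where
  "act_gen M j = psubst (\<lambda>v.
     if v = 0 then px
     else if v = 1 then py + pscale (M$1$j) px
     else pz + pscale (2 * M$1$j) py + pscale ((M$1$j)^2 + M$2$j) px)"

text \<open>The element of \<open>E\<close> with exponent vector \<open>a\<close> is \<open>e\<^sub>1\<^bsup>a\<^sub>1\<^esup> \<dots> e\<^sub>4\<^bsup>a\<^sub>4\<^esup>\<close>; it acts on the
  right.\<close>

definition E_elems :: "nat \<Rightarrow> (nat^4) set" where
  "E_elems p = {a. \<forall>j. a$j < p}"

definition act :: "'a::field^4^2 \<Rightarrow> nat^4 \<Rightarrow> (3, 'a) mpoly \<Rightarrow> (3, 'a) mpoly" where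
  "act M a f =
     (act_gen M 4 ^^ (a$4)) ((act_gen M 3 ^^ (a$3)) ((act_gen M 2 ^^ (a$2)) ((act_gen M 1 ^^ (a$1)) f)))"

definition invariants :: "nat \<Rightarrow> 'a::field^4^2 \<Rightarrow> (3, 'a) mpoly set" where
  "invariants p M = {f. \<forall>a\<in>E_elems p. act M a f = f}"

definition orbit :: "nat \<Rightarrow> 'a::field^4^2 \<Rightarrow> (3, 'a) mpoly \<Rightarrow> (3, 'a) mpoly set" where
  "orbit p M f = (\<lambda>a. act M a f) ` E_elems p"

definition orbit_prod :: "nat \<Rightarrow> 'a::field^4^2 \<Rightarrow> (3, 'a) mpoly \<Rightarrow> (3, 'a) mpoly" where
  "orbit_prod p M f = \<Prod>(orbit p M f)"


section \<open>Admissible changes of coordinates\<close>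

text \<open>In characteristic \<open>p\<close> the set \<open>\<int>\<close>, the range of \<^const>\<open>of_int\<close>, is the prime field
  \<open>\<bold>F\<^sub>p\<close>.\<close>

definition GL4_prime_field :: "('a::field^4^4) set" where
  "GL4_prime_field = {g. (\<forall>i j. g$i$j \<in> \<int>) \<and>
     (\<exists>h. (\<forall>i j. h$i$j \<in> \<int>) \<and> g ** h = mat 1 \<and> h ** g = mat 1)}"

text \<open>The effect on the matrix of the basis change \<open>(x, y, z) \<mapsto> (cx, y, c\<^sup>-\<^sup>1(z + ay))\<close>.\<close>

definition basis_change :: "'a::field \<Rightarrow> 'a \<Rightarrow> 'a^4^2 \<Rightarrow> 'a^4^2" where
  "basis_change c a M = (\<chi> i j. if i = 1 then M$1$j / c else (M$2$j + a * M$1$j) / c^2)"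

definition admissible_change :: "'a::field^4^2 \<Rightarrow> 'a^4^2 \<Rightarrow> bool" where
  "admissible_change M M' \<longleftrightarrow>
     (\<exists>g c a. g \<in> GL4_prime_field \<and> c \<noteq> 0 \<and> M' = basis_change c a (M ** g))"


section \<open>Minors and the distinguished invariants\<close>

definition Gamma_row :: "nat \<Rightarrow> 'a::field^4^2 \<Rightarrow> nat \<Rightarrow> 'a^4" where
  "Gamma_row p M i = (\<chi> j. (if odd i then M$1$j else M$2$j) ^ (p ^ ((i - 1) div 2)))"

definition gam :: "nat \<Rightarrow> 'a::field^4^2 \<Rightarrow> nat \<Rightarrow> nat \<Rightarrow> nat \<Rightarrow> nat \<Rightarrow> 'a" where
  "gam p M i j k l =
     det (vector [Gamma_row p M i, Gamma_row p M j, Gamma_row p M k, Gamma_row p M l] :: 'a^4^4)"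

definition pdelta :: "(3, 'a::field) mpoly" where
  "pdelta = py^2 - px * pz"

definition f1 :: "nat \<Rightarrow> 'a::field^4^2 \<Rightarrow> (3, 'a) mpoly" where
  "f1 p M =
     pscale (gam p M 1 2 3 4) (py ^ (p^2))
   + pscale (gam p M 1 2 3 5) (pdelta ^ p * px ^ (p^2 - 2*p))
   + pscale (gam p M 1 2 4 5) (px ^ (p^2 - p) * py ^ p)
   + pscale (gam p M 1 3 4 5) (pdelta * px ^ (p^2 - 2))
   + pscale (gam p M 2 3 4 5) (px ^ (p^2 - 1) * py)"

definition f12346 :: "nat \<Rightarrow> 'a::field^4^2 \<Rightarrow> (3, 'a) mpoly" where
  "f12346 p M =
   - pscale (gam p M 1 2 3 4) (pdelta ^ (p^2))
   + pscale (gam p M 1 2 3 6) (pdelta ^ p * px ^ (2*p^2 - 2*p))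
   + pscale (gam p M 1 2 4 6) (px ^ (2*p^2 - p) * py ^ p)
   + pscale (gam p M 1 3 4 6) (pdelta * px ^ (2*p^2 - 2))
   + pscale (gam p M 2 3 4 6) (px ^ (2*p^2 - 1) * py)"

definition f2 :: "nat \<Rightarrow> 'a::field^4^2 \<Rightarrow> (3, 'a) mpoly" where
  "f2 p M = exact_quot ((f1 p M)^2 + pscale (gam p M 1 2 3 4) (f12346 p M))
                       (2 * px ^ (p^2 - 2*p))"

definition h2 :: "nat \<Rightarrow> 'a::field^4^2 \<Rightarrow> (3, 'a) mpoly" where
  "h2 p M = exact_quot (- f2 p M) (pscale ((gam p M 1 2 3 4)^2) (px ^ (2*p - 1)))"

definition minor_conditions :: "nat \<Rightarrow> 'a::field^4^2 \<Rightarrow> bool" where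
  "minor_conditions p M \<longleftrightarrow>
     gam p M 1 2 3 4 \<noteq> 0 \<and> gam p M 1 2 3 5 = 0 \<and> gam p M 1 3 5 7 = 0 \<and> gam p M 1 2 4 5 = 0"

definition normal_form :: "'a::field^4^2 \<Rightarrow> bool" where
  "normal_form M \<longleftrightarrow> M$1$1 = 1 \<and> M$1$4 = 0 \<and> M$2$1 = 0 \<and> M$2$4 \<noteq> 0"

end

theory Submission
  imports Defs "HOL-Computational_Algebra.Polynomial"
begin

text \<open> Write \<open>q = p\<^sup>2\<close>, let \<open>u\<close> and \<open>v\<close> be the rows of \<open>M\<close>, and let \<open>u\<^sup>p\<close>, \<open>u\<^sup>q\<close> denote
  entrywise powers.

  \<^bold>\<open>The normal form.\<close> If \<open>\<gamma>\<^sub>1\<^sub>2\<^sub>3\<^sub>4 \<noteq> 0\<close>, the rows \<open>u, v, u\<^sup>p, v\<^sup>p\<close> form a basis of \<open>\<bold>F\<^sup>4\<close>, and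
  the other minors can be read off from coordinates in this basis. The vanishing of \<open>\<gamma>\<^sub>1\<^sub>2\<^sub>3\<^sub>5\<close>
  and \<open>\<gamma>\<^sub>1\<^sub>2\<^sub>4\<^sub>5\<close> says \<open>u\<^sup>q = \<alpha>u + \<beta>v\<close>; then \<open>\<gamma>\<^sub>1\<^sub>3\<^sub>5\<^sub>7 = - \<beta>\<^bsup>p+1\<^esup> \<gamma>\<^sub>1\<^sub>2\<^sub>3\<^sub>4\<close>, so its vanishing
  says \<open>\<beta> = 0\<close>. Thus the hypotheses amount to \<open>\<gamma>\<^sub>1\<^sub>2\<^sub>3\<^sub>4 \<noteq> 0\<close> and \<open>u\<^sup>q = \<alpha>u\<close>
  (\<open>minor_conditions_iff\<close>). All \<open>p\<^sup>4\<close> combinations of the entries of \<open>u\<close> over the prime field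
  are roots of \<open>X\<^sup>q - \<alpha>X\<close>, so two of them coincide. This gives a linear relation over the prime
  field, which column operations turn into a zero entry of \<open>u\<close> (\<open>normal_form_exists\<close>).

  \<^bold>\<open>The group.\<close> In normal form \<open>u\<^sup>q = u\<close>. A group element is the shear \<open>y \<mapsto> y + sx\<close>, \<open>\<delta> \<mapsto> \<delta> -
  tx\<^sup>2\<close>, where \<open>(s, t)\<close> is an integral combination of the columns of \<open>M\<close>. There are \<open>q\<^sup>2\<close> such
  pairs, each \<open>s\<close> is a root of \<open>X\<^sup>q - X\<close>, and, given \<open>s\<close>, each \<open>t\<close> is a root of a monic
  polynomial of degree \<open>q\<close>. So there are exactly \<open>q\<close> values \<open>s\<close> and exactly \<open>q\<close> values \<open>t\<close> for
  each of them (\<open>card_shifts\<close>, \<open>card_fibre\<close>).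

  \<^bold>\<open>Lead monomials of invariants.\<close> Let \<open>N = y\<^sup>q - yx\<^bsup>q-1\<^esup>\<close> and let \<open>h\<close> be the third generator.
  Every polynomial, multiplied by a power of \<open>x\<close>, is a combination of the \<open>y\<^sup>i \<delta>\<^sup>j\<close> with \<open>i, j <
  q\<close> whose coefficients lie in \<open>\<bold>F[x, N, h]\<close>. For an invariant, the group gives \<open>q\<close> values of
  \<open>\<delta>\<close> and then \<open>q\<close> values of \<open>y\<close> at which this combination takes the same value, so it equals
  its constant coefficient: \<open>x\<^sup>k f \<in> \<bold>F[x, N, h]\<close> (\<open>localisation\<close>). Next, \<open>h\<^sup>q - N\<^bsup>q+1\<^esup> -
  x\<^bsup>q-1\<^esup>N\<^bsup>q-1\<^esup>h\<close> is divisible by \<open>x\<^sup>q\<close>, and \<open>-2\<close> times the quotient is an invariant \<open>Z\<close> with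
  lead monomial \<open>z\<^bsup>q\<^sup>2\<^esup>\<close> (\<open>two_power_relation\<close>). This relation is monic of degree \<open>q\<close> in \<open>h\<close>, so
  \<open>x\<^sup>k f\<close> is a combination of products of \<open>x, N, h, Z\<close> in which \<open>h\<close> has exponent less than \<open>q\<close>.
  Such products have the distinct lead monomials \<open>x\<^sup>a y\<^bsup>qb+(q+1)i\<^esup> z\<^bsup>q\<^sup>2 c\<^esup>\<close>, so one of them is
  the lead monomial of \<open>x\<^sup>k f\<close>; cancelling \<open>x\<^sup>k\<close> in it shows that the lead monomial of \<open>f\<close> is a
  product of \<open>x, y\<^sup>q, y\<^bsup>q+1\<^esup>, z\<^bsup>q\<^sup>2\<^esup>\<close> (\<open>lead_exp_invariant\<close>).

  \<^bold>\<open>Conclusion.\<close> These four monomials are also the lead monomials of \<open>x, N(y), h, N(z)\<close>, because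
  the orbits of \<open>y\<close> and \<open>z\<close> have \<open>q\<close> and \<open>q\<^sup>2\<close> elements. Hence these form a SAGBI basis
  (\<open>sagbi_basisI\<close>). Every subduction stops since only finitely many monomials lie below a given
  one. A relation \<open>R\<close> obtained from the tete-a-tete is monic of degree \<open>q\<close> in the third
  variable; the remainder of any relation modulo \<open>R\<close> has smaller degree and vanishes, since its
  terms have distinct lead monomials (\<open>hypersurface_byI\<close>). \<close>

abbreviation "lookup \<equiv> Poly_Mapping.lookup"
abbreviation "keys \<equiv> Poly_Mapping.keys"
abbreviation "single \<equiv> Poly_Mapping.single"

section \<open>Substitution homomorphisms\<close>

lemma pconst_0 [simp]: "pconst 0 = 0"
  and pconst_1 [simp]: "pconst 1 = 1"
  and pconst_add: "pconst (a + b) = pconst a + pconst b"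
  and pconst_mult: "pconst (a * b) = pconst a * pconst b"
  and pconst_uminus: "pconst (- a) = - pconst a"
  by (simp_all add: pconst_def single_add single_uminus mult_single)

lemma pconst_power: "pconst (a ^ n) = pconst a ^ n"
  by (induction n) (simp_all add: pconst_mult)

lemma pconst_of_nat [simp]: "pconst (of_nat n) = of_nat n"
  by (induction n) (simp_all add: pconst_add)

lemma pconst_numeral [simp]: "pconst (numeral n) = numeral n"
  by (metis of_nat_numeral pconst_of_nat)

lemma pscale_pmonom: "pscale c (pmonom m) = single m c"
  by (simp add: pscale_def pconst_def pmonom_def mult_single)

lemma pmonom_add: "pmonom (m + n) = pmonom m * pmonom n"
  by (simp add: pmonom_def mult_single)

lemma pmonom_0 [simp]: "pmonom 0 = 1"
  by (simp add: pmonom_def)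

lemma pmonom_neq_0 [simp]: "pmonom m \<noteq> 0"
  by (metis pmonom_def lookup_single_eq lookup_zero zero_neq_one)

lemma keys_pmonom [simp]: "keys (pmonom m) = {m}"
  by (simp add: pmonom_def)

lemma lookup_pscale [simp]: "lookup (pscale c f) m = c * lookup f m"
  unfolding pscale_def pconst_def
  by (simp flip: mult_map_scale_conv_mult add: Poly_Mapping.map.rep_eq when_def)

lemma keys_pscale: "c \<noteq> 0 \<Longrightarrow> keys (pscale c f) = keys f"
  by (auto simp: in_keys_iff)

lemma mpoly_eq_sum_monomials: "f = (\<Sum>m\<in>keys f. pscale (lookup f m) (pmonom m))"
proof (rule poly_mapping_eqI)
  fix k
  have "lookup (\<Sum>m\<in>keys f. pscale (lookup f m) (pmonom m)) k
      = (\<Sum>m\<in>keys f. if m = k then lookup f k else 0)"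
    by (auto simp: lookup_sum pscale_pmonom lookup_single when_def intro!: sum.cong)
  also have "\<dots> = lookup f k"
    by (auto simp: in_keys_iff)
  finally show "lookup f k = lookup (\<Sum>m\<in>keys f. pscale (lookup f m) (pmonom m)) k" by simp
qed

lemma eq_sum_unit_vectors:
  fixes m :: "'v::finite \<Rightarrow>\<^sub>0 nat"
  shows "m = (\<Sum>v\<in>UNIV. single v (lookup m v))"
  by (rule poly_mapping_eqI) (simp add: lookup_sum lookup_single when_def)

lemma pmonom_single: "pmonom (single v n) = pvar v ^ n"
proof (induction n)
  case (Suc n)
  have "single v (Suc n) = single v 1 + single v n" by (simp flip: single_add)
  then show ?case using Suc by (simp add: pmonom_add pvar_def)
qed simp

lemma pmonom_sum: "finite S \<Longrightarrow> pmonom (\<Sum>i\<in>S. g i) = (\<Prod>i\<in>S. pmonom (g i))"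
  by (induction S rule: finite_induct) (simp_all add: pmonom_add)

lemma pmonom_eq_bprod: "pmonom m = bprod pvar m"
proof -
  have "pmonom m = pmonom (\<Sum>v\<in>UNIV. single v (lookup m v))"
    by (simp flip: eq_sum_unit_vectors)
  then show ?thesis by (simp add: pmonom_sum pmonom_single bprod_def)
qed

text \<open>The polynomial ring is generated by constants and variables; identities between algebra
  homomorphisms and closure properties are proved by this induction.\<close>

lemma mpoly_induct [case_names const add var]:
  fixes f :: "('v::finite, 'a::field) mpoly"
  assumes c: "\<And>c. P (pconst c)" and a: "\<And>f g. P f \<Longrightarrow> P g \<Longrightarrow> P (f + g)"
    and v: "\<And>v f. P f \<Longrightarrow> P (pvar v * f)"
  shows "P f"
proof -
  have v': "P (pvar v ^ n * f)" if "P f" for v n f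
    by (induction n) (use that v in \<open>simp_all add: mult.assoc\<close>)
  have v'': "P ((\<Prod>v\<in>S. pvar v ^ e v) * f)" if "P f" "finite S" for S e f
    using that(2,1) by (induction S rule: finite_induct) (simp_all add: mult.assoc v')
  have m: "P (pscale c (pmonom m))" for c m
    using v''[OF c[of c], of UNIV "lookup m"]
    by (simp add: pmonom_eq_bprod bprod_def pscale_def mult.commute)
  have "P (\<Sum>m\<in>S. pscale (lookup f m) (pmonom m))" if "finite S" for S
    using that
  proof (induction S rule: finite_induct)
    case empty
    then show ?case using c[of 0] by simp
  qed (simp add: a m)
  then show ?thesis
    by (subst mpoly_eq_sum_monomials) simp
qed

text \<open>Summing over a common superset of the supports is what makes \<^const>\<open>psubst\<close> visibly additive.\<close>

lemma psubst_superset: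
  assumes "finite S" "keys f \<subseteq> S"
  shows "psubst \<phi> f = (\<Sum>m\<in>S. pscale (lookup f m) (bprod \<phi> m))"
  unfolding psubst_def bprod_def
  by (rule sum.mono_neutral_left) (use assms in \<open>auto simp: in_keys_iff pscale_def\<close>)

lemma pscale_add: "pscale (c + d) f = pscale c f + pscale d f"
  and pscale_add_right: "pscale c (f + g) = pscale c f + pscale c g"
  and pscale_pscale: "pscale c (pscale d f) = pscale (c * d) f"
  and pscale_1 [simp]: "pscale 1 f = f"
  and pscale_0 [simp]: "pscale 0 f = 0"
  and pscale_0_right [simp]: "pscale c 0 = 0"
  and pscale_mult_left: "pscale c f * g = pscale c (f * g)"
  and pscale_mult_right: "f * pscale c g = pscale c (f * g)"
  by (simp_all add: pscale_def pconst_add pconst_mult algebra_simps)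

lemma psubst_add: "psubst \<phi> (f + g) = psubst \<phi> f + psubst \<phi> g"
proof -
  let ?S = "keys f \<union> keys g"
  have "keys (f + g) \<subseteq> ?S" by (rule Poly_Mapping.keys_add)
  then show ?thesis
    by (simp add: psubst_superset[of ?S] lookup_add pscale_add sum.distrib)
qed

lemma psubst_0 [simp]: "psubst \<phi> 0 = 0"
  by (simp add: psubst_def)

lemma psubst_single: "psubst \<phi> (single m c) = pscale c (bprod \<phi> m)"
  by (simp add: psubst_superset[of "{m}"])

lemma psubst_pmonom: "psubst \<phi> (pmonom m) = bprod \<phi> m"
  by (simp add: pmonom_def psubst_single)

lemma bprod_0 [simp]: "bprod \<phi> 0 = 1"
  by (simp add: bprod_def)

lemma bprod_add: "bprod \<phi> (m + n) = bprod \<phi> m * bprod \<phi> n"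
  by (simp add: bprod_def lookup_add power_add prod.distrib)

lemma bprod_single: "bprod \<phi> (single w n) = \<phi> w ^ n"
proof -
  have "bprod \<phi> (single w n) = (\<Prod>v\<in>UNIV. if v = w then \<phi> w ^ n else 1)"
    unfolding bprod_def by (rule prod.cong) (auto simp: lookup_single when_def)
  then show ?thesis by simp
qed

lemma psubst_pconst [simp]: "psubst \<phi> (pconst c) = pconst c"
  by (simp add: pconst_def psubst_single) (simp add: pscale_def pconst_def)

lemma psubst_sum: "psubst \<phi> (\<Sum>i\<in>S. f i) = (\<Sum>i\<in>S. psubst \<phi> (f i))"
  by (induction S rule: infinite_finite_induct) (simp_all add: psubst_add)

lemma psubst_mult: "psubst \<phi> (f * g) = psubst \<phi> f * psubst \<phi> g"
proof -
  have "psubst \<phi> (f * g) = psubst \<phi> ((\<Sum>m\<in>keys f. pscale (lookup f m) (pmonom m))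
      * (\<Sum>n\<in>keys g. pscale (lookup g n) (pmonom n)))"
    using mpoly_eq_sum_monomials[of f] mpoly_eq_sum_monomials[of g] by simp
  also have "\<dots> = (\<Sum>m\<in>keys f. \<Sum>n\<in>keys g. psubst \<phi> (single (m + n) (lookup f m * lookup g n)))"
    by (simp add: sum_product psubst_sum pscale_pmonom mult_single)
  also have "\<dots> = (\<Sum>m\<in>keys f. pscale (lookup f m) (bprod \<phi> m))
      * (\<Sum>n\<in>keys g. pscale (lookup g n) (bprod \<phi> n))"
    by (simp add: sum_product psubst_single bprod_add pscale_def pconst_mult mult_ac)
  finally show ?thesis by (simp add: psubst_def bprod_def)
qed

lemma psubst_1 [simp]: "psubst \<phi> 1 = 1"
  using psubst_pconst[of \<phi> 1] by simp

lemma psubst_pscale: "psubst \<phi> (pscale c f) = pscale c (psubst \<phi> f)"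
  by (simp add: pscale_def psubst_mult)

lemma psubst_uminus: "psubst \<phi> (- f) = - psubst \<phi> f"
  using psubst_add[of \<phi> f "- f"] by (simp add: eq_neg_iff_add_eq_0 add.commute)

lemma psubst_diff: "psubst \<phi> (f - g) = psubst \<phi> f - psubst \<phi> g"
  using psubst_add[of \<phi> f "- g"] by (simp add: psubst_uminus)

lemma psubst_power: "psubst \<phi> (f ^ n) = psubst \<phi> f ^ n"
  by (induction n) (simp_all add: psubst_mult)

lemma psubst_prod: "psubst \<phi> (\<Prod>i\<in>S. f i) = (\<Prod>i\<in>S. psubst \<phi> (f i))"
  by (induction S rule: infinite_finite_induct) (simp_all add: psubst_mult)

lemma psubst_pvar [simp]: "psubst \<phi> (pvar v) = \<phi> v"
  by (simp add: pvar_def psubst_pmonom bprod_single)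

lemmas psubst_hom = psubst_add psubst_mult psubst_uminus psubst_diff psubst_power
  psubst_pscale psubst_prod psubst_sum

lemma psubst_compose: "psubst \<phi> (psubst \<psi> f) = psubst (\<lambda>v. psubst \<phi> (\<psi> v)) f"
  by (induction f rule: mpoly_induct) (simp_all add: psubst_hom)

lemma psubst_pvar_id: "psubst pvar f = f"
  by (induction f rule: mpoly_induct) (simp_all add: psubst_hom)

lemma subalgebra_range_psubst: "subalgebra (range (psubst \<phi>))"
  unfolding subalgebra_def
proof (intro conjI ballI)
  show "range pconst \<subseteq> range (psubst \<phi>)"
    by (metis image_subsetI psubst_pconst rangeI)
next
  fix f g assume "f \<in> range (psubst \<phi>)" "g \<in> range (psubst \<phi>)"
  then obtain P Q where "f = psubst \<phi> P" "g = psubst \<phi> Q" by blast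
  then have "f + g = psubst \<phi> (P + Q)" "f * g = psubst \<phi> (P * Q)"
    by (simp_all add: psubst_hom)
  then show "f + g \<in> range (psubst \<phi>)" "f * g \<in> range (psubst \<phi>)" by blast+
qed

lemma subalgebra_add: "subalgebra A \<Longrightarrow> f \<in> A \<Longrightarrow> g \<in> A \<Longrightarrow> f + g \<in> A"
  and subalgebra_mult: "subalgebra A \<Longrightarrow> f \<in> A \<Longrightarrow> g \<in> A \<Longrightarrow> f * g \<in> A"
  and subalgebra_pconst: "subalgebra A \<Longrightarrow> pconst c \<in> A"
  by (auto simp: subalgebra_def)

lemma subalgebra_0: "subalgebra A \<Longrightarrow> 0 \<in> A"
  and subalgebra_1: "subalgebra A \<Longrightarrow> 1 \<in> A"
  using subalgebra_pconst[of A 0] subalgebra_pconst[of A 1] by simp_all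

lemma subalgebra_pscale: "subalgebra A \<Longrightarrow> f \<in> A \<Longrightarrow> pscale c f \<in> A"
  by (simp add: pscale_def subalgebra_mult subalgebra_pconst)

lemma subalgebra_uminus: "subalgebra A \<Longrightarrow> f \<in> A \<Longrightarrow> - f \<in> A"
  using subalgebra_pscale[of A f "- 1"] by (simp add: pscale_def pconst_uminus)

lemma subalgebra_diff: "subalgebra A \<Longrightarrow> f \<in> A \<Longrightarrow> g \<in> A \<Longrightarrow> f - g \<in> A"
  using subalgebra_add[of A f "- g"] subalgebra_uminus by auto

lemma subalgebra_power: "subalgebra A \<Longrightarrow> f \<in> A \<Longrightarrow> f ^ n \<in> A"
  by (induction n) (simp_all add: subalgebra_1 subalgebra_mult)

lemma subalgebra_sum: "subalgebra A \<Longrightarrow> (\<And>i. i \<in> S \<Longrightarrow> f i \<in> A) \<Longrightarrow> sum f S \<in> A"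
  by (induction S rule: infinite_finite_induct) (simp_all add: subalgebra_0 subalgebra_add)

lemma subalgebra_prod: "subalgebra A \<Longrightarrow> (\<And>i. i \<in> S \<Longrightarrow> f i \<in> A) \<Longrightarrow> prod f S \<in> A"
  by (induction S rule: infinite_finite_induct) (simp_all add: subalgebra_1 subalgebra_mult)

lemmas subalgebra_closed = subalgebra_0 subalgebra_1 subalgebra_add subalgebra_mult
  subalgebra_pconst subalgebra_pscale subalgebra_uminus subalgebra_diff subalgebra_power
  subalgebra_sum subalgebra_prod

lemma bprod_in_subalgebra: "subalgebra A \<Longrightarrow> (\<And>w. b w \<in> A) \<Longrightarrow> bprod b K \<in> A"
  by (simp add: bprod_def subalgebra_closed)

lemma psubst_in_subalgebra: "subalgebra A \<Longrightarrow> (\<And>w. b w \<in> A) \<Longrightarrow> psubst b P \<in> A"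
  by (simp add: psubst_superset[of "keys P"] subalgebra_closed bprod_in_subalgebra)

section \<open>Lead exponents\<close>

lemma mdeg_add: "mdeg (m + n) = mdeg m + mdeg n"
  by (simp add: mdeg_def lookup_add sum.distrib)

lemma mdeg_single [simp]: "mdeg (single v n) = n"
  by (simp add: mdeg_def lookup_single when_def)

lemma mdeg_0 [simp]: "mdeg 0 = 0"
  by (simp add: mdeg_def)

lemma lookup_le_mdeg: "lookup m v \<le> mdeg m"
  unfolding mdeg_def by (rule member_le_sum) auto

lemma grevlex_irrefl: "\<not> grevlex_less m m"
  by (simp add: grevlex_less_def)

lemma grevlex_trans:
  assumes "grevlex_less k m" "grevlex_less m n"
  shows "grevlex_less k n"
proof (cases "mdeg k = mdeg m \<and> mdeg m = mdeg n")
  case True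
  with assms obtain v w where
    v: "lookup k v > lookup m v" "\<forall>u<v. lookup k u = lookup m u" and
    w: "lookup m w > lookup n w" "\<forall>u<w. lookup m u = lookup n u"
    by (auto simp: grevlex_less_def)
  have "lookup k (min v w) > lookup n (min v w) \<and> (\<forall>u<min v w. lookup k u = lookup n u)"
    using v w by (cases v w rule: linorder_cases) (auto simp: min_def)
  with True show ?thesis by (auto simp: grevlex_less_def)
qed (use assms in \<open>auto simp: grevlex_less_def\<close>)

lemma grevlex_asym: "grevlex_less m n \<Longrightarrow> \<not> grevlex_less n m"
  using grevlex_trans grevlex_irrefl by blast

lemma grevlex_total: "m \<noteq> n \<Longrightarrow> grevlex_less m n \<or> grevlex_less n m"
proof -
  assume "m \<noteq> n"
  let ?D = "{v. lookup m v \<noteq> lookup n v}"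
  have "?D \<noteq> {}" using \<open>m \<noteq> n\<close> by (auto simp: poly_mapping_eq_iff fun_eq_iff)
  define v where "v = Min ?D"
  have "v \<in> ?D" unfolding v_def by (rule Min_in) (use \<open>?D \<noteq> {}\<close> in auto)
  moreover have "\<forall>u<v. lookup m u = lookup n u"
    using Min_le[of ?D] unfolding v_def by (metis (mono_tags, lifting) finite linorder_not_le mem_Collect_eq)
  ultimately have "lookup m v > lookup n v \<and> (\<forall>u<v. lookup m u = lookup n u) \<or>
      lookup n v > lookup m v \<and> (\<forall>u<v. lookup n u = lookup m u)"
    by auto
  then show ?thesis unfolding grevlex_less_def by (metis linorder_less_linear)
qed

lemma not_grevlex_less_0: "\<not> grevlex_less n 0"
proof
  assume "grevlex_less n 0"
  then obtain v where "lookup n v > 0" "mdeg n = 0" by (auto simp: grevlex_less_def)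
  with lookup_le_mdeg[of n v] show False by simp
qed

lemma grevlex_add_mono: "grevlex_less m n \<Longrightarrow> grevlex_less (m + k) (n + k)"
  by (auto simp: grevlex_less_def mdeg_add lookup_add)

lemma grevlex_add_mono2:
  assumes "m = m' \<or> grevlex_less m m'" "n = n' \<or> grevlex_less n n'" "m \<noteq> m' \<or> n \<noteq> n'"
  shows "grevlex_less (m + n) (m' + n')"
  using assms grevlex_add_mono[of m m' n] grevlex_add_mono[of n n' m']
    grevlex_trans[of "m + n" "m' + n" "m' + n'"] by (auto simp: add.commute)

text \<open>A grevlex-smaller monomial has no larger total degree, which bounds all its exponents.\<close>

lemma finite_grevlex_below: "finite {n. grevlex_less n (m :: 'v::{finite,linorder} \<Rightarrow>\<^sub>0 nat)}"
proof (rule finite_subset)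
  show "{n. grevlex_less n m} \<subseteq> {n. mdeg n \<le> mdeg m}"
    by (auto simp: grevlex_less_def)
  have "lookup ` {n :: 'v \<Rightarrow>\<^sub>0 nat. mdeg n \<le> mdeg m} \<subseteq> PiE UNIV (\<lambda>_. {..mdeg m})"
    using lookup_le_mdeg order_trans by fastforce
  moreover have "finite (PiE UNIV (\<lambda>_::'v. {..mdeg m}))" by (intro finite_PiE) auto
  ultimately have "finite (lookup ` {n :: 'v \<Rightarrow>\<^sub>0 nat. mdeg n \<le> mdeg m})"
    by (rule finite_subset)
  then show "finite {n :: 'v \<Rightarrow>\<^sub>0 nat. mdeg n \<le> mdeg m}"
    by (rule finite_imageD) (simp add: inj_on_def poly_mapping_eqI)
qed

text \<open>Only finitely many monomials lie below a given one, so \<^const>\<open>grevlex_less\<close> supports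
  well-founded induction; this is why every subduction stops.\<close>

lemma grevlex_induct:
  assumes "\<And>m. (\<And>n. grevlex_less n m \<Longrightarrow> P n) \<Longrightarrow> P m"
  shows "P m"
proof (induction "card {n. grevlex_less n m}" arbitrary: m rule: less_induct)
  case less
  show ?case
  proof (rule assms)
    fix n assume n: "grevlex_less n m"
    have "{k. grevlex_less k n} \<subset> {k. grevlex_less k m}"
      using n grevlex_trans grevlex_irrefl by blast
    then show "P n" by (intro less psubset_card_mono finite_grevlex_below)
  qed
qed

lemma grevlex_max_exists:
  assumes "finite S" "S \<noteq> {}"
  shows "\<exists>m\<in>S. \<forall>n\<in>S. n \<noteq> m \<longrightarrow> grevlex_less n m"
  using assms
proof (induction S rule: finite_ne_induct)
  case (insert x S)
  then obtain m where m: "m \<in> S" "\<forall>n\<in>S. n \<noteq> m \<longrightarrow> grevlex_less n m" by blast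
  show ?case
  proof (cases "grevlex_less m x")
    case True
    then have "grevlex_less n x" if "n \<in> S" for n
      using that m grevlex_trans[of n m x] by (cases "n = m") simp_all
    then show ?thesis by blast
  next
    case False
    then have "x \<noteq> m \<longrightarrow> grevlex_less x m" using grevlex_total by blast
    then show ?thesis
      using m by blast
  qed
qed auto

lemma lead_exp_eqI:
  assumes "m \<in> keys f" "\<And>n. n \<in> keys f \<Longrightarrow> n \<noteq> m \<Longrightarrow> grevlex_less n m"
  shows "lead_exp f = m"
  unfolding lead_exp_def
proof (rule the_equality)
  fix k assume k: "k \<in> keys f \<and> (\<forall>n\<in>keys f. n \<noteq> k \<longrightarrow> grevlex_less n k)"
  show "k = m"
  proof (rule ccontr)
    assume "k \<noteq> m"
    with k assms have "grevlex_less k m" "grevlex_less m k" by simp_all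
    then show False using grevlex_asym[of k m] by simp
  qed
qed (use assms in simp)

lemma lead_exp:
  assumes "f \<noteq> 0"
  shows lead_exp_in_keys: "lead_exp f \<in> keys f"
    and lead_exp_max: "n \<in> keys f \<Longrightarrow> n \<noteq> lead_exp f \<Longrightarrow> grevlex_less n (lead_exp f)"
proof -
  from assms obtain m where "m \<in> keys f" "\<forall>n\<in>keys f. n \<noteq> m \<longrightarrow> grevlex_less n m"
    using grevlex_max_exists[of "keys f"] by auto
  moreover from this have "lead_exp f = m" by (intro lead_exp_eqI) auto
  ultimately show "lead_exp f \<in> keys f"
    "n \<in> keys f \<Longrightarrow> n \<noteq> lead_exp f \<Longrightarrow> grevlex_less n (lead_exp f)" by auto
qed

lemma lead_coeff_neq_0: "f \<noteq> 0 \<Longrightarrow> lookup f (lead_exp f) \<noteq> 0"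
  using lead_exp_in_keys in_keys_iff by fast

lemma lead_exp_pmonom [simp]: "lead_exp (pmonom m) = m"
  by (rule lead_exp_eqI) auto

lemma lead_exp_1 [simp]: "lead_exp 1 = 0"
  using lead_exp_pmonom[of 0] by simp

lemma pscale_eq_0_iff [simp]: "pscale c f = 0 \<longleftrightarrow> c = 0 \<or> f = 0"
  by (auto simp: poly_mapping_eq_iff fun_eq_iff)

lemma lead_exp_pscale: "c \<noteq> 0 \<Longrightarrow> lead_exp (pscale c f) = lead_exp f"
  by (simp add: lead_exp_def keys_pscale)

lemma lookup_mult_keys:
  fixes f g :: "('v::finite, 'a::field) mpoly"
  shows "lookup (f * g) k = (\<Sum>m\<in>keys f. \<Sum>n\<in>keys g. lookup f m * lookup g n when m + n = k)"
proof -
  have "f * g = (\<Sum>m\<in>keys f. pscale (lookup f m) (pmonom m))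
      * (\<Sum>n\<in>keys g. pscale (lookup g n) (pmonom n))"
    using mpoly_eq_sum_monomials[of f] mpoly_eq_sum_monomials[of g] by simp
  also have "\<dots> = (\<Sum>m\<in>keys f. \<Sum>n\<in>keys g. single (m + n) (lookup f m * lookup g n))"
    by (simp add: sum_product pscale_pmonom mult_single)
  finally show ?thesis by (simp add: lookup_sum lookup_single)
qed

text \<open>The order is compatible with products, so \<open>lead_exp f + lead_exp g\<close> arises from a single
  pair of monomials of \<open>f\<close> and \<open>g\<close>, and no cancellation is possible there.\<close>

lemma lead_exp_mult:
  assumes "f \<noteq> 0" "g \<noteq> 0"
  shows "lead_exp (f * g) = lead_exp f + lead_exp g"
proof -
  have less: "m + n \<noteq> lead_exp f + lead_exp g \<and> grevlex_less (m + n) (lead_exp f + lead_exp g)"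
    if "m \<in> keys f" "n \<in> keys g" "m \<noteq> lead_exp f \<or> n \<noteq> lead_exp g" for m n
    using grevlex_add_mono2[of m "lead_exp f" n "lead_exp g"] that lead_exp_max[OF assms(1)]
      lead_exp_max[OF assms(2)] grevlex_irrefl by metis
  have "lookup (f * g) (lead_exp f + lead_exp g) =
      (\<Sum>m\<in>keys f. \<Sum>n\<in>keys g. if m = lead_exp f \<and> n = lead_exp g
        then lookup f (lead_exp f) * lookup g (lead_exp g) else 0)"
    unfolding lookup_mult_keys by (intro sum.cong refl) (use less in \<open>auto simp: when_def\<close>)
  also have "\<dots> = (\<Sum>m\<in>keys f. if m = lead_exp f
      then \<Sum>n\<in>keys g. if n = lead_exp g then lookup f (lead_exp f) * lookup g (lead_exp g) else 0
      else 0)"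
    by (intro sum.cong refl) auto
  also have "\<dots> = lookup f (lead_exp f) * lookup g (lead_exp g)"
    using lead_exp_in_keys[OF assms(1)] lead_exp_in_keys[OF assms(2)] by simp
  finally have *: "lookup (f * g) (lead_exp f + lead_exp g)
      = lookup f (lead_exp f) * lookup g (lead_exp g)" .
  show "lead_exp (f * g) = lead_exp f + lead_exp g"
  proof (rule lead_exp_eqI)
    show "lead_exp f + lead_exp g \<in> keys (f * g)"
      using * assms by (simp add: in_keys_iff lead_coeff_neq_0)
  next
    fix n assume "n \<in> keys (f * g)" "n \<noteq> lead_exp f + lead_exp g"
    then show "grevlex_less n (lead_exp f + lead_exp g)"
      using Poly_Mapping.keys_mult[of f g] less by blast
  qed
qed

lemma LM_mult: "f \<noteq> 0 \<Longrightarrow> g \<noteq> 0 \<Longrightarrow> LM (f * g) = LM f * LM g"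
  by (simp add: LM_def lead_exp_mult pmonom_add)

lemma LM_1 [simp]: "LM 1 = 1"
  by (simp add: LM_def)

lemma lead_exp_power:
  assumes "f \<noteq> 0"
  shows "lookup (lead_exp (f ^ n)) v = n * lookup (lead_exp f) v"
proof (induction n)
  case (Suc n)
  have "f ^ n \<noteq> 0" using assms by simp
  with Suc assms show ?case by (simp add: lead_exp_mult lookup_add)
qed simp

lemma lead_exp_prod:
  assumes "finite S" "\<And>i. i \<in> S \<Longrightarrow> f i \<noteq> 0"
  shows "lookup (lead_exp (prod f S)) v = (\<Sum>i\<in>S. lookup (lead_exp (f i)) v)"
  using assms by (induction S rule: finite_induct) (simp_all add: lead_exp_mult lookup_add)

lemma bprod_neq_0:
  fixes b :: "'w::finite \<Rightarrow> ('v::{finite,linorder}, 'a::field) mpoly"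
  shows "(\<And>w. b w \<noteq> 0) \<Longrightarrow> bprod b K \<noteq> 0"
  by (simp add: bprod_def)

lemma lead_exp_bprod:
  assumes "\<And>w. b w \<noteq> 0"
  shows "lookup (lead_exp (bprod b K)) v = (\<Sum>w\<in>UNIV. lookup K w * lookup (lead_exp (b w)) v)"
  unfolding bprod_def using assms by (subst lead_exp_prod) (simp_all add: lead_exp_power)

lemma LT_eq_single: "LT f = single (lead_exp f) (lookup f (lead_exp f))"
  by (simp add: LT_def LM_def pscale_pmonom)

lemma LT_0 [simp]: "LT 0 = 0"
  by (simp add: LT_eq_single)

lemma LT_eq_0_iff: "LT f = 0 \<longleftrightarrow> f = 0"
  by (metis LT_0 LT_eq_single lead_coeff_neq_0 lookup_single_eq lookup_zero)

lemma LT_eqD: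
  assumes "LT f = LT g" "f \<noteq> 0"
  shows "g \<noteq> 0" "lead_exp g = lead_exp f" "lookup g (lead_exp f) = lookup f (lead_exp f)"
proof -
  show "g \<noteq> 0" using assms LT_eq_0_iff by metis
  have "keys (LT f) = {lead_exp f}" "keys (LT g) = {lead_exp g}"
    using \<open>f \<noteq> 0\<close> \<open>g \<noteq> 0\<close> by (simp_all add: LT_eq_single lead_coeff_neq_0)
  then show *: "lead_exp g = lead_exp f" using assms by simp
  show "lookup g (lead_exp f) = lookup f (lead_exp f)"
    using assms(1) * by (metis LT_eq_single lookup_single_eq)
qed

lemma LT_eqI:
  "lead_exp f = lead_exp g \<Longrightarrow> lookup f (lead_exp f) = lookup g (lead_exp g) \<Longrightarrow> LT f = LT g"
  by (simp add: LT_eq_single)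

text \<open>One step of a subduction: equal lead terms cancel, and what remains is smaller.\<close>

lemma lead_exp_diff_less:
  assumes "LT f = LT g" "f \<noteq> 0" "f - g \<noteq> 0"
  shows "grevlex_less (lead_exp (f - g)) (lead_exp f)"
proof -
  let ?m = "lead_exp (f - g)"
  note g = LT_eqD[OF assms(1,2)]
  have m: "?m \<in> keys (f - g)" using assms(3) by (rule lead_exp_in_keys)
  then have "?m \<noteq> lead_exp f" using g(3) by (auto simp: in_keys_iff lookup_minus)
  moreover have "?m \<in> keys f \<or> ?m \<in> keys g" using m by (auto simp: in_keys_iff lookup_minus)
  ultimately show ?thesis using lead_exp_max assms(2) g(1,2) by metis
qed

text \<open>The largest of the lead exponents occurs in only one summand, so it cannot cancel. This is
  the source of linear independence in all that follows.\<close>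

lemma lead_exp_sum_distinct:
  fixes g :: "'k \<Rightarrow> ('v::{finite,linorder}, 'a::field) mpoly"
  assumes S: "finite S" "S \<noteq> {}" and g: "\<And>k. k \<in> S \<Longrightarrow> g k \<noteq> 0" "\<And>k. k \<in> S \<Longrightarrow> c k \<noteq> 0"
    and inj: "inj_on (\<lambda>k. lead_exp (g k)) S"
  shows "(\<Sum>k\<in>S. pscale (c k) (g k)) \<noteq> 0"
    and "\<exists>k\<in>S. lead_exp (\<Sum>k\<in>S. pscale (c k) (g k)) = lead_exp (g k)"
proof -
  let ?f = "\<Sum>k\<in>S. pscale (c k) (g k)"
  obtain k where k: "k \<in> S"
    and max: "\<And>j. j \<in> S \<Longrightarrow> lead_exp (g j) \<noteq> lead_exp (g k) \<Longrightarrow>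
      grevlex_less (lead_exp (g j)) (lead_exp (g k))"
    using grevlex_max_exists[of "(\<lambda>k. lead_exp (g k)) ` S"] S by auto
  have less: "grevlex_less (lead_exp (g j)) (lead_exp (g k))" if "j \<in> S" "j \<noteq> k" for j
    using max that k inj by (metis inj_onD)
  have below: "n = lead_exp (g k) \<and> j = k \<or> grevlex_less n (lead_exp (g k))"
    if "j \<in> S" "n \<in> keys (g j)" for j n
    using lead_exp_max[OF g(1), of j n] that less[of j] grevlex_trans by metis
  have "lookup ?f (lead_exp (g k)) = (\<Sum>j\<in>S. if j = k then c k * lookup (g k) (lead_exp (g k)) else 0)"
    unfolding lookup_sum lookup_pscale
  proof (intro sum.cong refl)
    fix j assume "j \<in> S"
    then show "c j * lookup (g j) (lead_exp (g k)) =
        (if j = k then c k * lookup (g k) (lead_exp (g k)) else 0)"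
      using below[of j "lead_exp (g k)"] grevlex_irrefl by (auto simp: in_keys_iff)
  qed
  also have "\<dots> \<noteq> 0" using k S(1) g by (simp add: lead_coeff_neq_0)
  finally have in_keys: "lead_exp (g k) \<in> keys ?f" by (simp add: in_keys_iff)
  then show "?f \<noteq> 0" by auto
  have "lead_exp ?f = lead_exp (g k)"
  proof (rule lead_exp_eqI[OF in_keys])
    fix n assume n: "n \<in> keys ?f" "n \<noteq> lead_exp (g k)"
    then have "(\<Sum>j\<in>S. c j * lookup (g j) n) \<noteq> 0" by (simp add: in_keys_iff lookup_sum)
    then obtain j where "j \<in> S" "c j * lookup (g j) n \<noteq> 0"
      by (rule sum.not_neutral_contains_not_neutral)
    then show "grevlex_less n (lead_exp (g k))"
      using below[of j n] n(2) by (simp add: in_keys_iff)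
  qed
  with k show "\<exists>k\<in>S. lead_exp ?f = lead_exp (g k)" by blast
qed

section \<open>Homogeneous polynomials\<close>

text \<open>Homogeneity serves to find lead exponents: among monomials of one degree, \<open>x\<close> occurring
  makes a monomial smaller.\<close>

definition homogeneous :: "nat \<Rightarrow> ('v::finite, 'a::field) mpoly \<Rightarrow> bool" where
  "homogeneous d f \<longleftrightarrow> (\<forall>m\<in>keys f. mdeg m = d)"

lemma homogeneous_1: "homogeneous 0 1"
  by (simp add: homogeneous_def)

lemma homogeneous_pvar: "homogeneous 1 (pvar v)"
  by (simp add: homogeneous_def pvar_def)

lemma homogeneous_add: "homogeneous d f \<Longrightarrow> homogeneous d g \<Longrightarrow> homogeneous d (f + g)"
  using Poly_Mapping.keys_add[of f g] by (auto simp: homogeneous_def)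

lemma homogeneous_uminus: "homogeneous d f \<Longrightarrow> homogeneous d (- f)"
  by (auto simp: homogeneous_def in_keys_iff)

lemma homogeneous_diff: "homogeneous d f \<Longrightarrow> homogeneous d g \<Longrightarrow> homogeneous d (f - g)"
  using homogeneous_add[of d f "- g"] homogeneous_uminus by auto

lemma homogeneous_pscale: "homogeneous d f \<Longrightarrow> homogeneous d (pscale c f)"
  by (auto simp: homogeneous_def in_keys_iff)

lemma homogeneous_mult: "homogeneous d f \<Longrightarrow> homogeneous e g \<Longrightarrow> homogeneous (d + e) (f * g)"
  using Poly_Mapping.keys_mult[of f g] by (auto simp: homogeneous_def mdeg_add dest!: subsetD)

lemma homogeneous_power: "homogeneous d f \<Longrightarrow> homogeneous (n * d) (f ^ n)"
  by (induction n) (simp_all add: homogeneous_1 homogeneous_mult)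

section \<open>Subduction\<close>

lemma subducts_to_zero_psubst: "subducts_to_zero b f P \<Longrightarrow> psubst b P = f"
  by (induction rule: subducts_to_zero.induct) (simp_all add: psubst_hom psubst_pmonom)

text \<open>The lead exponents of the terms of a subduction descend from that of its input. This
  bounds the relation that it produces.\<close>

lemma subducts_to_zero_keys:
  assumes "subducts_to_zero b f P" "K \<in> keys P"
  shows "f \<noteq> 0 \<and> (lead_exp (bprod b K) = lead_exp f \<or> grevlex_less (lead_exp (bprod b K)) (lead_exp f))"
  using assms
proof (induction arbitrary: K rule: subducts_to_zero.induct)
  case (step f c L P)
  have c: "c \<noteq> 0" and lead: "lead_exp (bprod b L) = lead_exp f"
    using LT_eqD(1,2)[OF step.hyps(2,1)] by (auto simp: lead_exp_pscale)
  from step.prems consider "K = L" | "K \<in> keys P"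
    using Poly_Mapping.keys_add[of "pscale c (pmonom L)" P] c by (auto simp: keys_pscale)
  then show ?case
  proof cases
    case 1
    with lead step.hyps(1) show ?thesis by simp
  next
    case 2
    note IH = step.IH[OF this]
    then have "grevlex_less (lead_exp (f - pscale c (bprod b L))) (lead_exp f)"
      using step.hyps by (intro lead_exp_diff_less) auto
    with IH step.hyps(1) grevlex_trans show ?thesis by metis
  qed
qed simp

text \<open>If each lead monomial of \<open>A\<close> is that of a product of generators, the lead term can always
  be cancelled inside \<open>A\<close>, and the lead exponents decrease.\<close>

lemma subducts_to_zero_exists:
  fixes b :: "'w::finite \<Rightarrow> ('v::{finite,linorder}, 'a::field) mpoly"
  assumes A: "subalgebra A" "\<And>w. b w \<in> A" "\<And>w. b w \<noteq> 0"
    and lead: "\<And>f. f \<in> A \<Longrightarrow> f \<noteq> 0 \<Longrightarrow> \<exists>K. lead_exp f = lead_exp (bprod b K)"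
    and "f \<in> A"
  shows "\<exists>P. subducts_to_zero b f P"
proof -
  have "\<forall>f\<in>A. f \<noteq> 0 \<longrightarrow> lead_exp f = m \<longrightarrow> (\<exists>P. subducts_to_zero b f P)" for m
  proof (induction m rule: grevlex_induct)
    case (1 m)
    show ?case
    proof (intro ballI impI)
      fix f assume f: "f \<in> A" "f \<noteq> 0" "lead_exp f = m"
      from lead[OF f(1,2)] obtain K where K: "lead_exp f = lead_exp (bprod b K)" by blast
      have bK: "bprod b K \<noteq> 0" using A(3) by (rule bprod_neq_0)
      define c where "c = lookup f m / lookup (bprod b K) m"
      have c: "c \<noteq> 0" and cK: "c * lookup (bprod b K) m = lookup f m"
        using lead_coeff_neq_0[OF f(2)] lead_coeff_neq_0[OF bK] K f(3) by (auto simp: c_def)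
      have LT: "LT f = LT (pscale c (bprod b K))"
        using K f(3) cK c by (intro LT_eqI) (simp_all add: lead_exp_pscale)
      let ?g = "f - pscale c (bprod b K)"
      have "\<exists>P. subducts_to_zero b ?g P"
      proof (cases "?g = 0")
        case True
        then show ?thesis by (metis subducts_to_zero.zero)
      next
        case False
        then have "grevlex_less (lead_exp ?g) m"
          using lead_exp_diff_less[OF LT f(2)] f(3) by simp
        moreover have "?g \<in> A" using A f(1) by (intro subalgebra_closed bprod_in_subalgebra)
        ultimately show ?thesis using 1 False by blast
      qed
      then show "\<exists>P. subducts_to_zero b f P"
        using subducts_to_zero.step[OF f(2) LT] by blast
    qed
  qed
  then show ?thesis using \<open>f \<in> A\<close> by (cases "f = 0") (auto intro: subducts_to_zero.zero)
qed

lemma range_psubst_eqI: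
  fixes b :: "'w::finite \<Rightarrow> ('v::{finite,linorder}, 'a::field) mpoly"
  assumes "subalgebra A" "\<And>w. b w \<in> A" "\<And>w. b w \<noteq> 0"
    and "\<And>f. f \<in> A \<Longrightarrow> f \<noteq> 0 \<Longrightarrow> \<exists>K. lead_exp f = lead_exp (bprod b K)"
  shows "range (psubst b) = A"
proof
  show "range (psubst b) \<subseteq> A" using psubst_in_subalgebra[OF assms(1), of b] assms(2) by blast
  show "A \<subseteq> range (psubst b)"
    using subducts_to_zero_exists[OF assms] subducts_to_zero_psubst by (metis rangeI subsetI)
qed

section \<open>SAGBI bases\<close>

interpretation mpoly_module: module "pscale :: 'a::field \<Rightarrow> ('v::finite, 'a) mpoly \<Rightarrow> _"
  by standard (simp_all add: pscale_add pscale_add_right pscale_pscale)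

lemma subalgebra_hull: "subalgebra (subalgebra hull X)"
  by (rule hull_in) (auto simp: subalgebra_def)

lemma LM_bprod:
  fixes b :: "'w::finite \<Rightarrow> ('v::{finite,linorder}, 'a::field) mpoly"
  assumes "\<And>w. b w \<noteq> 0"
  shows "LM (bprod b K) = (\<Prod>w\<in>UNIV. LM (b w) ^ lookup K w)"
proof -
  have power: "LM (f ^ n) = LM f ^ n" if "f \<noteq> 0" for f :: "('v, 'a) mpoly" and n
    by (induction n) (use that in \<open>simp_all add: LM_mult\<close>)
  have "LM (\<Prod>w\<in>S. b w ^ lookup K w) = (\<Prod>w\<in>S. LM (b w) ^ lookup K w)" for S
    using finite[of S] by (induction S rule: finite_induct) (use assms in \<open>simp_all add: LM_mult power\<close>)
  then show ?thesis by (simp add: bprod_def)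
qed

text \<open>Lead monomials are multiplicative, so those of \<open>A\<close> span an algebra; by hypothesis each of
  them is a product of lead monomials of generators.\<close>

lemma sagbi_basisI:
  fixes b :: "'w::finite \<Rightarrow> ('v::{finite,linorder}, 'a::field) mpoly"
  assumes A: "subalgebra A" and b: "\<And>w. b w \<in> A" "\<And>w. b w \<noteq> 0"
    and lead: "\<And>f. f \<in> A \<Longrightarrow> f \<noteq> 0 \<Longrightarrow> \<exists>K. lead_exp f = lead_exp (bprod b K)"
  shows "sagbi_basis (range b) A"
proof -
  let ?H = "subalgebra hull (LM ` range b)"
  let ?S = "module.span pscale (LM ` (A - {0})) :: ('v, 'a) mpoly set"
  note H = subalgebra_hull[of "LM ` range b"]
  have "LM f \<in> ?H" if f: "f \<in> A" "f \<noteq> 0" for f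
  proof -
    from lead[OF f] obtain K where "LM f = LM (bprod b K)" by (auto simp: LM_def)
    also have "\<dots> \<in> ?H"
      unfolding LM_bprod[OF b(2)] using H by (intro subalgebra_closed hull_inc) auto
    finally show ?thesis .
  qed
  moreover have "mpoly_module.subspace ?H"
    using H by (intro mpoly_module.subspaceI subalgebra_closed)
  ultimately have "?S \<subseteq> ?H" by (intro mpoly_module.span_minimal) auto
  moreover have "subalgebra ?S"
    unfolding subalgebra_def
  proof (intro conjI ballI)
    have "1 \<in> ?S"
      by (rule mpoly_module.span_base) (use subalgebra_1[OF A] LM_1 in \<open>auto intro!: image_eqI[of _ _ 1]\<close>)
    then have "pscale c 1 \<in> ?S" for c by (rule mpoly_module.span_scale)
    then show "range pconst \<subseteq> ?S" by (auto simp: pscale_def)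
  next
    fix f g assume f: "f \<in> ?S" and g: "g \<in> ?S"
    then show "f + g \<in> ?S" by (rule mpoly_module.span_add)
    have *: "m * n \<in> ?S" if "m \<in> LM ` (A - {0})" "n \<in> LM ` (A - {0})" for m n
    proof -
      from that obtain h k where "h \<in> A - {0}" "m = LM h" "k \<in> A - {0}" "n = LM k" by blast
      then have "m * n = LM (h * k)" "h * k \<in> A - {0}"
        using A by (auto simp: LM_mult subalgebra_mult)
      then show ?thesis by (auto intro: mpoly_module.span_base)
    qed
    have **: "m * g \<in> ?S" if "m \<in> LM ` (A - {0})" for m
      using g
    proof (induction rule: mpoly_module.span_induct_alt)
      case base
      show ?case by (simp add: mpoly_module.span_zero)
    next
      case (step c n h)
      have "m * (pscale c n + h) = pscale c (m * n) + m * h"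
        by (simp add: distrib_left pscale_mult_right)
      then show ?case
        using *[OF that step(1)] step(2)
        by (simp add: mpoly_module.span_add mpoly_module.span_scale)
    qed
    show "f * g \<in> ?S"
      using f
    proof (induction rule: mpoly_module.span_induct_alt)
      case base
      show ?case by (simp add: mpoly_module.span_zero)
    next
      case (step c m h)
      have "(pscale c m + h) * g = pscale c (m * g) + h * g"
        by (simp add: distrib_right pscale_mult_left)
      then show ?case
        using **[OF step(1)] step(2)
        by (simp add: mpoly_module.span_add mpoly_module.span_scale)
    qed
  qed
  then have "?H \<subseteq> ?S"
    by (intro hull_minimal) (use b in \<open>auto intro!: mpoly_module.span_base\<close>)
  ultimately show ?thesis
    unfolding sagbi_basis_def using A b by auto
qed

section \<open>Hypersurfaces\<close>

text \<open>The polynomials of degree less than \<open>q\<close> in the variable \<open>w\<close>: the remainders after division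
  by a polynomial that is monic of degree \<open>q\<close> in \<open>w\<close>.\<close>

definition reduced :: "'w::finite \<Rightarrow> nat \<Rightarrow> ('w, 'a::field) mpoly \<Rightarrow> bool" where
  "reduced w q P \<longleftrightarrow> (\<forall>K\<in>keys P. lookup K w < q)"

text \<open>A monomial whose \<open>w\<close>-exponent is at least \<open>q\<close> can be rewritten with the relation, which
  lowers this exponent; hence an induction on the exponent.\<close>

lemma division_by_monic:
  fixes P :: "('w::finite, 'a::field) mpoly"
  assumes "reduced w q P0" and R: "R = pmonom (single w q) - P0"
  shows "\<exists>Q S. P = Q * R + S \<and> reduced w q S"
proof -
  define D where "D = {P. \<exists>Q S. P = Q * R + S \<and> reduced w q S}"
  have add: "P1 + P2 \<in> D" if "P1 \<in> D" "P2 \<in> D" for P1 P2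
  proof -
    from that obtain Q1 S1 Q2 S2 where
      "P1 = Q1 * R + S1" "reduced w q S1" "P2 = Q2 * R + S2" "reduced w q S2"
      unfolding D_def by blast
    then have "P1 + P2 = (Q1 + Q2) * R + (S1 + S2)" "reduced w q (S1 + S2)"
      using Poly_Mapping.keys_add[of S1 S2] by (auto simp: reduced_def algebra_simps)
    then show ?thesis unfolding D_def by blast
  qed
  have scale: "pscale c P \<in> D" if "P \<in> D" for c P
  proof -
    from that obtain Q S where "P = Q * R + S" "reduced w q S"
      unfolding D_def by blast
    then have "pscale c P = pscale c Q * R + pscale c S" "reduced w q (pscale c S)"
      by (auto simp: reduced_def pscale_add_right pscale_mult_left in_keys_iff)
    then show ?thesis unfolding D_def by blast
  qed
  have zero: "0 \<in> D"
    unfolding D_def by (rule CollectI, rule exI[of _ 0], rule exI[of _ 0]) (simp add: reduced_def)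
  have combine: "P \<in> D" if "\<And>K. K \<in> keys P \<Longrightarrow> pmonom K \<in> D" for P
  proof -
    have "(\<Sum>m\<in>T. pscale (lookup P m) (pmonom m)) \<in> D" if "T \<subseteq> keys P" for T
      using finite_subset[OF that finite_keys] that
      by (induction T rule: finite_induct) (auto simp: zero intro!: add scale \<open>\<And>K. K \<in> keys P \<Longrightarrow> pmonom K \<in> D\<close>)
    from this[OF order_refl] show ?thesis by (simp flip: mpoly_eq_sum_monomials)
  qed
  have monom: "pmonom K \<in> D" if "lookup K w = n" for n K
    using that
  proof (induction n arbitrary: K rule: less_induct)
    case (less n)
    show ?case
    proof (cases "n < q")
      case True
      then have "reduced w q (pmonom K :: ('w, 'a) mpoly)" using less.prems by (simp add: reduced_def)
      moreover have "pmonom K = 0 * R + pmonom K" by simp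
      ultimately show ?thesis unfolding D_def by blast
    next
      case False
      define L where "L = K - single w q"
      have K: "K = L + single w q"
        using False less.prems
        by (intro poly_mapping_eqI) (auto simp: L_def lookup_add lookup_minus lookup_single when_def)
      have "pmonom K = pmonom L * R + pmonom L * P0"
        by (simp add: K pmonom_add R algebra_simps)
      moreover have "pmonom L * R \<in> D"
        unfolding D_def by (rule CollectI, rule exI[of _ "pmonom L"], rule exI[of _ 0])
          (simp add: reduced_def)
      moreover have "pmonom L * P0 \<in> D"
      proof (rule combine)
        fix N assume "N \<in> keys (pmonom L * P0)"
        then obtain J where "J \<in> keys P0" "N = L + J"
          using Poly_Mapping.keys_mult[of "pmonom L" P0] by auto
        then have "lookup N w < n"
          using assms(1) False less.prems
          by (auto simp: reduced_def L_def lookup_add lookup_minus)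
        then show "pmonom N \<in> D" using less.IH by blast
      qed
      ultimately show ?thesis using add by metis
    qed
  qed
  have "P \<in> D" by (rule combine) (rule monom[OF refl])
  then show ?thesis by (simp add: D_def)
qed

lemma lead_exp_psubst_reduced:
  fixes b :: "'w::finite \<Rightarrow> ('v::{finite,linorder}, 'a::field) mpoly"
  assumes b: "\<And>w. b w \<noteq> 0"
    and inj: "inj_on (\<lambda>K. lead_exp (bprod b K)) {K. lookup K w < q}"
    and P: "reduced w q P" "P \<noteq> 0"
  shows "psubst b P \<noteq> 0" "\<exists>K. lead_exp (psubst b P) = lead_exp (bprod b K)"
proof -
  have eq: "psubst b P = (\<Sum>K\<in>keys P. pscale (lookup P K) (bprod b K))"
    by (rule psubst_superset) auto
  have inj': "inj_on (\<lambda>K. lead_exp (bprod b K)) (keys P)"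
    by (rule inj_on_subset[OF inj]) (use P in \<open>auto simp: reduced_def\<close>)
  have "keys P \<noteq> {}" using P by simp
  note * = lead_exp_sum_distinct[OF finite_keys this bprod_neq_0[of b] _ inj', of "lookup P"]
  show "psubst b P \<noteq> 0" "\<exists>K. lead_exp (psubst b P) = lead_exp (bprod b K)"
    unfolding eq using * b by (auto simp: in_keys_iff)
qed

text \<open>The terms subtracted in a subduction of \<open>b\<^sub>w\<^sup>q - c b\<^sup>J\<close> have smaller lead exponents than
  \<open>b\<^sub>w\<^sup>q\<close>, so none of them is a multiple of it, and the relation is monic of degree \<open>q\<close> in \<open>w\<close>.
  Dividing an element of the kernel by it leaves a reduced element of the kernel, which is zero
  because reduced products have distinct lead exponents.\<close>

lemma hypersurface_byI:
  fixes b :: "'w::finite \<Rightarrow> ('v::{finite,linorder}, 'a::field) mpoly"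
  assumes A: "subalgebra A" and b: "\<And>w. b w \<in> A" "\<And>w. b w \<noteq> 0"
    and lead: "\<And>f. f \<in> A \<Longrightarrow> f \<noteq> 0 \<Longrightarrow> \<exists>K. lead_exp f = lead_exp (bprod b K)"
    and inj: "inj_on (\<lambda>K. lead_exp (bprod b K)) {K. lookup K w < q}"
    and J: "lookup J w < q" "lead_exp (bprod b (single w q)) = lead_exp (bprod b J)"
  shows "hypersurface_by A b (single w q) J"
proof -
  let ?I = "single w q"
  have bK: "bprod b K \<noteq> 0" for K using b(2) by (rule bprod_neq_0)
  have bA: "bprod b K \<in> A" for K using A b(1) by (rule bprod_in_subalgebra)
  have "\<exists>R. subduction_relation b ?I J R"
  proof -
    let ?m = "lead_exp (bprod b J)"
    define c where "c = lookup (bprod b ?I) ?m / lookup (bprod b J) ?m"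
    have "lookup (bprod b ?I) ?m \<noteq> 0" "lookup (bprod b J) ?m \<noteq> 0"
      using lead_coeff_neq_0[OF bK[of ?I]] lead_coeff_neq_0[OF bK[of J]] J(2) by simp_all
    then have "LT (bprod b ?I) = LT (pscale c (bprod b J))"
      using J(2) by (intro LT_eqI) (simp_all add: c_def lead_exp_pscale)
    moreover have "\<exists>P. subducts_to_zero b (bprod b ?I - pscale c (bprod b J)) P"
      using A bA by (intro subducts_to_zero_exists[OF A b lead] subalgebra_closed)
    ultimately show ?thesis unfolding subduction_relation_def by blast
  qed
  moreover have "{P. psubst b P = 0} = range (\<lambda>Q. Q * R)" if "subduction_relation b ?I J R" for R
  proof -
    from that obtain c P where
      LT: "LT (bprod b ?I) = LT (pscale c (bprod b J))" and
      sub: "subducts_to_zero b (bprod b ?I - pscale c (bprod b J)) P" and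
      R: "R = pmonom ?I - pscale c (pmonom J) - P"
      unfolding subduction_relation_def by blast
    have R0: "psubst b R = 0"
      using subducts_to_zero_psubst[OF sub] by (simp add: R psubst_hom psubst_pmonom)
    have "lookup K w < q" if "K \<in> keys P" for K
    proof (rule ccontr)
      \<comment> \<open>Otherwise \<open>b\<^sup>K\<close> would be a multiple of \<open>b\<^sub>w\<^sup>q\<close>, whose lead exponent is strictly larger.\<close>
      assume "\<not> lookup K w < q"
      then have "K = (K - ?I) + ?I"
        by (intro poly_mapping_eqI) (auto simp: lookup_add lookup_minus lookup_single when_def)
      then have "lead_exp (bprod b K) = lead_exp (bprod b (K - ?I)) + lead_exp (bprod b ?I)"
        using bK by (metis bprod_add lead_exp_mult)
      moreover have "grevlex_less (lead_exp (bprod b K)) (lead_exp (bprod b ?I))"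
      proof -
        let ?f = "bprod b ?I - pscale c (bprod b J)"
        have "?f \<noteq> 0" and K: "lead_exp (bprod b K) = lead_exp ?f \<or>
            grevlex_less (lead_exp (bprod b K)) (lead_exp ?f)"
          using subducts_to_zero_keys[OF sub that] by blast+
        from \<open>?f \<noteq> 0\<close> have less: "grevlex_less (lead_exp ?f) (lead_exp (bprod b ?I))"
          by (intro lead_exp_diff_less LT bK)
        from K show ?thesis using grevlex_trans[OF _ less] less by (elim disjE) simp_all
      qed
      moreover have "\<not> grevlex_less (m + n) n" for m n :: "'v \<Rightarrow>\<^sub>0 nat"
      proof (cases "m = 0")
        case False
        then have "grevlex_less 0 m" using grevlex_total[of m 0] not_grevlex_less_0 by blast
        then have "grevlex_less n (m + n)" using grevlex_add_mono[of 0 m n] by simp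
        then show ?thesis by (rule grevlex_asym)
      qed (simp add: grevlex_irrefl)
      ultimately show False by simp
    qed
    then have red: "reduced w q (pscale c (pmonom J) + P)"
      using Poly_Mapping.keys_add[of "pscale c (pmonom J)" P] J(1)
      by (cases "c = 0") (auto simp: reduced_def keys_pscale)
    have "\<exists>Q. P' = Q * R" if P': "psubst b P' = 0" for P'
    proof -
      obtain Q S where QS: "P' = Q * R + S" "reduced w q S"
        using division_by_monic[OF red, of R P'] R by (auto simp: algebra_simps)
      then have "psubst b S = 0" using P' R0 by (simp add: psubst_hom)
      then have "S = 0" using lead_exp_psubst_reduced(1)[OF b(2) inj QS(2)] by blast
      with QS show ?thesis by auto
    qed
    then show ?thesis using R0 by (auto simp: psubst_hom)
  qed
  moreover have "range (psubst b) = A" using A b lead by (rule range_psubst_eqI)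
  ultimately show ?thesis
    unfolding hypersurface_by_def tete_a_tete_def using J(2) by (auto simp: LM_def)
qed

section \<open>Counting roots\<close>

lemma card_roots_monic_le:
  fixes r :: "'a::field poly"
  assumes "degree r < n"
  shows "finite {x. x ^ n = poly r x}" "card {x. x ^ n = poly r x} \<le> n"
proof -
  let ?P = "monom 1 n - r"
  have "degree (- r + monom 1 n) = degree (monom (1::'a) n)"
    by (rule degree_add_eq_right) (use assms in \<open>simp add: degree_monom_eq\<close>)
  then have "degree ?P = n" by (simp add: degree_monom_eq)
  moreover from this have "?P \<noteq> 0" using assms by auto
  moreover have "{x. x ^ n = poly r x} = {x. poly ?P x = 0}" by (simp add: poly_monom)
  ultimately show "finite {x. x ^ n = poly r x}" "card {x. x ^ n = poly r x} \<le> n"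
    using poly_roots_finite[of ?P] card_poly_roots_bound[of ?P] by simp_all
qed

text \<open>The polynomial \<open>\<Sum> c\<^sub>j T\<^sup>j - C\<close> has degree less than \<open>n\<close> and \<open>n\<close> roots, so it is zero.\<close>

lemma constant_coeff_eq:
  fixes c :: "nat \<Rightarrow> 'r::idom"
  assumes "n > 0" "n \<le> card A" "\<And>r. r \<in> A \<Longrightarrow> (\<Sum>j<n. c j * r ^ j) = C"
  shows "c 0 = C"
proof -
  let ?P = "\<Sum>j<n. monom (c j) j"
  have "degree ?P < n"
    by (rule degree_sum_less) (use assms(1) degree_monom_le le_less_trans in \<open>auto, blast\<close>)
  then have "?P = [:C:]"
    using assms by (intro poly_eqI_degree[of A]) (auto simp: poly_sum poly_monom)
  then have "C = poly ?P 0" by simp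
  also have "\<dots> = (\<Sum>j<n. c j * 0 ^ j)" by (simp add: poly_sum poly_monom)
  also have "\<dots> = (\<Sum>j\<in>{0}. c j * 0 ^ j)"
    by (rule sum.mono_neutral_right) (use assms(1) in \<open>auto simp: power_0_left\<close>)
  finally show ?thesis by simp
qed

section \<open>Shears\<close>

lemma var3_distinct [simp]: "(1::3) \<noteq> 0" "(2::3) \<noteq> 0" "(2::3) \<noteq> 1" "(0::3) \<noteq> 1" "(0::3) \<noteq> 2" "(1::3) \<noteq> 2"
  by simp_all

text \<open>The common shape of all group elements; \<open>shear_pdelta\<close> explains the parametrisation: \<open>y\<close>
  is translated by \<open>sx\<close> and \<open>\<delta>\<close> by \<open>- tx\<^sup>2\<close>.\<close>

definition shear :: "'a::field \<Rightarrow> 'a \<Rightarrow> (3, 'a) mpoly \<Rightarrow> (3, 'a) mpoly" where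
  "shear s t = psubst (\<lambda>v. if v = 0 then px else if v = 1 then py + pscale s px
     else pz + pscale (2 * s) py + pscale (s^2 + t) px)"

lemma shear_px [simp]: "shear s t px = px"
  and shear_py [simp]: "shear s t py = py + pscale s px"
  and shear_pz [simp]: "shear s t pz = pz + pscale (2 * s) py + pscale (s^2 + t) px"
  by (simp_all add: shear_def)

lemma shear_hom: "shear s t (f + g) = shear s t f + shear s t g"
  "shear s t (f * g) = shear s t f * shear s t g"
  "shear s t (- f) = - shear s t f"
  "shear s t (f - g) = shear s t f - shear s t g"
  "shear s t (f ^ n) = shear s t f ^ n"
  "shear s t (pscale c f) = pscale c (shear s t f)"
  "shear s t (pconst c) = pconst c"
  "shear s t 1 = 1"
  "shear s t (numeral k) = numeral k"
  "shear s t 0 = 0"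
  "shear s t (prod h S) = (\<Prod>i\<in>S. shear s t (h i))"
  "shear s t (sum h S) = (\<Sum>i\<in>S. shear s t (h i))"
  using psubst_pconst[where c = "numeral k"] by (simp_all add: shear_def psubst_hom)

lemma shear_pdelta: "shear s t pdelta = pdelta - pscale t (px^2)"
  by (simp add: pdelta_def shear_hom pscale_def pconst_mult pconst_add pconst_power
      power2_eq_square algebra_simps)

lemma shear_shear: "shear s t (shear s' t' f) = shear (s + s') (t + t') f"
proof -
  have "shear s t (pz + pscale (2 * s') py + pscale (s'^2 + t') px)
      = pz + pscale (2 * (s + s')) py + pscale ((s + s')^2 + (t + t')) px"
    by (simp add: shear_hom pscale_def pconst_mult pconst_add pconst_power power2_eq_square
        algebra_simps)
  moreover have "shear s t (py + pscale s' px) = py + pscale (s + s') px"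
    by (simp add: shear_hom pscale_add)
  ultimately have "(\<lambda>v. shear s t (if v = 0 then px else if v = 1 then py + pscale s' px
     else pz + pscale (2 * s') py + pscale (s'^2 + t') px)) =
     (\<lambda>v. if v = 0 then px else if v = 1 then py + pscale (s + s') px
     else pz + pscale (2 * (s + s')) py + pscale ((s + s')^2 + (t + t')) px)"
    by (simp add: fun_eq_iff)
  then show ?thesis
    unfolding shear_def psubst_compose by (rule arg_cong[where f = "\<lambda>\<phi>. psubst \<phi> f"])
qed

lemma shear_0 [simp]: "shear 0 0 f = f"
proof -
  have "(\<lambda>v. if v = 0 then px else if v = 1 then py else pz) = (pvar :: 3 \<Rightarrow> (3, 'a) mpoly)"
    using exhaust_3 by (fastforce simp: fun_eq_iff)
  then show ?thesis by (simp add: shear_def psubst_pvar_id cong: if_cong)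
qed

lemma shear_inj: "shear s t f = shear s t g \<Longrightarrow> f = g"
  by (metis shear_shear shear_0 add.left_inverse)

lemma pvar_neq_0 [simp]: "pvar v \<noteq> 0"
  by (simp add: pvar_def)

lemma pconst_inj: "pconst c = pconst d \<longleftrightarrow> c = d"
  by (simp add: pconst_def inj_single[THEN inj_eq])

lemma char_mpoly: "CHAR((3, 'a::field) mpoly) = CHAR('a)"
proof (rule CHAR_eqI)
  show "of_nat CHAR('a) = (0 :: (3, 'a) mpoly)"
    by (metis of_nat_CHAR pconst_0 pconst_of_nat)
next
  fix n assume "of_nat n = (0 :: (3, 'a) mpoly)"
  then have "pconst (of_nat n) = (pconst 0 :: (3, 'a) mpoly)" by simp
  then show "CHAR('a) dvd n" unfolding pconst_inj by (simp add: of_nat_eq_0_iff_char_dvd)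
qed

lemma pscale_left_cancel: "pscale c f = pscale d f \<longleftrightarrow> c = d \<or> f = 0"
  for f :: "(3, 'a::field) mpoly"
  by (auto simp: pscale_def pconst_inj)

section \<open>Finite groups of shears\<close>

text \<open>For a matrix in normal form, \<open>G\<close> consists of the pairs \<open>(s, t)\<close> by which the group acts,
  and \<open>a, b, c, d\<close> are the coordinates of \<open>v\<^sup>q\<close> in the basis \<open>u, v, u\<^sup>p, v\<^sup>p\<close>, where \<open>u, v\<close> are
  the rows of the matrix.\<close>

locale shear_group =
  fixes p q :: nat and a b c d :: "'a::field" and G :: "('a \<times> 'a) set"
  assumes prime_p: "prime p" and p_gt_2: "p > 2" and char_p: "CHAR('a) = p" and q: "q = p^2"
    and G_fst: "(s, t) \<in> G \<Longrightarrow> s ^ q = s"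
    and G_snd: "(s, t) \<in> G \<Longrightarrow> t ^ q = a * s + b * t + c * s ^ p + d * t ^ p"
    and G_add: "(s, t) \<in> G \<Longrightarrow> (s', t') \<in> G \<Longrightarrow> (s + s', t + t') \<in> G"
    and card_G: "card G = q^2"
begin

text \<open>These bounds keep all exponents such as \<open>q - 2p\<close> free of truncation.\<close>

lemma q_ge: "q \<ge> 3 * p" "q \<ge> 9"
proof -
  show 1: "q \<ge> 3 * p" using p_gt_2 by (simp add: q power2_eq_square)
  show "q \<ge> 9" using 1 p_gt_2 by linarith
qed

lemma finite_G: "finite G"
  using card_G q_ge by (intro card_ge_0_finite) simp

definition shifts :: "'a set" where
  "shifts = fst ` G"

definition fibre :: "'a \<Rightarrow> 'a set" where
  "fibre s = {t. (s, t) \<in> G}"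

text \<open>Both bounds \<open>\<le> q\<close> come from counting roots; since there are \<open>q\<^sup>2\<close> pairs in all, they are
  attained.\<close>

lemma card_shifts: "card shifts = q"
  and card_fibre: "s \<in> shifts \<Longrightarrow> card (fibre s) = q"
proof -
  have S: "finite shifts" using finite_G by (simp add: shifts_def)
  have sub: "shifts \<subseteq> {x. x ^ q = poly [:0, 1:] x}"
    using G_fst by (auto simp: shifts_def)
  have "degree [:0, 1::'a:] < q" using q_ge by simp
  note roots = card_roots_monic_le[OF this]
  have le: "card shifts \<le> q" using card_mono[OF roots(1) sub] roots(2) by (rule order_trans)
  have fib: "finite (fibre s)" "card (fibre s) \<le> q" for s
  proof -
    let ?r = "[:a * s + c * s ^ p, b:] + monom d p"
    have "degree ?r \<le> max 1 p"
      by (intro degree_add_le_max[THEN order_trans] max.mono) (auto simp: degree_monom_le)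
    then have "degree ?r < q" using q_ge p_gt_2 by simp
    note roots = card_roots_monic_le[OF this]
    have sub: "fibre s \<subseteq> {x. x ^ q = poly ?r x}"
      using G_snd by (auto simp: fibre_def poly_monom algebra_simps)
    then show "finite (fibre s)" using roots(1) by (rule finite_subset)
    show "card (fibre s) \<le> q" using card_mono[OF roots(1) sub] roots(2) by (rule order_trans)
  qed
  have "G = Sigma shifts fibre" by (auto simp: shifts_def fibre_def image_iff) (metis fst_conv)
  then have "card G = (\<Sum>s\<in>shifts. card (fibre s))"
    using S fib(1) by (metis card_SigmaI)
  then have sum: "(\<Sum>s\<in>shifts. card (fibre s)) = q * q"
    using card_G by (simp add: power2_eq_square)
  have "q * q \<le> card shifts * q"
    using sum_bounded_above[of shifts "\<lambda>s. card (fibre s)" q] fib(2) sum by simp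
  then have "q \<le> card shifts" using q_ge by simp
  with le show eq: "card shifts = q" by simp
  show "card (fibre s) = q" if "s \<in> shifts"
  proof (rule ccontr)
    assume "card (fibre s) \<noteq> q"
    then have "card (fibre s) < q" using fib(2)[of s] by simp
    then have "(\<Sum>s\<in>shifts. card (fibre s)) < (\<Sum>s\<in>shifts. q)"
      using fib(2) that S by (intro sum_strict_mono_ex1) auto
    then show False using sum eq by simp
  qed
qed

lemma frobenius_add: "(f + g) ^ p = f ^ p + g ^ p" "(f + g) ^ q = f ^ q + g ^ q"
  for f g :: "(3, 'a) mpoly"
proof -
  have C: "CHAR((3, 'a) mpoly) = p" by (simp add: char_mpoly char_p)
  show "(f + g) ^ p = f ^ p + g ^ p"
    by (rule freshmans_dream) (simp_all add: C prime_p)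
  show "(f + g) ^ q = f ^ q + g ^ q"
    by (rule freshmans_dream'[where n = 2]) (simp_all add: C prime_p q)
qed

lemma odd_p: "odd p" and odd_q: "odd q"
  using prime_p p_gt_2 by (simp_all add: q prime_odd_nat)

lemma frobenius_diff: "(f - g) ^ p = f ^ p - g ^ p" "(f - g) ^ q = f ^ q - g ^ q"
  for f g :: "(3, 'a) mpoly"
  using frobenius_add[of f "- g"] odd_p odd_q by simp_all

lemma two_power_q: "(2 :: (3, 'a) mpoly) ^ q = 2"
  using frobenius_add(2)[of 1 1] by simp

lemma two_neq_0: "(2 :: 'a) \<noteq> 0" "(2 :: (3, 'a) mpoly) \<noteq> 0"
proof -
  have "\<not> p dvd 2" using p_gt_2 by (simp add: nat_dvd_not_less)
  then show "(2 :: 'a) \<noteq> 0" "(2 :: (3, 'a) mpoly) \<noteq> 0"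
    using of_nat_eq_0_iff_char_dvd[of 2, where ?'a = 'a] char_p
      of_nat_eq_0_iff_char_dvd[of 2, where ?'a = "(3, 'a) mpoly"] char_mpoly[where ?'a = 'a] by simp_all
qed

lemma half: "2 * pscale (1 / 2) f = f" for f :: "(3, 'a) mpoly"
  using two_neq_0 by (simp add: pscale_def flip: pconst_numeral mult.assoc pconst_mult)

definition Inv :: "(3, 'a) mpoly set" where
  "Inv = {f. \<forall>(s, t)\<in>G. shear s t f = f}"

lemma Inv_iff: "f \<in> Inv \<longleftrightarrow> (\<forall>s t. (s, t) \<in> G \<longrightarrow> shear s t f = f)"
  by (auto simp: Inv_def)

lemma subalgebra_Inv: "subalgebra Inv"
  by (auto simp: subalgebra_def Inv_iff shear_hom)

lemma Inv_cancel: "f * g \<in> Inv \<Longrightarrow> f \<in> Inv \<Longrightarrow> f \<noteq> 0 \<Longrightarrow> g \<in> Inv"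
  by (auto simp: Inv_iff shear_hom)

lemma px_Inv: "px \<in> Inv"
  by (simp add: Inv_iff)

definition normY :: "(3, 'a) mpoly" where
  "normY = py ^ q - py * px ^ (q - 1)"

text \<open>The tail of the third generator: \<open>2h = 2y\<^bsup>q+1\<^esup> - x\<cdot>htail\<close>. Carrying out the divisions in
  the definition of \<open>h2\<close> by hand gives these terms.\<close>

definition htail :: "(3, 'a) mpoly" where
  "htail = pz ^ q + px ^ (q - 2) * py ^ 2 + pscale d (pdelta ^ p * px ^ (q - 2 * p))
     - pscale c (px ^ (q - p) * py ^ p) + pscale b (pdelta * px ^ (q - 2)) - pscale a (px ^ (q - 1) * py)"

text \<open>The explicit form of the third generator \<^const>\<open>h2\<close> of a matrix in normal form.\<close>

definition hpoly :: "(3, 'a) mpoly" where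
  "hpoly = py ^ (q + 1) - pscale (1 / 2) (px * htail)"

text \<open>The explicit form of \<open>f12346 / \<gamma>\<^sub>1\<^sub>2\<^sub>3\<^sub>4\<close>. Up to powers of \<open>x\<close> it is the additive
  polynomial \<open>- \<delta>\<^sup>q + d\<delta>\<^sup>p + b\<delta> - cy\<^sup>p - ay\<close>, which vanishes at \<open>(y, \<delta>) = (s, - t)\<close>.\<close>

definition Fpoly :: "(3, 'a) mpoly" where
  "Fpoly = - (pdelta ^ q) + pscale d (pdelta ^ p * px ^ (2 * q - 2 * p))
     - pscale c (px ^ (2 * q - p) * py ^ p) + pscale b (pdelta * px ^ (2 * q - 2))
     - pscale a (px ^ (2 * q - 1) * py)"

lemma two_hpoly: "2 * hpoly = 2 * py ^ (q + 1) - px * htail"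
  by (simp add: hpoly_def right_diff_distrib half)

lemma px_exponents:
  "px ^ (2 * q - 2 * p) = px ^ q * (px ^ (q - 2 * p) :: (3, 'a) mpoly)"
  "px ^ (2 * q - p) = px ^ q * (px ^ (q - p) :: (3, 'a) mpoly)"
  "px ^ (2 * q - 2) = px ^ q * (px ^ (q - 2) :: (3, 'a) mpoly)"
  "px ^ (2 * q - 1) = px ^ q * (px ^ (q - 1) :: (3, 'a) mpoly)"
  "px ^ q = px * (px ^ (q - 1) :: (3, 'a) mpoly)"
  "px ^ (q - 1) = px * (px ^ (q - 2) :: (3, 'a) mpoly)"
  "px ^ q = px ^ p * (px ^ (q - p) :: (3, 'a) mpoly)"
  "px ^ q = (px ^ p)^2 * (px ^ (q - 2 * p) :: (3, 'a) mpoly)"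
proof -
  have add: "px ^ m = px ^ n * (px ^ k :: (3, 'a) mpoly)" if "m = n + k" for m n k
    by (simp add: that power_add)
  show "px ^ (2 * q - 2 * p) = px ^ q * (px ^ (q - 2 * p) :: (3, 'a) mpoly)"
    "px ^ (2 * q - p) = px ^ q * (px ^ (q - p) :: (3, 'a) mpoly)"
    "px ^ (2 * q - 2) = px ^ q * (px ^ (q - 2) :: (3, 'a) mpoly)"
    "px ^ (2 * q - 1) = px ^ q * (px ^ (q - 1) :: (3, 'a) mpoly)"
    by (rule add, use q_ge p_gt_2 in linarith)+
  show "px ^ q = px * (px ^ (q - 1) :: (3, 'a) mpoly)"
    using add[of q 1 "q - 1"] q_ge by simp
  show "px ^ (q - 1) = px * (px ^ (q - 2) :: (3, 'a) mpoly)"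
    using add[of "q - 1" 1 "q - 2"] q_ge p_gt_2 by (simp add: numeral_2_eq_2 Suc_diff_Suc)
  show "px ^ q = px ^ p * (px ^ (q - p) :: (3, 'a) mpoly)"
    by (rule add) (use q_ge in linarith)
  show "px ^ q = (px ^ p)^2 * (px ^ (q - 2 * p) :: (3, 'a) mpoly)"
    using add[of q "2 * p" "q - 2 * p"] q_ge by (simp add: mult.commute flip: power_mult)
qed

text \<open>This is the division by \<open>2x\<^bsup>q-2p\<^esup>\<close> and \<open>x\<^bsup>2p-1\<^esup>\<close> that defines the third generator. It
  makes \<open>Fpoly\<close> an element of \<open>\<bold>F[x, N, h]\<close>, and it makes \<open>h\<close> invariant because \<open>N\<close> and \<open>Fpoly\<close>
  are.\<close>

lemma normY_sq_plus_Fpoly: "normY ^ 2 + Fpoly = - (2 * px ^ (q - 1) * hpoly)"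
proof -
  define Y Z w :: "(3, 'a) mpoly" where "Y = py ^ q" and "Z = pz ^ q" and "w = px ^ (q - 2)"
  have w: "px ^ (q - 1) = px * w" "px ^ q = px * (px * w)"
    unfolding w_def by (rule px_exponents(6), metis px_exponents(5,6))
  have N: "normY = Y - py * (px * w)"
    unfolding normY_def w Y_def by (rule refl)
  have D: "pdelta ^ q = Y^2 - px * (px * w) * Z"
    unfolding pdelta_def frobenius_diff power_mult_distrib w Y_def Z_def
    by (simp add: mult.commute flip: power_mult)
  have F: "Fpoly = px ^ q * (htail - Z - w * py^2) - pdelta ^ q"
    unfolding Fpoly_def htail_def px_exponents(1-4) w_def Z_def by (simp add: pscale_def algebra_simps)
  have H: "2 * hpoly = 2 * (py * Y) - px * htail"
    by (simp add: two_hpoly Y_def)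
  have "normY ^ 2 + Fpoly = - (px * w * (2 * hpoly))"
    unfolding H N F D w(2) by (simp add: algebra_simps power2_eq_square)
  then show ?thesis unfolding w(1) by (simp add: mult_ac)
qed

lemma normY_Inv: "normY \<in> Inv"
  unfolding Inv_iff
proof (intro allI impI)
  fix s t assume "(s, t) \<in> G"
  then have "pconst s ^ q = pconst s" by (simp add: G_fst flip: pconst_power)
  moreover have "px ^ q = px * (px ^ (q - 1) :: (3, 'a) mpoly)" by (rule px_exponents(5))
  ultimately show "shear s t normY = normY"
    by (simp add: normY_def shear_hom frobenius_add pscale_def power_mult_distrib algebra_simps)
qed

text \<open>By additivity the shear adds \<open>x\<^bsup>2q\<^esup>(t\<^sup>q - as - bt - cs\<^sup>p - dt\<^sup>p)\<close>, which is zero on the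
  group.\<close>

lemma Fpoly_Inv: "Fpoly \<in> Inv"
  unfolding Inv_iff
proof (intro allI impI)
  fix s t assume "(s, t) \<in> G"
  then have t: "pconst t ^ q = pconst a * pconst s + pconst b * pconst t + pconst c * pconst s ^ p
      + pconst d * pconst t ^ p"
    by (simp add: G_snd flip: pconst_power pconst_add pconst_mult)
  have d: "shear s t pdelta ^ q = pdelta ^ q - pconst t ^ q * (px ^ q) ^ 2"
    "shear s t pdelta ^ p = pdelta ^ p - pconst t ^ p * (px ^ p)^2"
    by (simp_all add: shear_pdelta frobenius_diff pscale_def power_mult_distrib mult.commute flip: power_mult)
  have e: "px ^ q * px ^ q = (px ^ p)^2 * (px ^ (2 * q - 2 * p) :: (3, 'a) mpoly)"
    "px ^ q * px ^ q = px ^ p * (px ^ (2 * q - p) :: (3, 'a) mpoly)"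
    "px ^ q * px ^ q = px^2 * (px ^ (2 * q - 2) :: (3, 'a) mpoly)"
    "px ^ q * px ^ q = px * (px ^ (2 * q - 1) :: (3, 'a) mpoly)"
    using px_exponents by (simp_all add: power2_eq_square mult_ac)
  have "shear s t Fpoly = - (pdelta ^ q - pconst t ^ q * (px ^ q) ^ 2)
     + pconst d * ((pdelta ^ p - pconst t ^ p * (px ^ p)^2) * px ^ (2 * q - 2 * p))
     - pconst c * (px ^ (2 * q - p) * (py ^ p + pconst s ^ p * px ^ p))
     + pconst b * ((pdelta - pconst t * px^2) * px ^ (2 * q - 2))
     - pconst a * (px ^ (2 * q - 1) * (py + pconst s * px))"
    unfolding Fpoly_def shear_hom d shear_px shear_py frobenius_add(1)
    by (simp add: pscale_def power_mult_distrib shear_pdelta)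
  also have "\<dots> = Fpoly + px ^ q * px ^ q * pconst t ^ q
     - pconst d * pconst t ^ p * ((px ^ p)^2 * px ^ (2 * q - 2 * p))
     - pconst c * pconst s ^ p * (px ^ p * px ^ (2 * q - p))
     - pconst b * pconst t * (px^2 * px ^ (2 * q - 2))
     - pconst a * pconst s * (px * px ^ (2 * q - 1))"
    unfolding Fpoly_def pscale_def by (simp add: algebra_simps power2_eq_square[of "px ^ q"])
  also have "\<dots> = Fpoly"
    unfolding e[symmetric] t by (simp add: algebra_simps)
  finally show "shear s t Fpoly = Fpoly" .
qed

lemma hpoly_Inv: "hpoly \<in> Inv"
proof (rule Inv_cancel)
  note S = subalgebra_Inv
  show "- (2 * px ^ (q - 1)) * hpoly \<in> Inv"
    using normY_sq_plus_Fpoly normY_Inv Fpoly_Inv subalgebra_add[OF S] subalgebra_power[OF S]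
    by (metis mult_minus_left)
  have "pscale 2 (px ^ (q - 1)) \<in> Inv" by (intro subalgebra_closed S px_Inv)
  then show "- (2 * px ^ (q - 1)) \<in> Inv"
    by (intro subalgebra_uminus[OF S]) (simp add: pscale_def)
  show "- (2 * px ^ (q - 1)) \<noteq> (0 :: (3, 'a) mpoly)" using two_neq_0 by simp
qed

end

section \<open>Lead exponents in three variables\<close>

lemma homogeneous_pvar_power: "homogeneous n (pvar v ^ n)"
  using homogeneous_power[OF homogeneous_pvar, of n] by simp

lemma homogeneous_mult': "homogeneous d f \<Longrightarrow> homogeneous e g \<Longrightarrow> d + e = n \<Longrightarrow> homogeneous n (f * g)"
  using homogeneous_mult by blast

lemma homogeneous_power': "homogeneous d f \<Longrightarrow> k * d = n \<Longrightarrow> homogeneous n (f ^ k)"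
  using homogeneous_power by blast

lemma homogeneous_pdelta: "homogeneous 2 pdelta"
  unfolding pdelta_def
  by (intro homogeneous_diff homogeneous_pvar_power homogeneous_mult'[OF homogeneous_pvar homogeneous_pvar])
    simp

lemma lookup_keys_mult_pvar: "m \<in> keys (pvar v * f) \<Longrightarrow> lookup m v > 0"
  using Poly_Mapping.keys_mult[of "pvar v" f] by (auto simp: pvar_def lookup_add)

lemma var3_cases: "v = 0 \<or> v = 1 \<or> v = 2" for v :: 3
  using exhaust_3[of v] by auto

lemma var3_less: "(0::3) < 1" "(0::3) < 2" "(1::3) < 2"
  by (simp_all add: less_bit1_def bit1.Rep_0 bit1.Rep_1 bit1.Rep_numeral)

lemma var3_less_iff: "v < 1 \<longleftrightarrow> v = 0" "v < 2 \<longleftrightarrow> v = 0 \<or> v = 1" "\<not> v < 0" for v :: 3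
proof -
  have "\<not> (1::3) < 0" "\<not> (2::3) < 0" "\<not> (2::3) < 1"
    using var3_less by (simp_all add: not_less less_imp_le)
  then show "v < 1 \<longleftrightarrow> v = 0" "v < 2 \<longleftrightarrow> v = 0 \<or> v = 1" "\<not> v < 0"
    using var3_cases[of v] var3_less by (elim disjE; simp)+
qed

text \<open>In one degree, any monomial that contains \<open>x\<close> is smaller than a power of \<open>y\<close>.\<close>

lemma lead_exp_py_power:
  fixes f :: "(3, 'a::field) mpoly"
  assumes f: "homogeneous n f" "f = py ^ n + px * A"
  shows "lead_exp f = single 1 n" "f \<noteq> 0"
proof -
  let ?m = "single 1 n :: 3 \<Rightarrow>\<^sub>0 nat"
  have "?m \<notin> keys (px * A)"
    using lookup_keys_mult_pvar[of ?m 0 A] by (auto simp: lookup_single_not_eq)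
  then have "lookup f ?m = 1"
    by (simp add: f(2) lookup_add in_keys_iff flip: pmonom_single) (simp add: pmonom_def)
  then have in_keys: "?m \<in> keys f" by (simp add: in_keys_iff)
  then show "f \<noteq> 0" by auto
  show "lead_exp f = ?m"
  proof (rule lead_exp_eqI[OF in_keys])
    fix m assume m: "m \<in> keys f" "m \<noteq> ?m"
    then have "m \<in> keys (px * A)"
      using Poly_Mapping.keys_add[of "py ^ n" "px * A"] by (auto simp: f(2) simp flip: pmonom_single)
    then have "lookup m 0 > 0" by (rule lookup_keys_mult_pvar)
    moreover have "mdeg m = n" using f(1) m(1) by (simp add: homogeneous_def)
    ultimately show "grevlex_less m ?m"
      by (auto simp: grevlex_less_def lookup_single_not_eq var3_less_iff intro!: exI[of _ 0])
  qed
qed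

text \<open>In one degree, a power of \<open>z\<close> is larger than any other monomial.\<close>

lemma lead_exp_pz_power:
  fixes f :: "(3, 'a::field) mpoly"
  assumes f: "homogeneous n f" "f = pz ^ n + px * A + py * B"
  shows "lead_exp f = single 2 n" "f \<noteq> 0"
proof -
  let ?m = "single 2 n :: 3 \<Rightarrow>\<^sub>0 nat"
  have "?m \<notin> keys (px * A)" "?m \<notin> keys (py * B)"
    using lookup_keys_mult_pvar[of ?m 0 A] lookup_keys_mult_pvar[of ?m 1 B]
    by (auto simp: lookup_single_not_eq)
  then have "lookup f ?m = 1"
    by (simp add: f(2) lookup_add in_keys_iff flip: pmonom_single) (simp add: pmonom_def)
  then have in_keys: "?m \<in> keys f" by (simp add: in_keys_iff)
  then show "f \<noteq> 0" by auto
  show "lead_exp f = ?m"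
  proof (rule lead_exp_eqI[OF in_keys])
    fix m assume m: "m \<in> keys f" "m \<noteq> ?m"
    then have "m \<in> keys (px * A) \<or> m \<in> keys (py * B)"
      using Poly_Mapping.keys_add[of "pz ^ n + px * A" "py * B"] Poly_Mapping.keys_add[of "pz ^ n" "px * A"]
      by (auto simp: f(2) simp flip: pmonom_single)
    then have "lookup m 0 > 0 \<or> lookup m 1 > 0" using lookup_keys_mult_pvar by metis
    moreover have "mdeg m = n" using f(1) m(1) by (simp add: homogeneous_def)
    moreover have "\<exists>v. lookup m v > lookup ?m v \<and> (\<forall>u<v. lookup m u = lookup ?m u)"
    proof (cases "lookup m 0 > 0")
      case True
      then show ?thesis by (auto simp: lookup_single_not_eq var3_less_iff intro!: exI[of _ 0])
    next
      case False
      with calculation(1) show ?thesis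
        by (auto simp: lookup_single_not_eq var3_less_iff intro!: exI[of _ 1])
    qed
    ultimately show "grevlex_less m ?m" by (simp add: grevlex_less_def)
  qed
qed

lemma lead_exp_pvar [simp]: "lead_exp (pvar v) = single v 1"
  by (simp add: pvar_def)

context shear_group
begin

section \<open>Invariants after inverting \<open>x\<close>\<close>

lemma normY_reduce: "py ^ q = normY + px ^ (q - 1) * py"
  by (simp add: normY_def)

lemma Fpoly_reduce: "pdelta ^ q = - Fpoly + pscale d (px ^ (2 * q - 2 * p)) * pdelta ^ p
     - pscale c (px ^ (2 * q - p)) * py ^ p + pscale b (px ^ (2 * q - 2)) * pdelta
     - pscale a (px ^ (2 * q - 1)) * py"
  by (simp add: Fpoly_def pscale_def algebra_simps)

text \<open>Up to a power of \<open>x\<close>, every polynomial can be written with coefficients in \<open>A\<close> and degree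
  less than \<open>q\<close> both in \<open>y\<close> and in \<open>\<delta>\<close> (note \<open>xz = y\<^sup>2 - \<delta>\<close>). Evaluated along the group, an
  invariant of this shape takes one value at \<open>q\<close> values of \<open>\<delta>\<close> for each of \<open>q\<close> values of \<open>y\<close>, so
  it is its constant coefficient.\<close>

lemma localisation:
  assumes A: "subalgebra A" "A \<subseteq> Inv" "px \<in> A" "normY \<in> A" "hpoly \<in> A" and f: "f \<in> Inv"
  shows "\<exists>k. px ^ k * f \<in> A"
proof -
  note AC = subalgebra_closed[OF A(1)]
  have FA: "Fpoly \<in> A"
  proof -
    have "Fpoly = - (pscale 2 (px ^ (q - 1)) * hpoly) - normY^2"
      using normY_sq_plus_Fpoly by (simp add: pscale_def eq_diff_eq add.commute)
    then show ?thesis using A by (auto intro!: AC)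
  qed
  \<comment> \<open>The \<open>A\<close>-span of the \<open>y\<^sup>i \<delta>\<^sup>j\<close> with \<open>i, j < q\<close>. It is closed under multiplication by \<open>y\<close> and by
    \<open>\<delta>\<close> because \<open>N\<close> and \<open>Fpoly\<close> express \<open>y\<^sup>q\<close> and \<open>\<delta>\<^sup>q\<close> by lower powers with coefficients in \<open>A\<close>.\<close>
  define V where "V = {(\<Sum>i<q. \<Sum>j<q. g i j * py ^ i * pdelta ^ j) | g. \<forall>i j. g i j \<in> A}"
  have V_add: "f + g \<in> V" if "f \<in> V" "g \<in> V" for f g
  proof -
    from that obtain u v where "\<forall>i j. u i j \<in> A" "\<forall>i j. v i j \<in> A"
      "f = (\<Sum>i<q. \<Sum>j<q. u i j * py ^ i * pdelta ^ j)" "g = (\<Sum>i<q. \<Sum>j<q. v i j * py ^ i * pdelta ^ j)"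
      unfolding V_def by blast
    then show ?thesis
      unfolding V_def by (intro CollectI exI[of _ "\<lambda>i j. u i j + v i j"])
        (simp add: AC sum.distrib algebra_simps)
  qed
  have V_scale: "r * f \<in> V" if "f \<in> V" "r \<in> A" for f r
  proof -
    from that obtain u where "\<forall>i j. u i j \<in> A" "f = (\<Sum>i<q. \<Sum>j<q. u i j * py ^ i * pdelta ^ j)"
      unfolding V_def by blast
    then show ?thesis
      unfolding V_def using that(2) by (intro CollectI exI[of _ "\<lambda>i j. r * u i j"])
        (simp add: AC sum_distrib_left mult.assoc)
  qed
  have V_uminus: "- f \<in> V" if "f \<in> V" for f
    using V_scale[OF that, of "- 1"] AC by simp
  have V_diff: "f - g \<in> V" if "f \<in> V" "g \<in> V" for f g
    using V_add[OF that(1) V_uminus[OF that(2)]] by simp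
  have V_base: "py ^ i * pdelta ^ j \<in> V" if "i < q" "j < q" for i j
  proof -
    have "(\<Sum>i'<q. \<Sum>j'<q. (if i' = i \<and> j' = j then 1 else 0) * py ^ i' * pdelta ^ j')
        = (\<Sum>i'<q. if i' = i then \<Sum>j'<q. if j' = j then py ^ i * pdelta ^ j else 0 else (0 :: (3, 'a) mpoly))"
      by (intro sum.cong refl) (auto simp del: sum.delta intro!: sum.cong)
    also have "\<dots> = py ^ i * pdelta ^ j" using that by simp
    finally show ?thesis
      unfolding V_def using AC
      by (intro CollectI exI[of _ "\<lambda>i' j'. if i' = i \<and> j' = j then 1 else 0"]) simp
  qed
  have V_0: "0 \<in> V" using V_scale[OF V_base[of 0 0], of 0] AC q_ge by simp
  have V_sum: "sum h S \<in> V" if "\<And>i. i \<in> S \<Longrightarrow> h i \<in> V" for h and S :: "nat set"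
    using that by (induction S rule: infinite_finite_induct) (auto simp: V_0 V_add)
  have V_induct: "r * f \<in> V" if "f \<in> V" "\<And>i j. i < q \<Longrightarrow> j < q \<Longrightarrow> r * (py ^ i * pdelta ^ j) \<in> V" for r f
  proof -
    from that(1) obtain u where u: "\<forall>i j. u i j \<in> A" "f = (\<Sum>i<q. \<Sum>j<q. u i j * py ^ i * pdelta ^ j)"
      unfolding V_def by blast
    have "r * f = (\<Sum>i<q. \<Sum>j<q. u i j * (r * (py ^ i * pdelta ^ j)))"
      by (simp add: u(2) sum_distrib_left mult_ac)
    also have "\<dots> \<in> V"
    proof (intro V_sum)
      fix i j assume "i \<in> {..<q}" "j \<in> {..<q}"
      then have "r * (py ^ i * pdelta ^ j) \<in> V" using that(2) by simp
      then show "u i j * (r * (py ^ i * pdelta ^ j)) \<in> V" using u(1) by (simp add: V_scale)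
    qed
    finally show ?thesis .
  qed
  have V_y: "py * f \<in> V" if "f \<in> V" for f
  proof (rule V_induct[OF that])
    fix i j assume ij: "i < q" "j < q"
    show "py * (py ^ i * pdelta ^ j) \<in> V"
    proof (cases "Suc i < q")
      case True
      then show ?thesis using V_base[of "Suc i" j] ij by (simp add: mult.assoc)
    next
      case False
      then have "Suc i = q" using ij by simp
      then have "py * (py ^ i * pdelta ^ j) = py ^ q * pdelta ^ j" by (auto simp: mult.assoc)
      also have "\<dots> = normY * (py ^ 0 * pdelta ^ j) + px ^ (q - 1) * (py ^ 1 * pdelta ^ j)"
        unfolding normY_reduce by (simp add: algebra_simps)
      also have "\<dots> \<in> V"
        using A ij q_ge by (intro V_base V_add V_scale) (auto intro: AC)
      finally show ?thesis .
    qed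
  qed
  have V_ypow: "py ^ n * f \<in> V" if "f \<in> V" for n f
    by (induction n) (use that V_y in \<open>simp_all add: mult.assoc\<close>)
  have V_delta: "pdelta * f \<in> V" if "f \<in> V" for f
  proof (rule V_induct[OF that])
    fix i j assume ij: "i < q" "j < q"
    show "pdelta * (py ^ i * pdelta ^ j) \<in> V"
    proof (cases "Suc j < q")
      case True
      then show ?thesis using V_base[of i "Suc j"] ij by (simp add: mult_ac)
    next
      case False
      then have "Suc j = q" using ij by simp
      then have "pdelta * (py ^ i * pdelta ^ j) = py ^ i * pdelta ^ q" by (auto simp: mult_ac)
      also have "pdelta ^ q = - (Fpoly * (py ^ 0 * pdelta ^ 0))
          + pscale d (px ^ (2 * q - 2 * p)) * (py ^ 0 * pdelta ^ p)
          - pscale c (px ^ (2 * q - p)) * (py ^ p * pdelta ^ 0)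
          + pscale b (px ^ (2 * q - 2)) * (py ^ 0 * pdelta ^ 1)
          - pscale a (px ^ (2 * q - 1)) * (py ^ 1 * pdelta ^ 0)"
        by (simp add: Fpoly_reduce)
      also have "py ^ i * \<dots> \<in> V"
        using A FA q_ge p_gt_2 by (intro V_ypow) (intro V_base V_add V_diff V_uminus V_scale, auto intro!: AC)
      finally show ?thesis .
    qed
  qed
  have "\<exists>k. px ^ k * f \<in> V"
  proof (induction f rule: mpoly_induct)
    case (const e)
    have "pconst e * (py ^ 0 * pdelta ^ 0) \<in> V" using q_ge by (intro V_base V_scale AC) auto
    then have "px ^ 0 * pconst e \<in> V" by simp
    then show ?case by blast
  next
    case (add f g)
    then obtain k l where "px ^ k * f \<in> V" "px ^ l * g \<in> V" by blast
    then have "px ^ l * (px ^ k * f) + px ^ k * (px ^ l * g) \<in> V"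
      by (intro V_add) (simp_all add: V_scale A subalgebra_power)
    also have "px ^ l * (px ^ k * f) + px ^ k * (px ^ l * g) = px ^ (k + l) * (f + g)"
      unfolding power_add distrib_left by (simp only: mult_ac)
    finally have "px ^ (k + l) * (f + g) \<in> V" .
    then show ?case by blast
  next
    case (var v f)
    then obtain k where k: "px ^ k * f \<in> V" by blast
    consider "v = 0" | "v = 1" | "v = 2" using var3_cases by blast
    then show ?case
    proof cases
      case 1
      have "px * (px ^ k * f) \<in> V" using k A(3) by (rule V_scale)
      with 1 show ?thesis by (auto simp: mult_ac intro: exI[of _ k])
    next
      case 2
      have "py * (px ^ k * f) \<in> V" using k by (rule V_y)
      with 2 show ?thesis by (auto simp: mult_ac intro: exI[of _ k])
    next
      case 3
      \<comment> \<open>\<open>xz = y\<^sup>2 - \<delta>\<close>\<close>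
      have "py * (py * (px ^ k * f)) - pdelta * (px ^ k * f) \<in> V" using k by (intro V_diff V_y V_delta)
      also have "py * (py * (px ^ k * f)) - pdelta * (px ^ k * f) = px ^ Suc k * (pz * f)"
        by (simp add: pdelta_def power2_eq_square algebra_simps)
      finally show ?thesis using 3 by blast
    qed
  qed
  then obtain k g where g: "\<And>i j. g i j \<in> A" and
    eq: "px ^ k * f = (\<Sum>i<q. \<Sum>j<q. g i j * py ^ i * pdelta ^ j)"
    unfolding V_def by blast
  have gInv: "shear s t (g i j) = g i j" if "(s, t) \<in> G" for s t i j
    using g[of i j] A(2) that Inv_iff by blast
  have orbit: "(\<Sum>j<q. (\<Sum>i<q. g i j * (py + pscale s px) ^ i) * (pdelta - pscale t (px^2)) ^ j) = px ^ k * f"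
    if "(s, t) \<in> G" for s t
  proof -
    have "px ^ k * f = shear s t (px ^ k * f)" using f that by (simp add: shear_hom Inv_iff)
    also have "\<dots> = (\<Sum>i<q. \<Sum>j<q. g i j * (py + pscale s px) ^ i * (pdelta - pscale t (px^2)) ^ j)"
      by (simp add: eq shear_hom shear_pdelta gInv[OF that])
    finally show ?thesis by (subst (asm) sum.swap) (simp add: sum_distrib_right)
  qed
  have inner: "(\<Sum>i<q. g i 0 * (py + pscale s px) ^ i) = px ^ k * f" if s: "s \<in> shifts" for s
  proof -
    have "inj_on (\<lambda>t. pdelta - pscale t (px^2 :: (3, 'a) mpoly)) (fibre s)"
      by (simp add: inj_on_def pscale_left_cancel)
    then have "card ((\<lambda>t. pdelta - pscale t (px^2 :: (3, 'a) mpoly)) ` fibre s) = q"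
      using card_fibre[OF s] by (simp add: card_image)
    then show ?thesis
      using q_ge orbit by (intro constant_coeff_eq[of q "(\<lambda>t. pdelta - pscale t (px^2)) ` fibre s"
          "\<lambda>j. \<Sum>i<q. g i j * (py + pscale s px) ^ i"]) (auto simp: fibre_def)
  qed
  have "inj_on (\<lambda>s. py + pscale s px :: (3, 'a) mpoly) shifts"
    by (simp add: inj_on_def pscale_left_cancel)
  then have "card ((\<lambda>s. py + pscale s px :: (3, 'a) mpoly) ` shifts) = q"
    using card_shifts by (simp add: card_image)
  then have "g 0 0 = px ^ k * f"
    using q_ge inner by (intro constant_coeff_eq[of q "(\<lambda>s. py + pscale s px) ` shifts"
        "\<lambda>i. g i 0"]) auto
  then show ?thesis using g by metis
qed

end

section \<open>Products of the four generators\<close>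

text \<open>The lead exponent of a product of four polynomials with lead monomials \<open>x, y\<^sup>q, y\<^bsup>q+1\<^esup>,
  z\<^bsup>q\<^sup>2\<^esup>\<close>.\<close>

definition gen_exp :: "nat \<Rightarrow> (4 \<Rightarrow>\<^sub>0 nat) \<Rightarrow> (3 \<Rightarrow>\<^sub>0 nat)" where
  "gen_exp q K = single 0 (lookup K 1) + single 1 (q * lookup K 2 + (q + 1) * lookup K 3)
     + single 2 (q^2 * lookup K 4)"

definition gen_family :: "nat \<Rightarrow> (4 \<Rightarrow> (3, 'a::field) mpoly) \<Rightarrow> bool" where
  "gen_family q b \<longleftrightarrow> (\<forall>w. b w \<noteq> 0) \<and> lead_exp (b 1) = single 0 1 \<and> lead_exp (b 2) = single 1 q
     \<and> lead_exp (b 3) = single 1 (q + 1) \<and> lead_exp (b 4) = single 2 (q^2)"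

lemma lead_exp_bprod_gens:
  assumes "gen_family q b"
  shows "lead_exp (bprod b K) = gen_exp q K"
proof (rule poly_mapping_eqI)
  fix v
  have "\<And>w. b w \<noteq> 0" using assms by (simp add: gen_family_def)
  then have "lookup (lead_exp (bprod b K)) v = (\<Sum>w\<in>UNIV. lookup K w * lookup (lead_exp (b w)) v)"
    by (rule lead_exp_bprod)
  then show "lookup (lead_exp (bprod b K)) v = lookup (gen_exp q K) v"
    using assms var3_cases[of v]
    by (auto simp: gen_family_def gen_exp_def sum_4 lookup_add lookup_single when_def)
qed

lemma lookup_gen_exp:
  "lookup (gen_exp q K) 0 = lookup K 1"
  "lookup (gen_exp q K) 1 = q * lookup K 2 + (q + 1) * lookup K 3"
  "lookup (gen_exp q K) 2 = q^2 * lookup K 4"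
  by (simp_all add: gen_exp_def lookup_add lookup_single when_def)

text \<open>The exponent of \<open>y\<close> is congruent to \<open>lookup K 3\<close> modulo \<open>q\<close>.\<close>

lemma inj_on_gen_exp:
  assumes "q > 0"
  shows "inj_on (gen_exp q) {K. lookup K 3 < q}"
proof (rule inj_onI)
  fix K L assume K: "K \<in> {K. lookup K 3 < q}" and L: "L \<in> {K. lookup K 3 < q}"
    and eq: "gen_exp q K = gen_exp q L"
  have e: "lookup K 1 = lookup L 1" "lookup K 4 = lookup L 4"
    "q * (lookup K 2 + lookup K 3) + lookup K 3 = q * (lookup L 2 + lookup L 3) + lookup L 3"
    using assms arg_cong[OF eq, of "\<lambda>m. lookup m 0"] arg_cong[OF eq, of "\<lambda>m. lookup m 2"]
      arg_cong[OF eq, of "\<lambda>m. lookup m 1"]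
    by (simp_all add: lookup_gen_exp algebra_simps)
  have "lookup K 3 = lookup L 3"
    using arg_cong[OF e(3), of "\<lambda>n. n mod q"] K L by simp
  with e(3) assms have "lookup K 2 = lookup L 2" by simp
  show "K = L"
  proof (rule poly_mapping_eqI)
    fix w show "lookup K w = lookup L w"
      using e \<open>lookup K 3 = lookup L 3\<close> \<open>lookup K 2 = lookup L 2\<close> exhaust_4[of w] by auto
  qed
qed

section \<open>The fourth invariant and the lead monomials of invariants\<close>

context shear_group
begin

text \<open>The quotient \<open>-2(h\<^sup>q - N\<^bsup>q+1\<^esup> - x\<^bsup>q-1\<^esup>N\<^bsup>q-1\<^esup>h) / x\<^sup>q\<close>, see \<open>two_power_relation\<close>. It has
  the lead monomial of the orbit product of \<open>z\<close> and replaces it in the computation of lead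
  monomials, because its relation to the other generators is known explicitly.\<close>

definition zpoly :: "(3, 'a) mpoly" where
  "zpoly = htail ^ q - normY ^ (q - 1) * htail - 2 * px ^ (q^2 - q - 1) * py ^ (q + 1)
     + 2 * px ^ (q - 2) * normY ^ (q - 1) * py^2 - 2 * normY * py ^ q * px ^ (q^2 - 2 * q)"

lemma q_sq: "q^2 \<ge> 9 * q"
  using q_ge by (simp add: power2_eq_square)

text \<open>Raising \<open>2h = 2y\<^bsup>q+1\<^esup> - x\<cdot>htail\<close> to the power \<open>q\<close> is additive and fixes \<open>2\<close>. With \<open>w =
  x\<^bsup>q-1\<^esup>\<close>, \<open>Y = y\<^sup>q\<close> and \<open>N = Y - yw\<close>, \<open>N\<^sup>q = Y\<^sup>q - Yw\<^sup>q\<close>, the rest is an identity in \<open>Y, y, w\<close>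
  and \<open>htail\<close>.\<close>

lemma two_power_relation:
  "2 * hpoly ^ q = 2 * normY ^ (q + 1) + 2 * px ^ (q - 1) * normY ^ (q - 1) * hpoly - px ^ q * zpoly"
proof -
  define Y w N :: "(3, 'a) mpoly" where "Y = py ^ q" and "w = px ^ (q - 1)" and "N = normY"
  define x y e n :: "(3, 'a) mpoly" where "x = px ^ q" and "y = py" and "e = htail" and "n = N ^ (q - 1)"
  have N: "N = Y - y * w"
    by (simp add: N_def normY_def Y_def w_def y_def)
  have Nq: "N ^ q = Y ^ q - Y * w ^ q"
    unfolding N frobenius_diff power_mult_distrib by (simp add: Y_def y_def)
  have nN: "n * N = N ^ q"
    using q_ge by (simp add: n_def flip: power_Suc2)
  have h: "2 * hpoly = 2 * (y * Y) - px * e"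
    by (simp add: two_hpoly Y_def y_def e_def)
  have "2 * hpoly ^ q = (2 * hpoly) ^ q"
    by (simp add: power_mult_distrib two_power_q)
  also have "\<dots> = 2 * (Y * Y ^ q) - x * e ^ q"
    unfolding h frobenius_diff power_mult_distrib two_power_q by (simp add: Y_def y_def x_def)
  finally have hq: "2 * hpoly ^ q = 2 * (Y * Y ^ q) - x * e ^ q" .
  have sq: "q * (q - 1) + q = q^2"
    by (cases q) (simp_all add: power2_eq_square)
  have wq: "w ^ q = px ^ (q * (q - 1))"
    by (simp add: w_def mult.commute flip: power_mult)
  have exps: "px ^ q * px ^ (q^2 - q - 1) = w * w ^ q" "px ^ q * px ^ (q - 2) = w * w"
    "px ^ q * px ^ (q^2 - 2 * q) = w ^ q" "px ^ q = px * w"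
  proof -
    have "q + (q^2 - q - 1) = (q - 1) + q * (q - 1)" "q + (q - 2) = (q - 1) + (q - 1)"
      "q + (q^2 - 2 * q) = q * (q - 1)"
      using sq q_sq q_ge by linarith+
    then show "px ^ q * px ^ (q^2 - q - 1) = w * w ^ q" "px ^ q * px ^ (q - 2) = w * w"
      "px ^ q * px ^ (q^2 - 2 * q) = w ^ q"
      unfolding wq unfolding w_def by (simp_all only: power_add[symmetric])
    show "px ^ q = px * w" unfolding w_def by (rule px_exponents(5))
  qed
  have z: "px ^ q * zpoly = x * e ^ q - n * (x * e) - 2 * (w * w ^ q) * (y * Y)
      + 2 * (w * w) * n * y^2 - 2 * N * Y * w ^ q"
  proof -
    have "X * (e ^ q - n * e - 2 * E1 * (y * Y) + 2 * E2 * n * y^2 - 2 * N * Y * E3)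
      = X * e ^ q - n * (X * e) - 2 * (X * E1) * (y * Y) + 2 * (X * E2) * n * y^2 - 2 * N * Y * (X * E3)"
      for X E1 E2 E3 :: "(3, 'a) mpoly"
      by (simp add: algebra_simps)
    moreover have "zpoly = e ^ q - n * e - 2 * px ^ (q^2 - q - 1) * (y * Y) + 2 * px ^ (q - 2) * n * y^2
        - 2 * N * Y * px ^ (q^2 - 2 * q)"
      by (simp add: zpoly_def e_def n_def N_def y_def Y_def)
    ultimately show ?thesis unfolding x_def by (simp only: exps(1-3))
  qed
  have "2 * (N * N ^ q) + w * n * (2 * hpoly) - px ^ q * zpoly = 2 * hpoly ^ q"
  proof -
    have "x = px * w" by (simp add: x_def exps)
    then have "2 * (N * N ^ q) + w * n * (2 * hpoly) - px ^ q * zpoly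
      = 2 * (N * N ^ q) + 2 * w * n * y * (Y - y * w) - x * e ^ q + 2 * (w * w ^ q) * (y * Y) + 2 * N * Y * w ^ q"
      unfolding h z by (simp add: algebra_simps power2_eq_square)
    also have "\<dots> = 2 * (N * N ^ q) + 2 * w * y * (n * N) - x * e ^ q + 2 * (w * w ^ q) * (y * Y) + 2 * N * Y * w ^ q"
      by (simp add: N algebra_simps)
    also have "\<dots> = 2 * (Y * Y ^ q) - x * e ^ q"
      unfolding nN Nq by (simp add: N algebra_simps)
    finally show ?thesis by (simp add: hq)
  qed
  then show ?thesis by (simp add: N_def n_def w_def mult_ac)
qed

lemma homogeneous_normY: "homogeneous q normY"
  unfolding normY_def using q_ge
  by (intro homogeneous_diff homogeneous_pvar_power homogeneous_mult'[OF homogeneous_pvar homogeneous_pvar_power]) simp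

lemma homogeneous_htail: "homogeneous q htail"
  unfolding htail_def using q_ge p_gt_2
  by (intro homogeneous_add homogeneous_diff homogeneous_pscale homogeneous_pvar_power
      homogeneous_mult'[OF homogeneous_pvar_power homogeneous_pvar_power]
      homogeneous_mult'[OF homogeneous_pvar_power homogeneous_pvar]
      homogeneous_mult'[OF homogeneous_pdelta homogeneous_pvar_power]
      homogeneous_mult'[OF homogeneous_power[OF homogeneous_pdelta] homogeneous_pvar_power]) simp_all

lemma homogeneous_hpoly: "homogeneous (q + 1) hpoly"
  unfolding hpoly_def
  by (intro homogeneous_diff homogeneous_pscale homogeneous_pvar_power
      homogeneous_mult'[OF homogeneous_pvar homogeneous_htail]) simp

lemma homogeneous_zpoly: "homogeneous (q^2) zpoly"
proof -
  have n: "homogeneous (q * (q - 1)) (normY ^ (q - 1))"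
    by (rule homogeneous_power'[OF homogeneous_normY]) simp
  have q2: "q^2 = q * (q - 1) + q" "q^2 = q^2 - q - 1 + (q + 1)" "q^2 = (q - 2) + q * (q - 1) + 2"
    "q^2 = q + q + (q^2 - 2 * q)"
  proof -
    show A: "q^2 = q * (q - 1) + q" by (cases q) (simp_all add: power2_eq_square)
    show "q^2 = q^2 - q - 1 + (q + 1)" "q^2 = (q - 2) + q * (q - 1) + 2"
      "q^2 = q + q + (q^2 - 2 * q)"
      using A q_ge q_sq by linarith+
  qed
  have "homogeneous (q^2) (htail ^ q)"
    by (rule homogeneous_power'[OF homogeneous_htail]) (simp add: power2_eq_square)
  moreover have "homogeneous (q^2) (normY ^ (q - 1) * htail)"
    by (rule homogeneous_mult'[OF n homogeneous_htail]) (rule q2(1)[symmetric])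
  moreover have "homogeneous (q^2) (pscale 2 (px ^ (q^2 - q - 1) * py ^ (q + 1)))"
    by (intro homogeneous_pscale homogeneous_mult'[OF homogeneous_pvar_power homogeneous_pvar_power])
      (rule q2(2)[symmetric])
  moreover have "homogeneous (q^2) (pscale 2 (px ^ (q - 2) * normY ^ (q - 1) * py^2))"
    by (intro homogeneous_pscale
        homogeneous_mult'[OF homogeneous_mult[OF homogeneous_pvar_power n] homogeneous_pvar_power])
      (rule q2(3)[symmetric])
  moreover have "homogeneous (q^2) (pscale 2 (normY * py ^ q * px ^ (q^2 - 2 * q)))"
    by (intro homogeneous_pscale
        homogeneous_mult'[OF homogeneous_mult[OF homogeneous_normY homogeneous_pvar_power] homogeneous_pvar_power])
      (rule q2(4)[symmetric])
  moreover have "zpoly = htail ^ q - normY ^ (q - 1) * htail - pscale 2 (px ^ (q^2 - q - 1) * py ^ (q + 1))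
     + pscale 2 (px ^ (q - 2) * normY ^ (q - 1) * py^2) - pscale 2 (normY * py ^ q * px ^ (q^2 - 2 * q))"
    by (simp add: zpoly_def pscale_def mult.assoc)
  ultimately show ?thesis
    by (auto intro: homogeneous_add homogeneous_diff)
qed

lemma px_dvd_power: "n > 0 \<Longrightarrow> px dvd px ^ n * f" for f :: "(3, 'a) mpoly"
  by (intro dvd_mult2 dvd_power) auto

lemma htail_eq: "\<exists>r. htail = pz ^ q + px * r"
proof -
  have "px dvd px ^ (q - 2) * (py ^ 2) + pconst d * (px ^ (q - 2 * p) * pdelta ^ p)
     - pconst c * (px ^ (q - p) * py ^ p) + pconst b * (px ^ (q - 2) * pdelta) - pconst a * (px ^ (q - 1) * py)"
    using q_ge p_gt_2 by (intro dvd_add dvd_diff px_dvd_power dvd_mult[OF px_dvd_power]) auto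
  then obtain r where "px ^ (q - 2) * (py ^ 2) + pconst d * (px ^ (q - 2 * p) * pdelta ^ p)
     - pconst c * (px ^ (q - p) * py ^ p) + pconst b * (px ^ (q - 2) * pdelta) - pconst a * (px ^ (q - 1) * py)
     = px * r" unfolding dvd_def by blast
  then have "htail = pz ^ q + px * r"
    by (simp add: htail_def pscale_def algebra_simps)
  then show ?thesis by blast
qed

lemma zpoly_eq: "\<exists>A B. zpoly = pz ^ (q^2) + px * A + py * B"
proof -
  obtain r where r: "htail = pz ^ q + px * r" using htail_eq by blast
  have "htail ^ q = pz ^ (q^2) + px ^ q * r ^ q"
    by (simp add: r frobenius_add power_mult_distrib power2_eq_square flip: power_mult)
  moreover have "px dvd px ^ q * r ^ q - px ^ (q^2 - q - 1) * (2 * py ^ (q + 1))"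
    using q_ge q_sq by (intro dvd_diff px_dvd_power) auto
  then obtain A where "px ^ q * r ^ q - px ^ (q^2 - q - 1) * (2 * py ^ (q + 1)) = px * A"
    unfolding dvd_def by blast
  moreover have "py dvd py * (2 * px ^ (q - 2) * normY ^ (q - 1) * py) - normY ^ (q - 1) * htail
      - normY * (2 * py ^ q * px ^ (q^2 - 2 * q))"
  proof -
    have "py ^ q = py * (py ^ (q - 1) :: (3, 'a) mpoly)"
      using q_ge by (simp flip: power_Suc)
    then have "normY = py * (py ^ (q - 1) - px ^ (q - 1))"
      by (simp add: normY_def algebra_simps)
    then have N: "py dvd normY" by simp
    moreover have "normY dvd normY ^ (q - 1)" using q_ge by (intro dvd_power) simp
    ultimately have "py dvd normY ^ (q - 1)" by (rule dvd_trans)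
    with N show ?thesis by (intro dvd_diff) (auto intro: dvd_mult2)
  qed
  then obtain B where "py * (2 * px ^ (q - 2) * normY ^ (q - 1) * py) - normY ^ (q - 1) * htail
      - normY * (2 * py ^ q * px ^ (q^2 - 2 * q)) = py * B"
    unfolding dvd_def by blast
  ultimately have "zpoly = pz ^ (q^2) + px * A + py * B"
    unfolding zpoly_def by (simp add: algebra_simps power2_eq_square)
  then show ?thesis by blast
qed

lemma lead_normY: "lead_exp normY = single 1 q" "normY \<noteq> 0"
proof -
  have "normY = py ^ q + px * (- (py * px ^ (q - 2)))"
    using px_exponents(6) by (simp add: normY_def mult_ac)
  from lead_exp_py_power[OF homogeneous_normY this]
  show "lead_exp normY = single 1 q" "normY \<noteq> 0" .
qed

lemma lead_hpoly: "lead_exp hpoly = single 1 (q + 1)" "hpoly \<noteq> 0"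
proof -
  have "hpoly = py ^ (q + 1) + px * (- pscale (1 / 2) htail)"
    by (simp add: hpoly_def pscale_mult_right)
  from lead_exp_py_power[OF homogeneous_hpoly this]
  show "lead_exp hpoly = single 1 (q + 1)" "hpoly \<noteq> 0" .
qed

lemma lead_zpoly: "lead_exp zpoly = single 2 (q^2)" "zpoly \<noteq> 0"
  using zpoly_eq lead_exp_pz_power[OF homogeneous_zpoly] by blast+

lemma zpoly_Inv: "zpoly \<in> Inv"
proof (rule Inv_cancel)
  note S = subalgebra_closed[OF subalgebra_Inv]
  have "px ^ q * zpoly = pscale 2 (normY ^ (q + 1)) + pscale 2 (px ^ (q - 1) * normY ^ (q - 1) * hpoly)
      - pscale 2 (hpoly ^ q)"
    using two_power_relation by (simp add: pscale_def algebra_simps)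
  also have "\<dots> \<in> Inv"
    by (intro S px_Inv normY_Inv hpoly_Inv)
  finally show "px ^ q * zpoly \<in> Inv" .
  show "px ^ q \<in> Inv" by (intro S px_Inv)
qed simp

definition gens :: "4 \<Rightarrow> (3, 'a) mpoly" where
  "gens w = (if w = 1 then px else if w = 2 then normY else if w = 3 then hpoly else zpoly)"

lemma gens_simps [simp]: "gens 1 = px" "gens 2 = normY" "gens 3 = hpoly" "gens 4 = zpoly"
  by (simp_all add: gens_def)

lemma gens_Inv: "gens w \<in> Inv"
  by (simp add: gens_def px_Inv normY_Inv hpoly_Inv zpoly_Inv)

lemma gen_family_gens: "gen_family q gens"
  unfolding gen_family_def
proof (intro conjI allI)
  fix w show "gens w \<noteq> 0" by (simp add: gens_def lead_normY lead_hpoly lead_zpoly)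
qed (simp_all add: lead_normY lead_hpoly lead_zpoly)

text \<open>Some \<open>x\<^sup>k f\<close> is a polynomial in the explicit generators. Reducing it by their relation
  shows that its lead exponent is that of a product of generators; the factor \<open>x\<^sup>k\<close> can then be
  removed from the power of \<open>x\<close> in this product.\<close>

lemma lead_exp_invariant:
  assumes f: "f \<in> Inv" "f \<noteq> 0"
  shows "\<exists>K. lead_exp f = gen_exp q K"
proof -
  let ?A = "range (psubst gens)"
  have gen: "gens w \<in> ?A" for w by (metis psubst_pvar rangeI)
  obtain k where "px ^ k * f \<in> ?A"
    using localisation[OF subalgebra_range_psubst[of gens] _ _ _ _ f(1)]
      psubst_in_subalgebra[OF subalgebra_Inv, of gens] gens_Inv gen[of 1] gen[of 2] gen[of 3] by auto
  then obtain P where P: "px ^ k * f = psubst gens P" by blast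
  \<comment> \<open>\<open>two_power_relation\<close>, solved for \<open>h\<^sup>q\<close>\<close>
  define P0 :: "(4, 'a) mpoly" where
    "P0 = pmonom (single 2 (q + 1)) + pmonom (single 1 (q - 1) + single 2 (q - 1) + single 3 1)
      - pscale (1 / 2) (pmonom (single 1 q + single 4 1))"
  let ?R = "pmonom (single 3 q) - P0"
  have "keys P0 \<subseteq> {single 2 (q + 1), single 1 (q - 1) + single 2 (q - 1) + single 3 1, single 1 q + single 4 1}"
    by (auto simp: P0_def in_keys_iff lookup_add lookup_minus pmonom_def lookup_single when_def split: if_splits)
  then have red: "reduced 3 q P0"
    using q_ge by (auto simp: reduced_def lookup_add lookup_single when_def)
  have "2 * psubst gens ?R = 0"
    using two_power_relation half[of "px ^ q * zpoly"]
    by (simp add: P0_def psubst_hom psubst_pmonom bprod_add bprod_single right_diff_distrib distrib_left mult.assoc)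
  then have R0: "psubst gens ?R = 0" using two_neq_0 by simp
  obtain Q S where QS: "P = Q * ?R + S" "reduced 3 q S"
    using division_by_monic[OF red refl] by blast
  have S: "px ^ k * f = psubst gens S" using P QS(1) R0 by (simp add: psubst_hom)
  then have "S \<noteq> 0" using f by auto
  have "\<And>w. gens w \<noteq> 0" using gen_family_gens by (simp add: gen_family_def)
  moreover have "inj_on (\<lambda>K. lead_exp (bprod gens K)) {K. lookup K 3 < q}"
    using inj_on_gen_exp[of q] q_ge by (simp add: lead_exp_bprod_gens[OF gen_family_gens])
  ultimately obtain K where "lead_exp (px ^ k * f) = lead_exp (bprod gens K)"
    using lead_exp_psubst_reduced(2)[OF _ _ QS(2) \<open>S \<noteq> 0\<close>] S by metis
  then have K: "single 0 k + lead_exp f = gen_exp q K"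
    using f by (simp add: lead_exp_bprod_gens[OF gen_family_gens] lead_exp_mult flip: pmonom_single)
  let ?L = "K - single 1 k"
  have k: "lookup K 1 = k + lookup (lead_exp f) 0"
    using arg_cong[OF K, of "\<lambda>m. lookup m 0"] by (simp add: lookup_gen_exp lookup_add)
  have "lead_exp f = gen_exp q ?L"
  proof (rule poly_mapping_eqI)
    fix v
    show "lookup (lead_exp f) v = lookup (gen_exp q ?L) v"
      using var3_cases[of v] arg_cong[OF K, of "\<lambda>m. lookup m v"] k
      by (auto simp: lookup_gen_exp lookup_add lookup_minus lookup_single when_def)
  qed
  then show ?thesis by blast
qed

text \<open>Only the lead exponents of the four invariants matter, so the explicit generators may be
  exchanged for the orbit products.\<close>

theorem sagbi_and_hypersurface:
  assumes \<beta>: "gen_family q \<beta>" "\<And>w. \<beta> w \<in> Inv"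
  shows "sagbi_basis (range \<beta>) Inv"
    and "hypersurface_by Inv \<beta> (single 3 (q :: nat)) (single 2 (q + 1))"
proof -
  have nz: "\<beta> w \<noteq> 0" for w using \<beta>(1) by (simp add: gen_family_def)
  have lead: "\<exists>K. lead_exp f = lead_exp (bprod \<beta> K)" if "f \<in> Inv" "f \<noteq> 0" for f
    using lead_exp_invariant[OF that] by (simp add: lead_exp_bprod_gens[OF \<beta>(1)])
  show "sagbi_basis (range \<beta>) Inv"
    by (rule sagbi_basisI[OF subalgebra_Inv \<beta>(2) nz lead])
  show "hypersurface_by Inv \<beta> (single 3 q) (single 2 (q + 1))"
  proof (rule hypersurface_byI[OF subalgebra_Inv \<beta>(2) nz lead])
    show "inj_on (\<lambda>K. lead_exp (bprod \<beta> K)) {K. lookup K 3 < q}"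
      using inj_on_gen_exp[of q] q_ge by (simp add: lead_exp_bprod_gens[OF \<beta>(1)])
    show "lookup (single 2 (q + 1) :: 4 \<Rightarrow>\<^sub>0 nat) 3 < q" using q_ge by (simp add: lookup_single when_def)
    show "lead_exp (bprod \<beta> (single 3 q)) = lead_exp (bprod \<beta> (single 2 (q + 1)))"
      by (simp add: lead_exp_bprod_gens[OF \<beta>(1)] gen_exp_def lookup_single when_def)
  qed
qed

end

section \<open>Four by four determinants\<close>

lemma det_4:
  "det (A :: 'a::comm_ring_1^4^4) =
    A$1$1 * (A$2$2 * A$3$3 * A$4$4 + A$2$3 * A$3$4 * A$4$2 + A$2$4 * A$3$2 * A$4$3
      - A$2$2 * A$3$4 * A$4$3 - A$2$3 * A$3$2 * A$4$4 - A$2$4 * A$3$3 * A$4$2)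
  - A$1$2 * (A$2$1 * A$3$3 * A$4$4 + A$2$3 * A$3$4 * A$4$1 + A$2$4 * A$3$1 * A$4$3
      - A$2$1 * A$3$4 * A$4$3 - A$2$3 * A$3$1 * A$4$4 - A$2$4 * A$3$3 * A$4$1)
  + A$1$3 * (A$2$1 * A$3$2 * A$4$4 + A$2$2 * A$3$4 * A$4$1 + A$2$4 * A$3$1 * A$4$2
      - A$2$1 * A$3$4 * A$4$2 - A$2$2 * A$3$1 * A$4$4 - A$2$4 * A$3$2 * A$4$1)
  - A$1$4 * (A$2$1 * A$3$2 * A$4$3 + A$2$2 * A$3$3 * A$4$1 + A$2$3 * A$3$1 * A$4$2
      - A$2$1 * A$3$3 * A$4$2 - A$2$2 * A$3$1 * A$4$3 - A$2$3 * A$3$2 * A$4$1)"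
proof -
  have f1: "finite {2::4, 3, 4}" "1 \<notin> {2::4, 3, 4}" by auto
  have f2: "finite {3::4, 4}" "2 \<notin> {3::4, 4}" by auto
  have f3: "finite {4::4}" "3 \<notin> {4::4}" by auto
  show ?thesis
    unfolding det_def UNIV_4
    unfolding sum_over_permutations_insert[OF f1]
    unfolding sum_over_permutations_insert[OF f2]
    unfolding sum_over_permutations_insert[OF f3]
    unfolding permutes_sing
    by (simp add: sign_swap_id permutation_swap_id permutation_compose sign_compose sign_id
        swap_id_eq algebra_simps)
qed

lemma vector_4 [simp]:
  "(vector [x, y, z, w] :: 'a::zero^4) $ 1 = x"
  "(vector [x, y, z, w] :: 'a::zero^4) $ 2 = y"
  "(vector [x, y, z, w] :: 'a::zero^4) $ 3 = z"
  "(vector [x, y, z, w] :: 'a::zero^4) $ 4 = w"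
  unfolding vector_def by simp_all

lemma det_vector_mult:
  fixes B :: "'a::field^4^4"
  shows "det (vector [a v* B, b v* B, c v* B, d v* B]) = det (vector [a, b, c, d]) * det B"
proof -
  have "(vector [a v* B, b v* B, c v* B, d v* B] :: 'a^4^4) = vector [a, b, c, d] ** B"
    by (simp add: vec_eq_iff forall_4 matrix_matrix_mult_def vector_matrix_mult_def mult.commute)
  then show ?thesis by (simp add: det_mul)
qed

lemma row_combination_exists:
  fixes B :: "'a::field^4^4"
  assumes "det B \<noteq> 0"
  shows "\<exists>w. r = w v* B"
proof -
  from assms obtain C where "C ** B = mat 1"
    unfolding invertible_det_nz[symmetric] invertible_def by blast
  then have "r = (r v* C) v* B" by (simp add: vector_matrix_mul_assoc)
  then show ?thesis by blast
qed

lemma det_neq_0_iff_kernel: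
  fixes B :: "'a::field^4^4"
  shows "det B \<noteq> 0 \<longleftrightarrow> (\<forall>x. B *v x = 0 \<longrightarrow> x = 0)"
  by (metis invertible_det_nz invertible_left_inverse matrix_left_invertible_ker)

section \<open>The minor conditions\<close>

definition twist :: "nat \<Rightarrow> 'a::field^4 \<Rightarrow> 'a^4" where
  "twist n r = (\<chi> j. r$j ^ n)"

text \<open>For a matrix with \<open>\<gamma>\<^sub>1\<^sub>2\<^sub>3\<^sub>4 \<noteq> 0\<close> these rows are a basis in which all further rows of
  \<open>\<Gamma>(M)\<close> are expanded.\<close>

definition frame :: "nat \<Rightarrow> 'a::field^4^2 \<Rightarrow> 'a^4^4" where
  "frame p M = vector [M$1, M$2, twist p (M$1), twist p (M$2)]"

lemma Gamma_row_eq: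
  "Gamma_row p M 1 = M$1" "Gamma_row p M 2 = M$2"
  "Gamma_row p M 3 = twist p (M$1)" "Gamma_row p M 4 = twist p (M$2)"
  "Gamma_row p M 5 = twist (p^2) (M$1)" "Gamma_row p M 6 = twist (p^2) (M$2)"
  "Gamma_row p M 7 = twist (p^3) (M$1)"
  by (simp_all add: Gamma_row_def twist_def vec_eq_iff)

lemma gam_1234: "gam p M 1 2 3 4 = det (frame p M)"
  unfolding gam_def Gamma_row_eq frame_def by (rule refl)

lemma frame_rows:
  "vector [1, 0, 0, 0] v* frame p M = M$1"
  "vector [0, 1, 0, 0] v* frame p M = M$2"
  "vector [0, 0, 1, 0] v* frame p M = twist p (M$1)"
  "vector [0, 0, 0, 1] v* frame p M = twist p (M$2)"
  by (simp_all add: vec_eq_iff vector_matrix_mult_def sum_4 frame_def)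

lemma Gamma_row_frame:
  "Gamma_row p M 1 = vector [1, 0, 0, 0] v* frame p M"
  "Gamma_row p M 2 = vector [0, 1, 0, 0] v* frame p M"
  "Gamma_row p M 3 = vector [0, 0, 1, 0] v* frame p M"
  "Gamma_row p M 4 = vector [0, 0, 0, 1] v* frame p M"
  by (simp_all only: Gamma_row_eq frame_rows)

lemma vector_mult_frame:
  "w v* frame p M = w$1 *s (M$1) + w$2 *s (M$2) + w$3 *s (twist p (M$1)) + w$4 *s (twist p (M$2))"
  by (simp add: vec_eq_iff vector_matrix_mult_def sum_4 frame_def mult.commute)

lemma gam_rows:
  assumes "Gamma_row p M i = w1 v* frame p M" "Gamma_row p M j = w2 v* frame p M"
    "Gamma_row p M k = w3 v* frame p M" "Gamma_row p M l = w4 v* frame p M"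
  shows "gam p M i j k l = det (vector [w1, w2, w3, w4]) * gam p M 1 2 3 4"
  unfolding gam_1234 gam_def[of p M i] assms by (rule det_vector_mult)

text \<open>Minors with rows among the first four and one further row are, up to sign, the coordinates
  of that row times \<open>\<gamma>\<^sub>1\<^sub>2\<^sub>3\<^sub>4\<close> (Cramer's rule).\<close>

lemma gam_via_frame:
  assumes "Gamma_row p M 5 = w v* frame p M"
  shows "gam p M 1 2 3 5 = w$4 * gam p M 1 2 3 4"
    and "gam p M 1 2 4 5 = - w$3 * gam p M 1 2 3 4"
    and "gam p M 1 3 4 5 = w$2 * gam p M 1 2 3 4"
    and "gam p M 2 3 4 5 = - w$1 * gam p M 1 2 3 4"
proof -
  note r = Gamma_row_frame[of p M]
  show "gam p M 1 2 3 5 = w$4 * gam p M 1 2 3 4"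
    using gam_rows[OF r(1,2,3) assms] by (simp add: det_4)
  show "gam p M 1 2 4 5 = - w$3 * gam p M 1 2 3 4"
    using gam_rows[OF r(1,2,4) assms] by (simp add: det_4)
  show "gam p M 1 3 4 5 = w$2 * gam p M 1 2 3 4"
    using gam_rows[OF r(1,3,4) assms] by (simp add: det_4)
  show "gam p M 2 3 4 5 = - w$1 * gam p M 1 2 3 4"
    using gam_rows[OF r(2,3,4) assms] by (simp add: det_4)
qed

lemma gam_via_frame_6:
  assumes "Gamma_row p M 6 = w v* frame p M"
  shows "gam p M 1 2 3 6 = w$4 * gam p M 1 2 3 4"
    and "gam p M 1 2 4 6 = - w$3 * gam p M 1 2 3 4"
    and "gam p M 1 3 4 6 = w$2 * gam p M 1 2 3 4"
    and "gam p M 2 3 4 6 = - w$1 * gam p M 1 2 3 4"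
proof -
  note r = Gamma_row_frame[of p M]
  show "gam p M 1 2 3 6 = w$4 * gam p M 1 2 3 4"
    using gam_rows[OF r(1,2,3) assms] by (simp add: det_4)
  show "gam p M 1 2 4 6 = - w$3 * gam p M 1 2 3 4"
    using gam_rows[OF r(1,2,4) assms] by (simp add: det_4)
  show "gam p M 1 3 4 6 = w$2 * gam p M 1 2 3 4"
    using gam_rows[OF r(1,3,4) assms] by (simp add: det_4)
  show "gam p M 2 3 4 6 = - w$1 * gam p M 1 2 3 4"
    using gam_rows[OF r(2,3,4) assms] by (simp add: det_4)
qed

text \<open>The pairing of a row with an exponent vector: the parameter by which a group element
  acts.\<close>

definition row_value :: "'a::field^4 \<Rightarrow> nat^4 \<Rightarrow> 'a" where
  "row_value r e = (\<Sum>j\<in>UNIV. of_nat (e$j) * r$j)"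

text \<open>The type argument ties the locale to the field whose characteristic is \<open>p\<close>.\<close>

locale odd_char =
  fixes p :: nat and field_type :: "'a::field itself"
  assumes prime_p: "prime p" and p_gt_2: "p > 2" and char_p: "CHAR('a) = p"
begin

lemma frob_add: "(x + y) ^ p = x ^ p + y ^ p" for x y :: 'a
  by (rule freshmans_dream) (simp_all add: prime_p char_p)

lemma frob_sum: "(\<Sum>i\<in>S. f i) ^ p = (\<Sum>i\<in>S. f i ^ p)" for f :: "'i \<Rightarrow> 'a"
  by (rule freshmans_dream_sum) (simp_all add: prime_p char_p)

lemma odd_p: "odd p"
  using prime_p p_gt_2 by (simp add: prime_odd_nat)

lemma frob_of_nat: "(of_nat n :: 'a) ^ p = of_nat n"
proof (induction n)
  case 0
  then show ?case using p_gt_2 by simp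
qed (simp add: frob_add)

lemma frob_Ints: "(x :: 'a) \<in> \<int> \<Longrightarrow> x ^ p = x"
proof (erule Ints_cases)
  fix z assume "x = of_int z"
  then show ?thesis
    using odd_p by (cases z rule: int_cases2) (simp_all add: frob_of_nat)
qed

text \<open>By Fermat \<open>x\<^sup>p = x\<close>, so the inverse is the power \<open>x\<^bsup>p-2\<^esup>\<close>.\<close>

lemma inverse_Ints:
  assumes "(x :: 'a) \<in> \<int>"
  shows "inverse x \<in> \<int>"
proof (cases "x = 0")
  case False
  obtain m where m: "p = m + 2" using p_gt_2 le_Suc_ex[of 2 p] by (auto simp: add.commute)
  have "(x ^ m * x) * x = 1 * x"
    using frob_Ints[OF assms] by (simp add: m power_add power2_eq_square mult_ac)
  then have "x ^ m * x = 1" using False unfolding mult_cancel_right by blast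
  then have "inverse x = x ^ m" by (metis inverse_unique mult.commute)
  then show ?thesis using assms by simp
qed simp

text \<open>The first two conditions put \<open>u\<^sup>q\<close> into the span of \<open>u\<close> and \<open>v\<close>. If \<open>u\<^sup>q = \<alpha>u + \<beta>v\<close>, then
  the seventh row is \<open>\<alpha>\<^sup>pu\<^sup>p + \<beta>\<^sup>pv\<^sup>p\<close>, and the last condition becomes \<open>\<beta>\<^bsup>p+1\<^esup> = 0\<close>.\<close>

lemma minor_conditions_iff:
  fixes M :: "'a^4^2"
  shows "minor_conditions p M \<longleftrightarrow> gam p M 1 2 3 4 \<noteq> 0 \<and> (\<exists>\<alpha>. twist (p^2) (M$1) = \<alpha> *s (M$1))"
proof -
  let ?g = "gam p M 1 2 3 4"
  have row7: "Gamma_row p M 7 = vector [0, 0, w$1 ^ p, w$2 ^ p] v* frame p M"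
    if "Gamma_row p M 5 = w v* frame p M" "w$3 = 0" "w$4 = 0" for w
  proof -
    have "M$1$j ^ (p^3) = (M$1$j ^ (p^2)) ^ p" for j
      by (simp add: power_mult[symmetric] power2_eq_square power3_eq_cube)
    moreover have "M$1$j ^ (p^2) = w$1 * M$1$j + w$2 * M$2$j" for j
      using that by (simp add: Gamma_row_eq vector_mult_frame twist_def vec_eq_iff)
    ultimately show ?thesis
      by (simp add: Gamma_row_eq vector_mult_frame twist_def vec_eq_iff frob_add power_mult_distrib)
  qed
  have g1357: "gam p M 1 3 5 7 = - w$2 * w$2 ^ p * ?g"
    if "Gamma_row p M 5 = w v* frame p M" "w$3 = 0" "w$4 = 0" for w
    using gam_rows[OF Gamma_row_frame(1,3)[of p M] that(1) row7[OF that]] that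
    by (simp add: det_4)
  show ?thesis
  proof
    assume m: "minor_conditions p M"
    then have g: "?g \<noteq> 0" by (simp add: minor_conditions_def)
    then obtain w where w: "Gamma_row p M 5 = w v* frame p M"
      using row_combination_exists unfolding gam_1234 by blast
    have "w$4 = 0" "w$3 = 0"
      using m g gam_via_frame(1,2)[OF w] by (simp_all add: minor_conditions_def)
    moreover from this have "w$2 = 0"
      using m g g1357[OF w] by (auto simp: minor_conditions_def)
    ultimately have "twist (p^2) (M$1) = w$1 *s (M$1)"
      using w by (simp add: Gamma_row_eq vector_mult_frame)
    with g show "?g \<noteq> 0 \<and> (\<exists>\<alpha>. twist (p^2) (M$1) = \<alpha> *s (M$1))" by blast
  next
    assume "?g \<noteq> 0 \<and> (\<exists>\<alpha>. twist (p^2) (M$1) = \<alpha> *s (M$1))"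
    then obtain \<alpha> where g: "?g \<noteq> 0" and "twist (p^2) (M$1) = \<alpha> *s (M$1)" by blast
    then have w: "Gamma_row p M 5 = vector [\<alpha>, 0, 0, 0] v* frame p M"
      by (simp add: Gamma_row_eq vector_mult_frame)
    show "minor_conditions p M"
      using g gam_via_frame[OF w] g1357[OF w] p_gt_2 by (simp add: minor_conditions_def)
  qed
qed

section \<open>The normal form\<close>

lemma of_nat_inj:
  assumes "(of_nat m :: 'a) = of_nat n" "m < p" "n < p"
  shows "m = n"
proof -
  have *: "i = j" if "(of_nat i :: 'a) = of_nat j" "i \<le> j" "j < p" for i j
  proof -
    have "of_nat (j - i) = (0 :: 'a)" using that by (simp add: of_nat_diff)
    then have "p dvd j - i" by (simp add: of_nat_eq_0_iff_char_dvd char_p)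
    then show ?thesis using that by (metis diff_is_0_eq dvd_imp_le le_antisym less_imp_diff_less not_less zero_less_iff_neq_zero)
  qed
  show ?thesis using *[of m n] *[of n m] assms by (cases "m \<le> n") auto
qed

lemma row_value_frob: "row_value r e ^ p = row_value (twist p r) e" for r :: "'a^4"
  by (simp add: row_value_def frob_sum power_mult_distrib frob_of_nat twist_def)

lemma card_E_elems: "card (E_elems p) = p ^ 4"
proof -
  have *: "bij_betw ($) (E_elems p) (PiE UNIV (\<lambda>_::4. {..<p}))"
    by (rule bij_betw_byWitness[of _ vec_lambda]) (auto simp: E_elems_def)
  show "card (E_elems p) = p ^ 4"
    using bij_betw_same_card[OF *] by (simp add: card_PiE)
qed

lemma twist_frob_twice: "twist p (twist p r) = twist (p^2) r"
  by (simp add: twist_def power2_eq_square flip: power_mult)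

text \<open>The \<open>p\<^sup>4\<close> values of the pairing are roots of \<open>X\<^bsup>p\<^sup>2\<^esup> - \<alpha>X\<close>, which has at most \<open>p\<^sup>2\<close> roots;
  the difference of two exponent vectors with equal values is the dependence.\<close>

lemma exists_integral_dependence:
  fixes u :: "'a^4"
  assumes "twist (p^2) u = \<alpha> *s u"
  shows "\<exists>w. (\<forall>j. w$j \<in> \<int>) \<and> w \<noteq> 0 \<and> (\<Sum>j\<in>UNIV. u$j * w$j) = 0"
proof -
  let ?S = "{x :: 'a. x ^ (p^2) = poly [:0, \<alpha>:] x}"
  have p2: "p^2 > 1" "p^2 < p^4"
    using p_gt_2 one_less_power[of p 2] power_strict_increasing[of 2 4 p] by linarith+
  have "degree [:0, \<alpha>:] < p^2" using p2(1) p_gt_2 by simp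
  note S = card_roots_monic_le[OF this]
  have "row_value u ` E_elems p \<subseteq> ?S"
  proof (intro image_subsetI CollectI)
    fix e
    have "row_value u e ^ (p^2) = row_value (twist (p^2) u) e"
      by (simp add: power2_eq_square power_mult row_value_frob twist_frob_twice[unfolded power2_eq_square])
    then show "row_value u e ^ (p^2) = poly [:0, \<alpha>:] (row_value u e)"
      by (simp add: assms row_value_def sum_distrib_left mult_ac)
  qed
  then have "card (row_value u ` E_elems p) \<le> card ?S" using S(1) by (intro card_mono)
  also have "\<dots> < card (E_elems p)" unfolding card_E_elems using S(2) p2(2) by (rule le_less_trans)
  finally have "card (row_value u ` E_elems p) < card (E_elems p)" .
  then have "\<not> inj_on (row_value u) (E_elems p)" by (rule pigeonhole)
  then obtain e e' where e: "e \<in> E_elems p" "e' \<in> E_elems p" "e \<noteq> e'" "row_value u e = row_value u e'"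
    by (auto simp: inj_on_def)
  let ?w = "(\<chi> j. of_nat (e$j) - of_nat (e'$j)) :: 'a^4"
  have "?w \<noteq> 0"
  proof
    assume "?w = 0"
    then have "e$j = e'$j" for j
      using e(1,2) by (intro of_nat_inj) (auto simp: vec_eq_iff E_elems_def)
    with e(3) show False by (simp add: vec_eq_iff)
  qed
  moreover have "(\<Sum>j\<in>UNIV. u$j * ?w$j) = 0"
    using e(4) by (simp add: row_value_def right_diff_distrib sum_subtractf mult.commute)
  moreover have "\<forall>j. ?w$j \<in> \<int>" by simp
  ultimately show ?thesis by blast
qed

lemma GL4_mult:
  "g \<in> GL4_prime_field \<Longrightarrow> h \<in> GL4_prime_field \<Longrightarrow> g ** h \<in> (GL4_prime_field :: ('a^4^4) set)"
proof -
  assume "g \<in> GL4_prime_field" "h \<in> (GL4_prime_field :: ('a^4^4) set)"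
  then obtain g' h' where g: "\<forall>i j. g$i$j \<in> \<int>" "\<forall>i j. g'$i$j \<in> \<int>" "g ** g' = mat 1" "g' ** g = mat 1"
    and h: "\<forall>i j. h$i$j \<in> \<int>" "\<forall>i j. h'$i$j \<in> \<int>" "h ** h' = mat 1" "h' ** h = mat 1"
    by (auto simp: GL4_prime_field_def)
  have "(g ** h) ** (h' ** g') = g ** (h ** h') ** g'" "(h' ** g') ** (g ** h) = h' ** (g' ** g) ** h"
    by (simp_all only: matrix_mul_assoc)
  then have "(g ** h) ** (h' ** g') = mat 1" "(h' ** g') ** (g ** h) = mat 1"
    using g h by simp_all
  moreover have "\<forall>i j. (g ** h)$i$j \<in> \<int>" "\<forall>i j. (h' ** g')$i$j \<in> \<int>"
    using g h by (auto simp: matrix_matrix_mult_def intro!: Ints_sum Ints_mult)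
  ultimately show ?thesis unfolding GL4_prime_field_def by blast
qed

text \<open>Right multiplication by this matrix adds the combination of the columns with coefficients
  \<open>n\<close> to column \<open>k\<close>.\<close>

definition column_shear :: "4 \<Rightarrow> 'a^4 \<Rightarrow> 'a^4^4" where
  "column_shear k n = (\<chi> i l. (if i = l then 1 else 0) + (if l = k then n$i else 0))"

lemma matrix_mult_column_shear:
  "((M :: 'a^4^'r) ** column_shear k n)$r$l = M$r$l + (if l = k then \<Sum>i\<in>UNIV. M$r$i * n$i else 0)"
proof -
  have "(\<Sum>i\<in>UNIV. M$r$i * (if i = l then 1 else 0)) = M$r$l"
    by (simp add: if_distrib[where f = "\<lambda>x. _ * x"] cong: if_cong)
  then show ?thesis
    by (cases "l = k") (simp_all add: matrix_matrix_mult_def column_shear_def distrib_left sum.distrib)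
qed

lemma column_shear_mult:
  assumes "m$k = 0"
  shows "column_shear k n ** column_shear k m = column_shear k (n + m)"
proof -
  have "(\<Sum>i\<in>UNIV. column_shear k n $r$i * m$i) = m$r" for r
  proof -
    have "(\<Sum>i\<in>UNIV. column_shear k n $r$i * m$i) = (\<Sum>i\<in>UNIV. if i = r then m$r else 0)"
      using assms by (intro sum.cong) (auto simp: column_shear_def)
    then show ?thesis by simp
  qed
  then show ?thesis
    unfolding vec_eq_iff matrix_mult_column_shear by (simp add: column_shear_def)
qed

lemma column_shear_GL4:
  assumes "n$k = 0" "\<forall>i. n$i \<in> \<int>"
  shows "column_shear k n \<in> GL4_prime_field"
proof -
  have "column_shear k (n + - n) = mat 1"
    by (simp add: column_shear_def mat_def vec_eq_iff)
  then have "column_shear k n ** column_shear k (- n) = mat 1" "column_shear k (- n) ** column_shear k n = mat 1"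
    using column_shear_mult[of n k "- n"] column_shear_mult[of "- n" k n] assms(1) by simp_all
  moreover have "\<forall>i j. column_shear k n $i$j \<in> \<int>" "\<forall>i j. column_shear k (- n) $i$j \<in> \<int>"
    using assms(2) by (simp_all add: column_shear_def)
  ultimately show ?thesis unfolding GL4_prime_field_def by blast
qed

definition column_permutation :: "(4 \<Rightarrow> 4) \<Rightarrow> 'a^4^4" where
  "column_permutation \<pi> = (\<chi> i l. if i = \<pi> l then 1 else 0)"

lemma matrix_mult_column_permutation:
  "((M :: 'a^4^'r) ** column_permutation \<pi>)$r$l = M$r$(\<pi> l)"
  by (simp add: matrix_matrix_mult_def column_permutation_def if_distrib cong: if_cong)

lemma column_permutation_GL4:
  assumes "\<And>i. \<sigma> (\<pi> i) = i" "\<And>i. \<pi> (\<sigma> i) = i"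
  shows "column_permutation \<pi> \<in> GL4_prime_field"
proof -
  have "column_permutation \<pi> ** column_permutation \<sigma> = mat 1" "column_permutation \<sigma> ** column_permutation \<pi> = mat 1"
    unfolding vec_eq_iff matrix_mult_column_permutation
    by (simp_all add: column_permutation_def mat_def assms)
  moreover have "\<forall>i j. column_permutation \<rho> $i$j \<in> \<int>" for \<rho>
    by (simp add: column_permutation_def)
  ultimately show ?thesis unfolding GL4_prime_field_def by blast
qed

lemma frame_mult_GL4:
  assumes "\<forall>i j. g$i$j \<in> \<int>"
  shows "frame p (M ** g) = frame p M ** (g :: 'a^4^4)"
  by (simp add: vec_eq_iff forall_4 frame_def twist_def matrix_matrix_mult_def frob_sum
      power_mult_distrib frob_Ints assms)

lemma frame_basis_change:
  "frame p (basis_change c a M) =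
    vector [vector [1 / c, 0, 0, 0], vector [a / c^2, 1 / c^2, 0, 0], vector [0, 0, 1 / c ^ p, 0],
      vector [0, 0, a ^ p / (c^2) ^ p, 1 / (c^2) ^ p]] ** frame p (M :: 'a^4^2)"
  by (simp add: vec_eq_iff forall_4 frame_def twist_def matrix_matrix_mult_def sum_4 basis_change_def
      power_divide frob_add power_mult_distrib add_divide_distrib)

text \<open>Through \<open>minor_conditions_iff\<close>: the frame is multiplied by invertible matrices on both
  sides, and \<open>u\<^sup>q = \<alpha>u\<close> persists with another \<open>\<alpha>\<close>, since the entries of \<open>g\<close> are fixed by
  Frobenius.\<close>

lemma minor_conditions_admissible:
  assumes M: "minor_conditions p M" and g: "g \<in> GL4_prime_field" and c: "c \<noteq> 0"
  shows "minor_conditions p (basis_change c a (M ** g :: 'a^4^2))"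
proof -
  from M obtain \<alpha> where M0: "det (frame p M) \<noteq> 0" and \<alpha>: "twist (p^2) (M$1) = \<alpha> *s (M$1)"
    unfolding minor_conditions_iff gam_1234 by blast
  from g obtain h where int: "\<forall>i j. g$i$j \<in> \<int>" and "g ** h = mat 1" by (auto simp: GL4_prime_field_def)
  then have "det g * det h = 1" by (metis det_I det_mul)
  then have "det g \<noteq> 0" by auto
  then have "det (frame p (M ** g)) \<noteq> 0" using M0 by (simp add: frame_mult_GL4[OF int] det_mul)
  then have "det (frame p (basis_change c a (M ** g))) \<noteq> 0"
    unfolding frame_basis_change det_mul using c by (simp add: det_4)
  moreover have "twist (p^2) (basis_change c a (M ** g) $1) = (\<alpha> * c / c ^ (p^2)) *s (basis_change c a (M ** g) $1)"
  proof -
    have "(\<Sum>i\<in>UNIV. M$1$i * g$i$j) ^ (p^2) = \<alpha> * (\<Sum>i\<in>UNIV. M$1$i * g$i$j)" for j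
    proof -
      have "(\<Sum>i\<in>UNIV. M$1$i * g$i$j) ^ (p^2) = (\<Sum>i\<in>UNIV. M$1$i ^ (p^2) * g$i$j)"
        using int by (simp add: power2_eq_square power_mult frob_sum power_mult_distrib frob_Ints)
      also have "\<dots> = \<alpha> * (\<Sum>i\<in>UNIV. M$1$i * g$i$j)"
        using \<alpha> by (simp add: twist_def vec_eq_iff sum_distrib_left mult.assoc)
      finally show ?thesis .
    qed
    then show ?thesis
      using c by (simp add: vec_eq_iff twist_def basis_change_def matrix_matrix_mult_def power_divide)
  qed
  ultimately show ?thesis unfolding minor_conditions_iff gam_1234 by blast
qed

text \<open>Normalised to have entry \<open>1\<close> at \<open>k\<close>, the dependence makes column \<open>k\<close> of the first row
  zero; this column is moved to the fourth place and a column with nonzero first entry to the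
  first. Dividing by that entry and subtracting a multiple of the first row from the second
  completes the form. A zero at the remaining place would give a zero column.\<close>

lemma normal_form_exists:
  assumes M: "minor_conditions p (M :: 'a^4^2)"
  shows "\<exists>M'. admissible_change M M' \<and> normal_form M' \<and> minor_conditions p M'"
proof -
  from M obtain \<alpha> where M0: "det (frame p M) \<noteq> 0" and \<alpha>: "twist (p^2) (M$1) = \<alpha> *s (M$1)"
    unfolding minor_conditions_iff gam_1234 by blast
  obtain w where w: "\<forall>j. w$j \<in> \<int>" "w \<noteq> 0" "(\<Sum>j\<in>UNIV. M$1$j * w$j) = 0"
    using exists_integral_dependence[OF \<alpha>] by blast
  then obtain k where k: "w$k \<noteq> 0" by (auto simp: vec_eq_iff)
  \<comment> \<open>The \<open>k\<close>-th unit vector plus \<open>n\<close> is the multiple of \<open>w\<close> with entry \<open>1\<close> at \<open>k\<close>; adding the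
    columns with coefficients \<open>n\<close> to column \<open>k\<close> therefore makes its first entry zero.\<close>
  define n where "n = (\<chi> j. w$j / w$k - (if j = k then 1 else 0))"
  have n: "n$k = 0" "\<forall>j. n$j \<in> \<int>"
    using k w(1) by (simp_all add: n_def divide_inverse inverse_Ints)
  have u_n: "M$1$k + (\<Sum>j\<in>UNIV. M$1$j * n$j) = 0"
  proof -
    have "(\<Sum>j\<in>UNIV. M$1$j * n$j) = (\<Sum>j\<in>UNIV. M$1$j * w$j / w$k - (if j = k then M$1$k else 0))"
      by (intro sum.cong) (auto simp: n_def right_diff_distrib)
    also have "\<dots> = (\<Sum>j\<in>UNIV. M$1$j * w$j) / w$k - M$1$k"
      by (simp add: sum_subtractf sum_divide_distrib)
    finally show ?thesis using w(3) by simp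
  qed
  obtain j where j: "j \<noteq> k" "M$1$j \<noteq> 0"
  proof (rule ccontr)
    assume "\<not> thesis"
    with that have "\<forall>j. j \<noteq> k \<longrightarrow> M$1$j = 0" by blast
    then have "M$1$j * n$j = 0" for j using n(1) by (cases "j = k") auto
    with u_n have "M$1$k = 0" by simp
    with \<open>\<forall>j. j \<noteq> k \<longrightarrow> M$1$j = 0\<close> have "M$1$j = 0" for j by (cases "j = k") auto
    then have "det (frame p M) = 0" by (simp add: det_4 frame_def)
    with M0 show False by simp
  qed
  define j' where "j' = Transposition.transpose 4 k j"
  \<comment> \<open>A permutation that moves column \<open>k\<close> to place \<open>4\<close> and column \<open>j\<close> to place \<open>1\<close>.\<close>
  define \<pi> where "\<pi> = Transposition.transpose 4 k \<circ> Transposition.transpose 1 j'"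
  have "j' \<noteq> 4" using j(1) by (metis j'_def transpose_apply_first transpose_involutory)
  then have \<pi>: "\<pi> 4 = k" "\<pi> 1 = j"
    by (simp_all add: \<pi>_def transpose_apply_other) (simp add: j'_def)
  have P: "column_permutation \<pi> \<in> GL4_prime_field"
    by (rule column_permutation_GL4[of "Transposition.transpose 1 j' \<circ> Transposition.transpose 4 k"])
      (simp_all add: \<pi>_def)
  define g where "g = column_shear k n ** column_permutation \<pi>"
  have g: "g \<in> GL4_prime_field"
    unfolding g_def using column_shear_GL4[OF n] P by (rule GL4_mult)
  let ?N = "M ** g"
  have N: "?N$1$4 = 0" "?N$1$1 = M$1$j"
    using u_n j(1) \<pi>
    by (simp_all add: g_def matrix_mul_assoc matrix_mult_column_permutation matrix_mult_column_shear)
  let ?c = "?N$1$1" and ?a = "- ?N$2$1 / ?N$1$1"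
  let ?M' = "basis_change ?c ?a ?N"
  have c: "?c \<noteq> 0" using N j by simp
  have M': "minor_conditions p ?M'" by (rule minor_conditions_admissible[OF M g c])
  have rows: "?M'$1$1 = 1" "?M'$1$4 = 0" "?M'$2$1 = 0"
    using c N(1) by (simp_all add: basis_change_def)
  have "?M'$2$4 \<noteq> 0"
  proof
    assume "?M'$2$4 = 0"
    then have "det (frame p ?M') = 0"
      using rows(2) p_gt_2 by (simp add: det_4 frame_def twist_def power_0_left)
    with M' show False unfolding minor_conditions_iff gam_1234 by blast
  qed
  with rows have "normal_form ?M'" by (simp add: normal_form_def)
  moreover have "admissible_change M ?M'" unfolding admissible_change_def using g c by blast
  ultimately show ?thesis using M' by blast
qed

end

section \<open>Orbit products\<close>

lemma lookup_pvar: "lookup (pvar v) (single w 1) = (if v = w then 1 else 0)"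
proof -
  have "v = w" if "single v (1::nat) = single w 1"
    using arg_cong[OF that, of "\<lambda>m. lookup m v"] by (simp add: lookup_single when_def split: if_splits)
  then show ?thesis by (auto simp: pvar_def pmonom_def lookup_single when_def)
qed

context shear_group
begin

definition orbit_of :: "(3, 'a) mpoly \<Rightarrow> (3, 'a) mpoly set" where
  "orbit_of f = (\<lambda>(s, t). shear s t f) ` G"

lemma finite_orbit_of: "finite (orbit_of f)"
  by (simp add: orbit_of_def finite_G)

text \<open>Since \<open>G\<close> is closed under addition, a shear in \<open>G\<close> maps the finite orbit injectively into
  itself, hence permutes it.\<close>

lemma prod_orbit_Inv: "\<Prod>(orbit_of f) \<in> Inv"
  unfolding Inv_iff
proof (intro allI impI)
  fix s t assume st: "(s, t) \<in> G"
  have sub: "shear s t ` orbit_of f \<subseteq> orbit_of f"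
  proof (rule image_subsetI)
    fix g assume "g \<in> orbit_of f"
    then obtain s' t' where "(s', t') \<in> G" "g = shear s' t' f" by (auto simp: orbit_of_def)
    then show "shear s t g \<in> orbit_of f"
      using G_add[OF st] by (force simp: orbit_of_def shear_shear)
  qed
  have inj: "inj_on (shear s t) (orbit_of f)" by (auto intro: inj_onI dest: shear_inj)
  have "shear s t (\<Prod>(orbit_of f)) = (\<Prod>g\<in>orbit_of f. shear s t g)" by (simp add: shear_hom)
  also have "\<dots> = \<Prod>(shear s t ` orbit_of f)" using prod.reindex[OF inj, of id] by simp
  also have "shear s t ` orbit_of f = orbit_of f" using finite_orbit_of sub inj by (rule endo_inj_surj)
  finally show "shear s t (\<Prod>(orbit_of f)) = \<Prod>(orbit_of f)" .
qed

lemma lead_exp_orbit_prod: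
  assumes "\<And>s t. (s, t) \<in> G \<Longrightarrow> shear s t f \<noteq> 0 \<and> lead_exp (shear s t f) = single v 1"
  shows "\<Prod>(orbit_of f) \<noteq> 0" "lead_exp (\<Prod>(orbit_of f)) = single v (card (orbit_of f))"
proof -
  have orb: "g \<noteq> 0 \<and> lead_exp g = single v 1" if "g \<in> orbit_of f" for g
    using that assms by (auto simp: orbit_of_def)
  then show "\<Prod>(orbit_of f) \<noteq> 0" using finite_orbit_of by auto
  show "lead_exp (\<Prod>(orbit_of f)) = single v (card (orbit_of f))"
  proof (rule poly_mapping_eqI)
    fix u
    have "lookup (lead_exp (\<Prod>(orbit_of f))) u = (\<Sum>g\<in>orbit_of f. lookup (lead_exp g) u)"
      using orb by (intro lead_exp_prod[OF finite_orbit_of, where f = "\<lambda>g. g"]) auto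
    also have "\<dots> = (\<Sum>g\<in>orbit_of f. lookup (single v 1) u)"
      using orb by (intro sum.cong) auto
    finally show "lookup (lead_exp (\<Prod>(orbit_of f))) u = lookup (single v (card (orbit_of f))) u"
      by (simp add: lookup_single when_def)
  qed
qed

lemma lead_exp_orbit_prod_py: "\<Prod>(orbit_of py) \<noteq> 0" "lead_exp (\<Prod>(orbit_of py)) = single 1 q"
proof -
  have lead: "shear s t py \<noteq> 0 \<and> lead_exp (shear s t py) = single 1 1" if "(s, t) \<in> G" for s t
  proof -
    have "shear s t py = py ^ 1 + px * pconst s" by (simp add: pscale_def mult.commute)
    moreover have "homogeneous 1 (shear s t py)"
      unfolding shear_py by (intro homogeneous_add homogeneous_pscale homogeneous_pvar)
    ultimately show ?thesis using lead_exp_py_power by blast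
  qed
  have "orbit_of py = (\<lambda>s. py + pscale s px) ` shifts"
    by (force simp: orbit_of_def shifts_def image_iff)
  moreover have "inj_on (\<lambda>s. py + pscale s px :: (3, 'a) mpoly) shifts"
    by (simp add: inj_on_def pscale_left_cancel)
  ultimately have "card (orbit_of py) = q" by (simp add: card_image card_shifts)
  then show "\<Prod>(orbit_of py) \<noteq> 0" "lead_exp (\<Prod>(orbit_of py)) = single 1 q"
    using lead_exp_orbit_prod[of py 1] lead by simp_all
qed

lemma lead_exp_orbit_prod_pz: "\<Prod>(orbit_of pz) \<noteq> 0" "lead_exp (\<Prod>(orbit_of pz)) = single 2 (q^2)"
proof -
  have lead: "shear s t pz \<noteq> 0 \<and> lead_exp (shear s t pz) = single 2 1" if "(s, t) \<in> G" for s t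
  proof -
    have "shear s t pz = pz ^ 1 + px * pconst (s^2 + t) + py * pconst (2 * s)"
      by (simp add: pscale_def mult.commute add_ac)
    moreover have "homogeneous 1 (shear s t pz)"
      unfolding shear_pz by (intro homogeneous_add homogeneous_pscale homogeneous_pvar)
    ultimately show ?thesis using lead_exp_pz_power by blast
  qed
  have "inj_on (\<lambda>(s, t). shear s t pz) G"
  proof (rule inj_onI, clarify)
    fix s t s' t' :: 'a assume "shear s t pz = shear s' t' pz"
    then have eq: "lookup (shear s t pz) m = lookup (shear s' t' pz) m" for m by (rule arg_cong)
    have "2 * s = 2 * s'"
      using eq[of "single 1 1"] unfolding shear_pz lookup_add lookup_pscale lookup_pvar by simp
    then have "s = s'" using two_neq_0 by simp
    then show "s = s' \<and> t = t'"
      using eq[of "single 0 1"] unfolding shear_pz lookup_add lookup_pscale lookup_pvar by simp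
  qed
  then have "card (orbit_of pz) = q^2" by (simp add: orbit_of_def card_image card_G)
  then show "\<Prod>(orbit_of pz) \<noteq> 0" "lead_exp (\<Prod>(orbit_of pz)) = single 2 (q^2)"
    using lead_exp_orbit_prod[of pz 2] lead by simp_all
qed

end

section \<open>The action of the elementary abelian group\<close>

lemma act_gen_eq_shear: "act_gen M j = shear (M$1$j) (M$2$j)"
  by (simp add: act_gen_def shear_def)

lemma shear_funpow: "(shear s t ^^ n) f = shear (of_nat n * s) (of_nat n * t) f"
  by (induction n) (simp_all add: shear_shear algebra_simps)

lemma act_eq_shear: "act M e f = shear (row_value (M$1) e) (row_value (M$2) e) f"
  by (simp add: act_def act_gen_eq_shear shear_funpow shear_shear row_value_def sum_4 add_ac)

definition shears :: "nat \<Rightarrow> 'a::field^4^2 \<Rightarrow> ('a \<times> 'a) set" where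
  "shears p M = (\<lambda>e. (row_value (M$1) e, row_value (M$2) e)) ` E_elems p"

lemma exact_quot_eqI:
  fixes f g h :: "(3, 'a::field) mpoly"
  assumes "h * g = f" "g \<noteq> 0"
  shows "exact_quot f g = h"
  unfolding exact_quot_def using assms by (intro the_equality) auto

context odd_char
begin

lemma row_value_add: "row_value (r + r') e = row_value r e + row_value r' e" for r :: "'a^4"
  by (simp add: row_value_def distrib_left sum.distrib)

lemma row_value_scale: "row_value (x *s r) e = x * row_value r e" for r :: "'a^4"
  by (simp add: row_value_def sum_distrib_left mult_ac)

lemma row_value_frob2: "row_value r e ^ (p^2) = row_value (twist (p^2) r) e" for r :: "'a^4"
  by (simp add: power2_eq_square power_mult row_value_frob twist_frob_twice[unfolded power2_eq_square])

text \<open>The difference of the exponent vectors is annihilated by \<open>u\<close> and \<open>v\<close>, and, having entries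
  in the prime field, also by \<open>u\<^sup>p\<close> and \<open>v\<^sup>p\<close>.\<close>

lemma row_value_inj:
  assumes M: "det (frame p M) \<noteq> 0"
    and e: "e \<in> E_elems p" "e' \<in> E_elems p"
    and eq: "row_value (M$1) e = row_value (M$1) e'" "row_value (M$2 :: 'a^4) e = row_value (M$2) e'"
  shows "e = e'"
proof -
  define w :: "'a^4" where "w = (\<chi> j. of_nat (e$j) - of_nat (e'$j))"
  have *: "(\<Sum>j\<in>UNIV. r$j * w$j) = row_value r e - row_value r e'" for r :: "'a^4"
    by (simp add: w_def row_value_def right_diff_distrib sum_subtractf mult.commute)
  have "frame p M *v w = 0"
    unfolding vec_eq_iff forall_4 using eq
    by (simp add: matrix_vector_mult_def frame_def * flip: row_value_frob)
  then have "w = 0" using M det_neq_0_iff_kernel by blast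
  then have "e$j = e'$j" for j
    using e by (intro of_nat_inj) (auto simp: w_def vec_eq_iff E_elems_def)
  then show ?thesis by (simp add: vec_eq_iff)
qed

text \<open>Exponents of group elements matter only modulo \<open>p\<close>, which is why the group is closed under
  addition of parameters.\<close>

lemma row_value_reduce: "row_value r (\<chi> j. e$j mod p) = row_value r e" for r :: "'a^4"
proof -
  have "(of_nat (n mod p) :: 'a) = of_nat n" for n
  proof -
    have "(of_nat n :: 'a) = of_nat p * of_nat (n div p) + of_nat (n mod p)"
      by (metis mult_div_mod_eq of_nat_add of_nat_mult)
    moreover have "of_nat p = (0 :: 'a)" using of_nat_CHAR[where ?'a = 'a] by (simp add: char_p)
    ultimately show ?thesis by simp
  qed
  then show ?thesis by (simp add: row_value_def)
qed

text \<open>The entry \<open>1\<close> of the first row forces \<open>\<alpha> = 1\<close> in \<open>u\<^sup>q = \<alpha>u\<close>.\<close>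

lemma shear_group_shears:
  fixes M :: "'a^4^2"
  assumes nf: "normal_form M" and mc: "minor_conditions p M"
    and w: "Gamma_row p M 6 = w v* frame p M"
  shows "shear_group p (p^2) (w$1) (w$2) (w$3) (w$4) (shears p M)"
proof
  from mc obtain \<alpha> where M0: "det (frame p M) \<noteq> 0" and \<alpha>: "twist (p^2) (M$1) = \<alpha> *s (M$1)"
    unfolding minor_conditions_iff gam_1234 by blast
  have "\<alpha> = 1"
    using arg_cong[OF \<alpha>, of "\<lambda>r. r$1"] nf by (simp add: twist_def normal_form_def)
  then have u: "twist (p^2) (M$1) = M$1" using \<alpha> by simp
  show "prime p" "p > 2" "CHAR('a) = p" "p^2 = p^2" using prime_p p_gt_2 char_p by simp_all
  fix s t assume "(s, t) \<in> shears p M"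
  then obtain e where e: "e \<in> E_elems p" "s = row_value (M$1) e" "t = row_value (M$2) e"
    by (auto simp: shears_def)
  show "s ^ (p^2) = s" by (simp add: e row_value_frob2 u)
  have "twist (p^2) (M$2) = w v* frame p M" using w by (simp add: Gamma_row_eq)
  then show "t ^ (p^2) = w$1 * s + w$2 * t + w$3 * s ^ p + w$4 * t ^ p"
    by (simp add: e row_value_frob2 row_value_frob vector_mult_frame row_value_add row_value_scale)
  fix s' t' assume "(s', t') \<in> shears p M"
  then obtain e' where e': "e' \<in> E_elems p" "s' = row_value (M$1) e'" "t' = row_value (M$2) e'"
    by (auto simp: shears_def)
  let ?e = "(\<chi> j. (e$j + e'$j) mod p) :: nat^4"
  have "row_value r ?e = row_value r e + row_value r e'" for r :: "'a^4"
    using row_value_reduce[of r "\<chi> j. e$j + e'$j"]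
    by (simp add: row_value_def distrib_right sum.distrib)
  moreover have "?e \<in> E_elems p" using p_gt_2 by (simp add: E_elems_def)
  ultimately show "(s + s', t + t') \<in> shears p M"
    unfolding shears_def e e' by (metis (no_types, lifting) imageI)
next
  have "inj_on (\<lambda>e. (row_value (M$1) e, row_value (M$2) e)) (E_elems p)"
    using mc row_value_inj unfolding minor_conditions_iff gam_1234 by (auto simp: inj_on_def)
  then show "card (shears p M) = (p^2)^2"
    by (simp add: shears_def card_image card_E_elems flip: power_mult)
qed

lemma normal_form_sagbi_hypersurface:
  fixes M :: "'a^4^2"
  assumes nf: "normal_form M" and mc: "minor_conditions p M"
  shows "sagbi_basis {px, orbit_prod p M py, h2 p M, orbit_prod p M pz} (invariants p M)"
    and "hypersurface_by (invariants p M)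
      (($) (vector [px, orbit_prod p M py, h2 p M, orbit_prod p M pz] :: (3, 'a) mpoly ^ 4))
      (single 3 (p^2)) (single 2 (p^2 + 1))"
proof -
  let ?g = "gam p M 1 2 3 4"
  have g: "?g \<noteq> 0" using mc by (simp add: minor_conditions_def)
  then obtain w where w: "Gamma_row p M 6 = w v* frame p M"
    using row_combination_exists unfolding gam_1234 by blast
  interpret shear_group p "p^2" "w$1" "w$2" "w$3" "w$4" "shears p M"
    using nf mc w by (rule shear_group_shears)
  have "f \<in> invariants p M \<longleftrightarrow> f \<in> Inv" for f
    unfolding Inv_iff by (auto simp: invariants_def shears_def act_eq_shear)
  then have inv: "invariants p M = Inv" by blast
  have orbit: "orbit_prod p M f = \<Prod>(orbit_of f)" for f
    unfolding orbit_prod_def orbit_def orbit_of_def by (simp add: shears_def act_eq_shear image_image)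
  have h2: "h2 p M = hpoly"
  proof -
    from mc obtain \<alpha> where \<alpha>: "twist (p^2) (M$1) = \<alpha> *s (M$1)"
      unfolding minor_conditions_iff by blast
    have "\<alpha> = 1"
      using arg_cong[OF \<alpha>, of "\<lambda>r. r$1"] nf by (simp add: twist_def normal_form_def)
    then have row5: "Gamma_row p M 5 = vector [1, 0, 0, 0] v* frame p M"
      using \<alpha> by (simp add: Gamma_row_eq frame_rows)
    have f1: "f1 p M = pconst ?g * normY"
      unfolding f1_def gam_via_frame[OF row5] normY_def
      by (simp add: pscale_def pconst_uminus algebra_simps)
    have f12346: "f12346 p M = pconst ?g * Fpoly"
      unfolding f12346_def gam_via_frame_6[OF w] Fpoly_def
      by (simp add: pscale_def pconst_uminus pconst_mult algebra_simps)
    have exp: "px ^ (p^2 - 1) = px ^ (2 * p - 1) * (px ^ (p^2 - 2 * p) :: (3, 'a) mpoly)"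
      using q_ge p_gt_2 by (simp flip: power_add)
    have "f1 p M ^ 2 + pscale ?g (f12346 p M) = pconst ?g ^ 2 * (normY ^ 2 + Fpoly)"
      unfolding f1 f12346 by (simp add: pscale_def power2_eq_square algebra_simps)
    also have "\<dots> = (- (pconst ?g ^ 2 * px ^ (2 * p - 1) * hpoly)) * (2 * px ^ (p^2 - 2 * p))"
      unfolding normY_sq_plus_Fpoly exp by (simp add: algebra_simps)
    finally have "f2 p M = - (pconst ?g ^ 2 * px ^ (2 * p - 1) * hpoly)"
      unfolding f2_def using two_neq_0 by (intro exact_quot_eqI) simp_all
    then have "hpoly * pscale (?g ^ 2) (px ^ (2 * p - 1)) = - f2 p M"
      by (simp add: pscale_def pconst_power mult_ac)
    then show ?thesis
      unfolding h2_def using g by (intro exact_quot_eqI) simp_all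
  qed
  let ?b = "($) (vector [px, orbit_prod p M py, h2 p M, orbit_prod p M pz] :: (3, 'a) mpoly ^ 4)"
  have range: "range ?b = {px, orbit_prod p M py, h2 p M, orbit_prod p M pz}"
    by (auto simp: UNIV_4)
  have nz: "\<forall>w. ?b w \<noteq> 0"
    unfolding forall_4 by (simp add: orbit h2 lead_exp_orbit_prod_py lead_exp_orbit_prod_pz lead_hpoly)
  then have "gen_family (p^2) ?b"
    unfolding gen_family_def
    by (simp add: orbit h2 lead_exp_orbit_prod_py lead_exp_orbit_prod_pz lead_hpoly)
  moreover have "\<forall>w. ?b w \<in> Inv"
    unfolding forall_4 by (simp add: orbit h2 prod_orbit_Inv px_Inv hpoly_Inv)
  ultimately show "sagbi_basis {px, orbit_prod p M py, h2 p M, orbit_prod p M pz} (invariants p M)"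
    "hypersurface_by (invariants p M) ?b (single 3 (p^2)) (single 2 (p^2 + 1))"
    using sagbi_and_hypersurface[of ?b] unfolding inv range by simp_all
qed

end

theorem theorem9p5:
  fixes p :: nat and M :: "'a::field^4^2"
  assumes "prime p" and "p > 2" and "CHAR('a) = p"
    and "minor_conditions p M"
  shows "(\<exists>M'. admissible_change M M' \<and> normal_form M' \<and> minor_conditions p M') \<and>
    (\<forall>M' :: 'a^4^2. normal_form M' \<and> minor_conditions p M' \<longrightarrow>
       sagbi_basis {px, orbit_prod p M' py, h2 p M', orbit_prod p M' pz} (invariants p M') \<and>
       hypersurface_by (invariants p M')
         (($) (vector [px, orbit_prod p M' py, h2 p M', orbit_prod p M' pz] :: (3, 'a) mpoly ^ 4))
         (Poly_Mapping.single 3 (p^2)) (Poly_Mapping.single 2 (p^2 + 1)))"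
proof -
  interpret odd_char p "TYPE('a)" using assms by unfold_locales
  show ?thesis
    using normal_form_exists[OF assms(4)] normal_form_sagbi_hypersurface by blast
qed

end
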